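(* Let $X$ be a rack, and let $A$ be an abelian group. Then, for every integer $n\geqslant 0$, there is an isomorphism of abelian groups \[ \mathrm{HR}^{n+1}(X;A)\cong \mathrm{D}^n_X(X;A) \] between the rack cohomology of $X$ with coefficients in $A$ in degree $n+1$ and the Quillen cohomology (for the algebraic theory of racks) of $X$ with coefficients in the trivial Beck module $A\times X\to X$ in degree $n$.
   Context: **Racks.** A rack is a set $X$ with a binary operation $\rhd$ such that for every $x\in X$ the left multiplication $y\mapsto x\rhd y$ is an automorphism of $(X,\rhd)$ (a bijection with $x\rhd(y\rhd z)=(x\rhd y)\rhd(x\rhd z)$). Let $\mathbf{R}$ be the category of racks and $\mathbf{R}_X$ the slice category of racks over $X$. The forgetful functor $R$ from racks to sets has a left adjoint $L$ (free racks). **Rack cohomology.** For $n\geqslant 0$ let $\mathrm{CR}_n(X)$ be the free abelian group with basis $X^n$. Define homomorphisms $\mathrm{CR}_n(X)\to\mathrm{CR}_{n-1}(X)$ by linear extension of \[ \delta_j^0(x_1,\dots,x_n)=(x_1,\dots,\widehat{x_j},\dots,x_n),\qquad \delta_j^1(x_1,\dots,x_n)=(x_1,\dots,x_{j-1},x_j\rhd x_{j+1},\dots,x_j\rhd x_n), \] and set $\delta^i=\sum_{j=1}^n(-1)^j\delta^i_j$ and $\delta=\delta^0-\delta^1$. Then $(\mathrm{CR}_\bullet(X),\delta)$ is a chain complex, and $\mathrm{HR}^*(X;A)$ is the cohomology of the cochain complex $\mathrm{Hom}(\mathrm{CR}_\bullet(X),A)$ (homomorphisms of abelian groups). **Beck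 modules.** A Beck module over $X$ is an abelian group object in $\mathbf{R}_X$; these form the abelian category $\mathrm{Ab}(\mathbf{R}_X)$. The forgetful functor $\mathrm{Ab}(\mathbf{R}_X)\to\mathbf{R}_X$ has a left adjoint $\Omega_X$. An abelian group $A$ is regarded as a rack with the trivial operation $a\rhd b=b$; it is an abelian group object in $\mathbf{R}$, and the projection $A\times X\to X$ from the product rack is a Beck module over $X$, again denoted $A$. **Quillen cohomology.** A map of simplicial racks is a weak equivalence (or fibration) if the underlying map of simplicial sets is one in the Kan--Quillen model structure; this defines a model structure on simplicial racks. Its cofibrant objects are the retracts of free simplicial racks, where $F_\bullet$ is free if there are subsets $B_q\subseteq F_q$, preserved by the degeneracies, such that the canonical map $LB_q\to F_q$ is an isomorphism for all $q$. Choose a cofibrant replacement $F_\bullet\to X$, that is, a weak equivalence from a cofibrant simplicial rack $F_\bullet$ to the constant simplicial rack $X$ (for example $F_q=(LR)^{q+1}X$). The cotangent complex $\mathbb{L}_X(X)$ is the simplicial Beck module $\Omega_X(F_\bullet)$, obtained by applying $\Omega_X$ level-wise, each $F_q$ being an object over $X$ by means of the augmentation. For a Beck module $M$ over $X$, the group $\mathrm{D}^n_X(X;M)$ is the $n$-th cohomology ($n\geqslant 0$) of the cochain complex with $\mathrm{Hom}_{\mathrm{Ab}(\mathbf{R}_X)}(\Omega_X(F_q),M)$ in degree $q$ and differential the alternating sum of the maps induced by the simplicial face maps. It does not depend on the choice of $F_\bullet$ up to canonical isomorphism. *)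

theory Defs
  imports "HOL-Algebra.Free_Abelian_Groups"
begin

section \<open>Racks\<close>

record 'a rack = "'a partial_object" +
  act :: "['a, 'a] \<Rightarrow> 'a" (infixl "\<rhd>\<index>" 70)

locale rack =
  fixes X :: "('a, 'z) rack_scheme" (structure)
  assumes act_bij: "x \<in> carrier X \<Longrightarrow> bij_betw (\<lambda>y. x \<rhd> y) (carrier X) (carrier X)"
    and act_distrib: "\<lbrakk>x \<in> carrier X; y \<in> carrier X; z \<in> carrier X\<rbrakk>
      \<Longrightarrow> x \<rhd> (y \<rhd> z) = (x \<rhd> y) \<rhd> (x \<rhd> z)"

definition rack_hom :: "('a, 'y) rack_scheme \<Rightarrow> ('b, 'z) rack_scheme \<Rightarrow> ('a \<Rightarrow> 'b) set" where
  "rack_hom X Y = {f. f \<in> carrier X \<rightarrow> carrier Y \<and>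
     (\<forall>x\<in>carrier X. \<forall>y\<in>carrier X. f (x \<rhd>\<^bsub>X\<^esub> y) = f x \<rhd>\<^bsub>Y\<^esub> f y)}"

definition rack_iso :: "('a, 'y) rack_scheme \<Rightarrow> ('b, 'z) rack_scheme \<Rightarrow> ('a \<Rightarrow> 'b) set" where
  "rack_iso X Y = {f \<in> rack_hom X Y. bij_betw f (carrier X) (carrier Y)}"

definition ldiv :: "('a, 'z) rack_scheme \<Rightarrow> 'a \<Rightarrow> 'a \<Rightarrow> 'a" where
  "ldiv X x y = inv_into (carrier X) (\<lambda>z. x \<rhd>\<^bsub>X\<^esub> z) y"

lemma UN_class1:
  assumes "equiv A r" "t \<in> A" "equiv C r'" "\<And>t'. (t, t') \<in> r \<Longrightarrow> (f t, f t') \<in> r'"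
  shows "(\<Union>t'\<in>r `` {t}. r' `` {f t'}) = r' `` {f t}"
proof -
  have "r' `` {f t'} = r' `` {f t}" if "t' \<in> r `` {t}" for t'
    using that assms equiv_class_eq[OF assms(3), of "f t" "f t'"] by blast
  moreover have "t \<in> r `` {t}" using assms equiv_class_self by fast
  ultimately show ?thesis by blast
qed

lemma UN_class2:
  assumes "equiv A r" "t \<in> A" "equiv B s" "u \<in> B" "equiv C r'"
    "\<And>t' u'. (t, t') \<in> r \<Longrightarrow> (u, u') \<in> s \<Longrightarrow> (f t u, f t' u') \<in> r'"
  shows "(\<Union>t'\<in>r `` {t}. \<Union>u'\<in>s `` {u}. r' `` {f t' u'}) = r' `` {f t u}"
proof -
  have "r' `` {f t' u'} = r' `` {f t u}" if "t' \<in> r `` {t}" "u' \<in> s `` {u}" for t' u'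
    using that assms(6) equiv_class_eq[OF assms(5), of "f t u" "f t' u'"] by blast
  moreover have "t \<in> r `` {t}" "u \<in> s `` {u}" using assms equiv_class_self by fast+
  ultimately show ?thesis by blast
qed

lemma rack_act_closed: "\<lbrakk>rack X; x \<in> carrier X; y \<in> carrier X\<rbrakk> \<Longrightarrow> x \<rhd>\<^bsub>X\<^esub> y \<in> carrier X"
  by (meson bij_betwE rack.act_bij)

lemma rack_act_inj:
  "\<lbrakk>rack X; x \<in> carrier X; y \<in> carrier X; z \<in> carrier X; x \<rhd>\<^bsub>X\<^esub> y = x \<rhd>\<^bsub>X\<^esub> z\<rbrakk> \<Longrightarrow> y = z"
  by (metis bij_betw_inv_into_left rack.act_bij)

lemma ldiv_closed: "\<lbrakk>rack X; x \<in> carrier X; y \<in> carrier X\<rbrakk> \<Longrightarrow> ldiv X x y \<in> carrier X"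
  unfolding ldiv_def by (metis bij_betw_imp_surj_on inv_into_into rack.act_bij)

lemma act_ldiv: "\<lbrakk>rack X; x \<in> carrier X; y \<in> carrier X\<rbrakk> \<Longrightarrow> x \<rhd>\<^bsub>X\<^esub> ldiv X x y = y"
  unfolding ldiv_def by (rule bij_betw_inv_into_right[OF rack.act_bij])

lemma ldiv_act: "\<lbrakk>rack X; x \<in> carrier X; y \<in> carrier X\<rbrakk> \<Longrightarrow> ldiv X x (x \<rhd>\<^bsub>X\<^esub> y) = y"
  unfolding ldiv_def by (rule bij_betw_inv_into_left[OF rack.act_bij])

definition product_rack :: "('a, 'y) rack_scheme \<Rightarrow> ('b, 'z) rack_scheme \<Rightarrow> ('a \<times> 'b) rack" where
  "product_rack X Y = \<lparr>carrier = carrier X \<times> carrier Y,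
     act = (\<lambda>(x, y) (x', y'). (x \<rhd>\<^bsub>X\<^esub> x', y \<rhd>\<^bsub>Y\<^esub> y'))\<rparr>"

definition trivial_rack :: "'a set \<Rightarrow> 'a rack" where
  "trivial_rack S = \<lparr>carrier = S, act = (\<lambda>a b. b)\<rparr>"

subsection \<open>Free racks\<close>

text \<open>The value of the left adjoint of the forgetful functor from racks to sets at a set B:
  formal rack terms over B modulo the congruence generated by the rack axioms
  (\<open>RDiv t u\<close> is the preimage of u under left multiplication by t).
  The universal property is proved below.\<close>

datatype 'b rterm = RGen 'b | RAct "'b rterm" "'b rterm" | RDiv "'b rterm" "'b rterm"

definition rterms :: "'b set \<Rightarrow> 'b rterm set" where
  "rterms B = {t. set_rterm t \<subseteq> B}"

inductive req :: "'b set \<Rightarrow> 'b rterm \<Rightarrow> 'b rterm \<Rightarrow> bool" for B where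
  refl: "t \<in> rterms B \<Longrightarrow> req B t t"
| sym: "req B t u \<Longrightarrow> req B u t"
| trans: "\<lbrakk>req B t u; req B u v\<rbrakk> \<Longrightarrow> req B t v"
| act_cong: "\<lbrakk>req B t t'; req B u u'\<rbrakk> \<Longrightarrow> req B (RAct t u) (RAct t' u')"
| div_cong: "\<lbrakk>req B t t'; req B u u'\<rbrakk> \<Longrightarrow> req B (RDiv t u) (RDiv t' u')"
| act_div: "\<lbrakk>t \<in> rterms B; u \<in> rterms B\<rbrakk> \<Longrightarrow> req B (RAct t (RDiv t u)) u"
| div_act: "\<lbrakk>t \<in> rterms B; u \<in> rterms B\<rbrakk> \<Longrightarrow> req B (RDiv t (RAct t u)) u"
| distrib: "\<lbrakk>t \<in> rterms B; u \<in> rterms B; v \<in> rterms B\<rbrakk>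
    \<Longrightarrow> req B (RAct t (RAct u v)) (RAct (RAct t u) (RAct t v))"

definition rrel :: "'b set \<Rightarrow> ('b rterm \<times> 'b rterm) set" where
  "rrel B = {(t, u). req B t u}"

definition free_rack :: "'b set \<Rightarrow> 'b rterm set rack" where
  "free_rack B = \<lparr>carrier = rterms B // rrel B,
     act = (\<lambda>C D. \<Union>t\<in>C. \<Union>u\<in>D. rrel B `` {RAct t u})\<rparr>"

definition free_rack_unit :: "'b set \<Rightarrow> 'b \<Rightarrow> 'b rterm set" where
  "free_rack_unit B b = rrel B `` {RGen b}"

lemma req_rterms: "req B t u \<Longrightarrow> t \<in> rterms B \<and> u \<in> rterms B"
  by (induction rule: req.induct) (auto simp: rterms_def)

lemma equiv_rrel: "equiv (rterms B) (rrel B)"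
  by (intro equivI refl_onI symI transI) (auto simp: rrel_def dest: req_rterms intro: req.intros)

lemma free_rack_act:
  assumes "t \<in> rterms B" "u \<in> rterms B"
  shows "rrel B `` {t} \<rhd>\<^bsub>free_rack B\<^esub> rrel B `` {u} = rrel B `` {RAct t u}"
  unfolding free_rack_def rack.simps
  by (rule UN_class2[OF equiv_rrel _ equiv_rrel _ equiv_rrel])
    (use assms in \<open>auto simp: rrel_def intro: req.act_cong\<close>)

lemma free_rack_carrier: "carrier (free_rack B) = (\<lambda>t. rrel B `` {t}) ` rterms B"
  by (auto simp: free_rack_def quotient_def)

lemma rrel_eqI: "req B t u \<Longrightarrow> rrel B `` {t} = rrel B `` {u}"
  by (rule equiv_class_eq[OF equiv_rrel]) (simp add: rrel_def)

lemma rrel_eqD: "\<lbrakk>rrel B `` {t} = rrel B `` {u}; u \<in> rterms B\<rbrakk> \<Longrightarrow> req B t u"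
  using eq_equiv_class[OF _ equiv_rrel] by (auto simp: rrel_def)

lemma rterms_RAct [simp]: "RAct t u \<in> rterms B \<longleftrightarrow> t \<in> rterms B \<and> u \<in> rterms B"
  and rterms_RDiv [simp]: "RDiv t u \<in> rterms B \<longleftrightarrow> t \<in> rterms B \<and> u \<in> rterms B"
  and rterms_RGen [simp]: "RGen b \<in> rterms B \<longleftrightarrow> b \<in> B"
  by (auto simp: rterms_def)

lemma free_rack_is_rack: "rack (free_rack B)"
proof
  fix C assume "C \<in> carrier (free_rack B)"
  then obtain t where t: "t \<in> rterms B" "C = rrel B `` {t}" by (auto simp: free_rack_carrier)
  show "bij_betw (\<lambda>D. C \<rhd>\<^bsub>free_rack B\<^esub> D) (carrier (free_rack B)) (carrier (free_rack B))"
  proof (rule bij_betwI')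
    fix D E assume "D \<in> carrier (free_rack B)" "E \<in> carrier (free_rack B)"
    then obtain u v where uv: "u \<in> rterms B" "D = rrel B `` {u}" "v \<in> rterms B" "E = rrel B `` {v}"
      by (auto simp: free_rack_carrier)
    show "(C \<rhd>\<^bsub>free_rack B\<^esub> D = C \<rhd>\<^bsub>free_rack B\<^esub> E) = (D = E)"
    proof
      assume "C \<rhd>\<^bsub>free_rack B\<^esub> D = C \<rhd>\<^bsub>free_rack B\<^esub> E"
      then have "req B (RAct t u) (RAct t v)"
        using t uv by (auto simp: free_rack_act intro!: rrel_eqD)
      then have "req B (RDiv t (RAct t u)) (RDiv t (RAct t v))"
        using t by (intro req.div_cong req.refl)
      then have "req B u v" using t uv by (meson req.div_act req.sym req.trans)
      then show "D = E" using uv by (simp add: rrel_eqI)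
    qed simp
  next
    fix D assume "D \<in> carrier (free_rack B)"
    then obtain u where u: "u \<in> rterms B" "D = rrel B `` {u}" by (auto simp: free_rack_carrier)
    then show "C \<rhd>\<^bsub>free_rack B\<^esub> D \<in> carrier (free_rack B)"
      using t by (simp add: free_rack_act) (simp add: free_rack_carrier)
    have "D = C \<rhd>\<^bsub>free_rack B\<^esub> rrel B `` {RDiv t u}"
      using t u by (simp add: free_rack_act) (meson req.act_div req.sym rrel_eqI)
    then show "\<exists>E\<in>carrier (free_rack B). D = C \<rhd>\<^bsub>free_rack B\<^esub> E"
      using t u by (auto simp: free_rack_carrier)
  qed
next
  fix C D E assume "C \<in> carrier (free_rack B)" "D \<in> carrier (free_rack B)" "E \<in> carrier (free_rack B)"
  then obtain t u v where "t \<in> rterms B" "C = rrel B `` {t}" "u \<in> rterms B" "D = rrel B `` {u}"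
    "v \<in> rterms B" "E = rrel B `` {v}" by (auto simp: free_rack_carrier)
  then show "C \<rhd>\<^bsub>free_rack B\<^esub> (D \<rhd>\<^bsub>free_rack B\<^esub> E) =
    (C \<rhd>\<^bsub>free_rack B\<^esub> D) \<rhd>\<^bsub>free_rack B\<^esub> (C \<rhd>\<^bsub>free_rack B\<^esub> E)"
    by (simp add: free_rack_act) (meson req.distrib rrel_eqI)
qed

primrec reval :: "('a, 'z) rack_scheme \<Rightarrow> ('b \<Rightarrow> 'a) \<Rightarrow> 'b rterm \<Rightarrow> 'a" where
  "reval X f (RGen b) = f b"
| "reval X f (RAct t u) = reval X f t \<rhd>\<^bsub>X\<^esub> reval X f u"
| "reval X f (RDiv t u) = ldiv X (reval X f t) (reval X f u)"

lemma reval_closed: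
  assumes "rack X" "f \<in> B \<rightarrow> carrier X"
  shows "t \<in> rterms B \<Longrightarrow> reval X f t \<in> carrier X"
  by (induction t) (use assms in \<open>auto intro: rack_act_closed ldiv_closed\<close>)

lemma reval_req:
  assumes "rack X" "f \<in> B \<rightarrow> carrier X"
  shows "req B t u \<Longrightarrow> reval X f t = reval X f u"
  by (induction rule: req.induct)
    (use assms in \<open>auto simp: act_ldiv ldiv_act rack.act_distrib reval_closed\<close>)

theorem free_rack_universal:
  assumes X: "rack X" and f: "f \<in> B \<rightarrow> carrier X"
  shows "\<exists>!h. h \<in> rack_hom (free_rack B) X \<inter> extensional (carrier (free_rack B)) \<and>
    (\<forall>b\<in>B. h (free_rack_unit B b) = f b)"
proof (rule ex1I)
  define h where "h = (\<lambda>C\<in>carrier (free_rack B). the_elem (reval X f ` C))"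
  have h: "h (rrel B `` {t}) = reval X f t" if "t \<in> rterms B" for t
  proof -
    have "reval X f u = reval X f t" if "u \<in> rrel B `` {t}" for u
      using that reval_req[OF X f] by (auto simp: rrel_def)
    moreover have "t \<in> rrel B `` {t}" using that by (simp add: rrel_def req.refl)
    ultimately have "reval X f ` (rrel B `` {t}) = {reval X f t}" by blast
    then show ?thesis using that by (simp add: h_def free_rack_carrier)
  qed
  show "h \<in> rack_hom (free_rack B) X \<inter> extensional (carrier (free_rack B)) \<and>
    (\<forall>b\<in>B. h (free_rack_unit B b) = f b)"
  proof (intro conjI IntI ballI)
    show "h \<in> rack_hom (free_rack B) X"
      by (auto simp: rack_hom_def free_rack_carrier free_rack_act h intro: reval_closed[OF X f])
    show "h \<in> extensional (carrier (free_rack B))" by (simp add: h_def)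
    show "h (free_rack_unit B b) = f b" if "b \<in> B" for b
      using that by (simp add: free_rack_unit_def h)
  qed
  fix k assume k: "k \<in> rack_hom (free_rack B) X \<inter> extensional (carrier (free_rack B)) \<and>
    (\<forall>b\<in>B. k (free_rack_unit B b) = f b)"
  have kact: "k (C \<rhd>\<^bsub>free_rack B\<^esub> D) = k C \<rhd>\<^bsub>X\<^esub> k D" and kcl: "k C \<in> carrier X"
    if "C \<in> carrier (free_rack B)" "D \<in> carrier (free_rack B)" for C D
    using k that by (auto simp: rack_hom_def)
  have "k (rrel B `` {t}) = reval X f t" if "t \<in> rterms B" for t
    using that
  proof (induction t)
    case (RGen b)
    then show ?case using k by (simp add: free_rack_unit_def)
  next
    case (RAct t u)
    then show ?case using kact[of "rrel B `` {t}" "rrel B `` {u}"]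
      by (auto simp: free_rack_act free_rack_carrier)
  next
    case (RDiv t u)
    then have "rrel B `` {t} \<rhd>\<^bsub>free_rack B\<^esub> rrel B `` {RDiv t u} = rrel B `` {u}"
      by (simp add: free_rack_act) (meson req.act_div rrel_eqI)
    moreover have "rrel B `` {t} \<in> carrier (free_rack B)" "rrel B `` {RDiv t u} \<in> carrier (free_rack B)"
      using RDiv by (auto simp: free_rack_carrier)
    ultimately have "reval X f t \<rhd>\<^bsub>X\<^esub> k (rrel B `` {RDiv t u}) = reval X f u"
      "k (rrel B `` {RDiv t u}) \<in> carrier X"
      using kact[of "rrel B `` {t}" "rrel B `` {RDiv t u}"] kcl RDiv by auto
    then show ?case using RDiv ldiv_act[OF X reval_closed[OF X f]] by fastforce
  qed
  then have "k C = h C" if "C \<in> carrier (free_rack B)" for C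
    using that h by (auto simp: free_rack_carrier)
  then show "k = h" using k by (auto simp: h_def intro: extensionalityI)
qed

text \<open>By the universal property there is exactly one homomorphism as below, so this says that the
  canonical map from the free rack on B to X is an isomorphism.\<close>

definition free_on :: "('b, 'z) rack_scheme \<Rightarrow> 'b set \<Rightarrow> bool" where
  "free_on X B \<longleftrightarrow> B \<subseteq> carrier X \<and>
     (\<exists>h \<in> rack_iso (free_rack B) X. \<forall>b\<in>B. h (free_rack_unit B b) = b)"

section \<open>Cohomology of cochain complexes of abelian groups\<close>

definition hom_group :: "('a, 'y) monoid_scheme \<Rightarrow> ('b, 'z) monoid_scheme \<Rightarrow> ('a \<Rightarrow> 'b) monoid" where
  "hom_group G H = \<lparr>carrier = hom G H \<inter> extensional (carrier G),
     mult = (\<lambda>f g. \<lambda>x\<in>carrier G. f x \<otimes>\<^bsub>H\<^esub> g x),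
     one = (\<lambda>x\<in>carrier G. \<one>\<^bsub>H\<^esub>)\<rparr>"

text \<open>\<open>d n\<close> is the differential from \<open>C n\<close> to \<open>C (Suc n)\<close>.\<close>

definition cohomology :: "(nat \<Rightarrow> 'c monoid) \<Rightarrow> (nat \<Rightarrow> 'c \<Rightarrow> 'c) \<Rightarrow> nat \<Rightarrow> 'c set monoid" where
  "cohomology C d n =
     (C n)\<lparr>carrier := kernel (C n) (C (Suc n)) (d n)\<rparr> Mod
     (case n of 0 \<Rightarrow> {\<one>\<^bsub>C 0\<^esub>} | Suc m \<Rightarrow> d m ` carrier (C m))"

section \<open>Rack cohomology\<close>

text \<open>Tuples are lists, with positions counted from 0.\<close>

definition rack_chains :: "('x, 'z) rack_scheme \<Rightarrow> nat \<Rightarrow> ('x list \<Rightarrow>\<^sub>0 int) monoid" where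
  "rack_chains X n = free_Abelian_group {xs. length xs = n \<and> set xs \<subseteq> carrier X}"

definition rack_face0 :: "nat \<Rightarrow> 'x list \<Rightarrow> 'x list" where
  "rack_face0 i xs = take i xs @ drop (Suc i) xs"

definition rack_face1 :: "('x, 'z) rack_scheme \<Rightarrow> nat \<Rightarrow> 'x list \<Rightarrow> 'x list" where
  "rack_face1 X i xs = take i xs @ map (\<lambda>y. (xs ! i) \<rhd>\<^bsub>X\<^esub> y) (drop (Suc i) xs)"

definition rack_boundary :: "('x, 'z) rack_scheme \<Rightarrow> ('x list \<Rightarrow>\<^sub>0 int) \<Rightarrow> ('x list \<Rightarrow>\<^sub>0 int)" where
  "rack_boundary X c =
     frag_extend (\<lambda>xs. \<Sum>i<length xs. frag_cmul ((-1) ^ Suc i) (frag_of (rack_face0 i xs))) c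
   - frag_extend (\<lambda>xs. \<Sum>i<length xs. frag_cmul ((-1) ^ Suc i) (frag_of (rack_face1 X i xs))) c"

definition rack_cohomology ::
    "('x, 'z) rack_scheme \<Rightarrow> ('a, 'y) monoid_scheme \<Rightarrow> nat \<Rightarrow> (('x list \<Rightarrow>\<^sub>0 int) \<Rightarrow> 'a) set monoid" where
  "rack_cohomology X A n = cohomology (\<lambda>n. hom_group (rack_chains X n) A)
     (\<lambda>n f. compose (carrier (rack_chains X (Suc n))) f (rack_boundary X)) n"

section \<open>Simplicial sets\<close>

text \<open>\<open>face S q i\<close> and \<open>degen S q i\<close> are the i-th face and degeneracy maps defined on the
  q-simplices.\<close>

record 's simplicial_set =
  cells :: "nat \<Rightarrow> 's set"
  face :: "nat \<Rightarrow> nat \<Rightarrow> 's \<Rightarrow> 's"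
  degen :: "nat \<Rightarrow> nat \<Rightarrow> 's \<Rightarrow> 's"

locale simplicial_set =
  fixes S :: "('s, 'z) simplicial_set_scheme"
  assumes face_closed: "\<lbrakk>x \<in> cells S (Suc q); i \<le> Suc q\<rbrakk> \<Longrightarrow> face S (Suc q) i x \<in> cells S q"
    and degen_closed: "\<lbrakk>x \<in> cells S q; i \<le> q\<rbrakk> \<Longrightarrow> degen S q i x \<in> cells S (Suc q)"
    and face_face: "\<lbrakk>x \<in> cells S (Suc (Suc q)); i < j; j \<le> Suc (Suc q)\<rbrakk> \<Longrightarrow>
      face S (Suc q) i (face S (Suc (Suc q)) j x) = face S (Suc q) (j - 1) (face S (Suc (Suc q)) i x)"
    and degen_degen: "\<lbrakk>x \<in> cells S q; i \<le> j; j \<le> q\<rbrakk> \<Longrightarrow>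
      degen S (Suc q) i (degen S q j x) = degen S (Suc q) (Suc j) (degen S q i x)"
    and face_degen_less: "\<lbrakk>x \<in> cells S q; i < j; j \<le> q\<rbrakk> \<Longrightarrow>
      face S (Suc q) i (degen S q j x) = degen S (q - 1) (j - 1) (face S q i x)"
    and face_degen_eq: "\<lbrakk>x \<in> cells S q; j \<le> q\<rbrakk> \<Longrightarrow> face S (Suc q) j (degen S q j x) = x"
    and face_degen_Suc: "\<lbrakk>x \<in> cells S q; j \<le> q\<rbrakk> \<Longrightarrow> face S (Suc q) (Suc j) (degen S q j x) = x"
    and face_degen_greater: "\<lbrakk>x \<in> cells S q; Suc j < i; i \<le> Suc q\<rbrakk> \<Longrightarrow>
      face S (Suc q) i (degen S q j x) = degen S (q - 1) j (face S q (i - 1) x)"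

definition simplicial_maps ::
    "('s, 'y) simplicial_set_scheme \<Rightarrow> ('t, 'z) simplicial_set_scheme \<Rightarrow> (nat \<Rightarrow> 's \<Rightarrow> 't) set" where
  "simplicial_maps S T = {f. \<forall>q.
     f q \<in> cells S q \<rightarrow> cells T q \<and>
     (\<forall>x\<in>cells S (Suc q). \<forall>i\<le>Suc q. f q (face S (Suc q) i x) = face T (Suc q) i (f (Suc q) x)) \<and>
     (\<forall>x\<in>cells S q. \<forall>i\<le>q. f (Suc q) (degen S q i x) = degen T q i (f q x))}"

definition simplicial_product ::
    "('s, 'y) simplicial_set_scheme \<Rightarrow> ('t, 'z) simplicial_set_scheme \<Rightarrow> ('s \<times> 't) simplicial_set" where
  "simplicial_product S T = \<lparr>cells = (\<lambda>q. cells S q \<times> cells T q),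
     face = (\<lambda>q i. map_prod (face S q i) (face T q i)),
     degen = (\<lambda>q i. map_prod (degen S q i) (degen T q i))\<rparr>"

text \<open>A q-simplex of the standard m-simplex is a weakly increasing list of \<open>q + 1\<close> vertices.\<close>

definition std_simplex :: "nat \<Rightarrow> nat list simplicial_set" where
  "std_simplex m = \<lparr>cells = (\<lambda>q. {v. length v = Suc q \<and> sorted v \<and> set v \<subseteq> {..m}}),
     face = (\<lambda>q i v. take i v @ drop (Suc i) v),
     degen = (\<lambda>q i v. take (Suc i) v @ drop i v)\<rparr>"

definition kan_complex :: "('s, 'z) simplicial_set_scheme \<Rightarrow> bool" where
  "kan_complex K \<longleftrightarrow> simplicial_set K \<and>
     (\<forall>n k x. k \<le> Suc n \<and> (\<forall>i\<le>Suc n. i \<noteq> k \<longrightarrow> x i \<in> cells K n) \<and>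
        (\<forall>i j. i < j \<and> j \<le> Suc n \<and> i \<noteq> k \<and> j \<noteq> k \<and> n > 0 \<longrightarrow>
           face K n i (x j) = face K n (j - 1) (x i)) \<longrightarrow>
        (\<exists>y\<in>cells K (Suc n). \<forall>i\<le>Suc n. i \<noteq> k \<longrightarrow> face K (Suc n) i y = x i))"

definition simplicially_homotopic ::
    "('s, 'y) simplicial_set_scheme \<Rightarrow> ('t, 'z) simplicial_set_scheme \<Rightarrow>
     (nat \<Rightarrow> 's \<Rightarrow> 't) \<Rightarrow> (nat \<Rightarrow> 's \<Rightarrow> 't) \<Rightarrow> bool" where
  "simplicially_homotopic S T f g \<longleftrightarrow>
     (\<exists>H \<in> simplicial_maps (simplicial_product S (std_simplex 1)) T.
        \<forall>q. \<forall>x\<in>cells S q. H q (x, replicate (Suc q) 0) = f q x \<and> H q (x, replicate (Suc q) 1) = g q x)"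

text \<open>The weak equivalences of the Kan--Quillen model structure: a simplicial map from S to T is one
  iff for every Kan complex K it induces a bijection from homotopy classes of maps from T to K to
  homotopy classes of maps from S to K.  (Simplicial homotopy of maps into a Kan complex is an
  equivalence relation.)

  A definition cannot quantify over all types, so K ranges over all Kan complexes whose simplices
  form sets of elements of one type, which is infinite and larger than the types of simplices of
  S and T.  This is no restriction: if the bijection holds for the fibrant replacements of S and
  T given by Kan's functor Ex-infinity, then the map is invertible in the homotopy category; and
  the simplices of Ex-infinity are finite configurations of simplices, hence can be indexed by
  elements of this type.\<close>

type_synonym ('s, 't) large = "('s + 't + nat) list set"

definition weak_equivalence ::
    "('s, 'y) simplicial_set_scheme \<Rightarrow> ('t, 'z) simplicial_set_scheme \<Rightarrow> (nat \<Rightarrow> 's \<Rightarrow> 't) \<Rightarrow> bool" where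
  "weak_equivalence S T f \<longleftrightarrow> f \<in> simplicial_maps S T \<and>
     (\<forall>K :: ('s, 't) large simplicial_set. kan_complex K \<longrightarrow>
        (\<forall>g \<in> simplicial_maps S K. \<exists>h \<in> simplicial_maps T K.
           simplicially_homotopic S K (\<lambda>q. h q \<circ> f q) g) \<and>
        (\<forall>h \<in> simplicial_maps T K. \<forall>h' \<in> simplicial_maps T K.
           simplicially_homotopic S K (\<lambda>q. h q \<circ> f q) (\<lambda>q. h' q \<circ> f q) \<longrightarrow>
           simplicially_homotopic T K h h'))"

section \<open>Simplicial racks\<close>

record 'f simplicial_rack = "'f simplicial_set" +
  sact :: "nat \<Rightarrow> 'f \<Rightarrow> 'f \<Rightarrow> 'f"

definition level :: "('f, 'z) simplicial_rack_scheme \<Rightarrow> nat \<Rightarrow> 'f rack" where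
  "level F q = \<lparr>carrier = cells F q, act = sact F q\<rparr>"

locale simplicial_rack = simplicial_set F for F :: "('f, 'z) simplicial_rack_scheme" +
  assumes level_rack: "rack (level F q)"
    and face_hom: "i \<le> Suc q \<Longrightarrow> face F (Suc q) i \<in> rack_hom (level F (Suc q)) (level F q)"
    and degen_hom: "i \<le> q \<Longrightarrow> degen F q i \<in> rack_hom (level F q) (level F (Suc q))"

definition simplicial_rack_maps ::
    "('f, 'y) simplicial_rack_scheme \<Rightarrow> ('g, 'z) simplicial_rack_scheme \<Rightarrow> (nat \<Rightarrow> 'f \<Rightarrow> 'g) set" where
  "simplicial_rack_maps F G =
     {f \<in> simplicial_maps F G. \<forall>q. f q \<in> rack_hom (level F q) (level G q)}"

definition constant_simplicial_rack :: "('x, 'z) rack_scheme \<Rightarrow> 'x simplicial_rack" where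
  "constant_simplicial_rack X = \<lparr>cells = (\<lambda>q. carrier X), face = (\<lambda>q i x. x), degen = (\<lambda>q i x. x),
     sact = (\<lambda>q. act X)\<rparr>"

definition free_simplicial_rack :: "('f, 'z) simplicial_rack_scheme \<Rightarrow> bool" where
  "free_simplicial_rack F \<longleftrightarrow> simplicial_rack F \<and>
     (\<exists>B. (\<forall>q. free_on (level F q) (B q)) \<and> (\<forall>q. \<forall>i\<le>q. degen F q i ` B q \<subseteq> B (Suc q)))"

text \<open>Retracts of free simplicial racks.  The type argument is the type of the simplices of the free
  simplicial rack; it is a type variable in all uses, so that no free simplicial rack is excluded.\<close>

definition cofibrant :: "'g itself \<Rightarrow> ('f, 'z) simplicial_rack_scheme \<Rightarrow> bool" where
  "cofibrant (_ :: 'g itself) F \<longleftrightarrow> simplicial_rack F \<and>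
     (\<exists>G :: 'g simplicial_rack. free_simplicial_rack G \<and>
        (\<exists>i \<in> simplicial_rack_maps F G. \<exists>r \<in> simplicial_rack_maps G F.
           \<forall>q. \<forall>x\<in>cells F q. r q (i q x) = x))"

definition cofibrant_replacement ::
    "'g itself \<Rightarrow> ('x, 'z) rack_scheme \<Rightarrow> ('f, 'w) simplicial_rack_scheme \<Rightarrow> (nat \<Rightarrow> 'f \<Rightarrow> 'x) \<Rightarrow> bool" where
  "cofibrant_replacement T X F \<epsilon> \<longleftrightarrow> cofibrant T F \<and>
     \<epsilon> \<in> simplicial_rack_maps F (constant_simplicial_rack X) \<and>
     weak_equivalence F (constant_simplicial_rack X) \<epsilon>"

section \<open>Beck modules\<close>

definition slice_hom ::
    "('y, 'u) rack_scheme \<Rightarrow> ('y \<Rightarrow> 'x) \<Rightarrow> ('z, 'v) rack_scheme \<Rightarrow> ('z \<Rightarrow> 'x) \<Rightarrow> ('y \<Rightarrow> 'z) set" where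
  "slice_hom Y p Z r = {f \<in> rack_hom Y Z. \<forall>y\<in>carrier Y. r (f y) = p y}"

definition fibre_product ::
    "('y, 'u) rack_scheme \<Rightarrow> ('y \<Rightarrow> 'x) \<Rightarrow> ('z, 'v) rack_scheme \<Rightarrow> ('z \<Rightarrow> 'x) \<Rightarrow> ('y \<times> 'z) rack" where
  "fibre_product Y p Z r = \<lparr>carrier = {(y, z). y \<in> carrier Y \<and> z \<in> carrier Z \<and> p y = r z},
     act = act (product_rack Y Z)\<rparr>"

record ('e, 'x) beck_module = "'e rack" +
  proj :: "'e \<Rightarrow> 'x"
  badd :: "'e \<Rightarrow> 'e \<Rightarrow> 'e"
  bzero :: "'x \<Rightarrow> 'e"
  bneg :: "'e \<Rightarrow> 'e"

text \<open>Abelian group objects in the category of racks over X.\<close>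

locale beck_module =
  fixes X :: "('x, 'y) rack_scheme" and M :: "('e, 'x, 'z) beck_module_scheme"
  assumes rack_M: "rack M"
    and proj_hom: "proj M \<in> rack_hom M X"
    and badd_hom: "case_prod (badd M) \<in>
      slice_hom (fibre_product M (proj M) M (proj M)) (proj M \<circ> fst) M (proj M)"
    and bzero_hom: "bzero M \<in> slice_hom X id M (proj M)"
    and bneg_hom: "bneg M \<in> slice_hom M (proj M) M (proj M)"
    and badd_assoc: "\<lbrakk>a \<in> carrier M; b \<in> carrier M; c \<in> carrier M; proj M a = proj M b; proj M b = proj M c\<rbrakk>
      \<Longrightarrow> badd M (badd M a b) c = badd M a (badd M b c)"
    and badd_comm: "\<lbrakk>a \<in> carrier M; b \<in> carrier M; proj M a = proj M b\<rbrakk> \<Longrightarrow> badd M a b = badd M b a"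
    and badd_zero: "a \<in> carrier M \<Longrightarrow> badd M (bzero M (proj M a)) a = a"
    and badd_neg: "a \<in> carrier M \<Longrightarrow> badd M (bneg M a) a = bzero M (proj M a)"

context beck_module
begin

lemma proj_closed: "a \<in> carrier M \<Longrightarrow> proj M a \<in> carrier X"
  and proj_act: "\<lbrakk>a \<in> carrier M; b \<in> carrier M\<rbrakk> \<Longrightarrow> proj M (a \<rhd>\<^bsub>M\<^esub> b) = proj M a \<rhd>\<^bsub>X\<^esub> proj M b"
  using proj_hom by (auto simp: rack_hom_def)

lemma badd_closed: "\<lbrakk>a \<in> carrier M; b \<in> carrier M; proj M a = proj M b\<rbrakk> \<Longrightarrow> badd M a b \<in> carrier M"
  and proj_badd: "\<lbrakk>a \<in> carrier M; b \<in> carrier M; proj M a = proj M b\<rbrakk> \<Longrightarrow> proj M (badd M a b) = proj M b"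
  using badd_hom by (auto simp: slice_hom_def rack_hom_def fibre_product_def Pi_iff)

lemma badd_act:
  "\<lbrakk>a \<in> carrier M; a' \<in> carrier M; proj M a = proj M a';
    b \<in> carrier M; b' \<in> carrier M; proj M b = proj M b'\<rbrakk> \<Longrightarrow>
    badd M (a \<rhd>\<^bsub>M\<^esub> b) (a' \<rhd>\<^bsub>M\<^esub> b') = badd M a a' \<rhd>\<^bsub>M\<^esub> badd M b b'"
  using badd_hom by (auto simp: slice_hom_def rack_hom_def fibre_product_def product_rack_def)

lemma bzero_closed: "x \<in> carrier X \<Longrightarrow> bzero M x \<in> carrier M"
  and proj_bzero: "x \<in> carrier X \<Longrightarrow> proj M (bzero M x) = x"
  and bzero_act: "\<lbrakk>x \<in> carrier X; y \<in> carrier X\<rbrakk> \<Longrightarrow> bzero M (x \<rhd>\<^bsub>X\<^esub> y) = bzero M x \<rhd>\<^bsub>M\<^esub> bzero M y"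
  using bzero_hom by (auto simp: slice_hom_def rack_hom_def)

lemma bneg_closed: "a \<in> carrier M \<Longrightarrow> bneg M a \<in> carrier M"
  and proj_bneg: "a \<in> carrier M \<Longrightarrow> proj M (bneg M a) = proj M a"
  and bneg_act: "\<lbrakk>a \<in> carrier M; b \<in> carrier M\<rbrakk> \<Longrightarrow> bneg M (a \<rhd>\<^bsub>M\<^esub> b) = bneg M a \<rhd>\<^bsub>M\<^esub> bneg M b"
  using bneg_hom by (auto simp: slice_hom_def rack_hom_def)

lemma badd_cancel:
  assumes "a \<in> carrier M" "b \<in> carrier M" "c \<in> carrier M" "proj M a = proj M b" "proj M c = proj M b"
    "badd M c a = badd M c b"
  shows "a = b"
proof -
  have "badd M (badd M (bneg M c) c) a = badd M (badd M (bneg M c) c) b"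
    using assms by (simp add: badd_assoc bneg_closed proj_bneg)
  then have "badd M (bzero M (proj M b)) a = badd M (bzero M (proj M b)) b"
    unfolding badd_neg[OF assms(3)] assms(5) .
  then show ?thesis using badd_zero[OF assms(1)] badd_zero[OF assms(2)] unfolding assms(4) by metis
qed

end

definition beck_hom ::
    "('e, 'x, 'u) beck_module_scheme \<Rightarrow> ('m, 'x, 'v) beck_module_scheme \<Rightarrow> ('e \<Rightarrow> 'm) set" where
  "beck_hom N M = {f \<in> slice_hom N (proj N) M (proj M).
     \<forall>a\<in>carrier N. \<forall>b\<in>carrier N. proj N a = proj N b \<longrightarrow> f (badd N a b) = badd M (f a) (f b)}"

definition beck_hom_group ::
    "('e, 'x, 'u) beck_module_scheme \<Rightarrow> ('m, 'x, 'v) beck_module_scheme \<Rightarrow> ('e \<Rightarrow> 'm) monoid" where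
  "beck_hom_group N M = \<lparr>carrier = beck_hom N M \<inter> extensional (carrier N),
     mult = (\<lambda>f g. \<lambda>a\<in>carrier N. badd M (f a) (g a)),
     one = (\<lambda>a\<in>carrier N. bzero M (proj N a))\<rparr>"

theorem beck_hom_group_is_comm_group:
  assumes N: "beck_module X N" and M: "beck_module X M"
  shows "comm_group (beck_hom_group N M)"
proof -
  interpret N: beck_module X N by fact
  interpret M: beck_module X M by fact
  let ?G = "beck_hom_group N M"
  have N_act: "a \<rhd>\<^bsub>N\<^esub> b \<in> carrier N" if "a \<in> carrier N" "b \<in> carrier N" for a b
    using rack_act_closed[OF N.rack_M that] .
  have car: "f a \<in> carrier M" "proj M (f a) = proj N a"
    "b \<in> carrier N \<Longrightarrow> f (a \<rhd>\<^bsub>N\<^esub> b) = f a \<rhd>\<^bsub>M\<^esub> f b"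
    "\<lbrakk>b \<in> carrier N; proj N a = proj N b\<rbrakk> \<Longrightarrow> f (badd N a b) = badd M (f a) (f b)"
    if "f \<in> carrier ?G" "a \<in> carrier N" for f a b
    using that by (auto simp: beck_hom_group_def beck_hom_def slice_hom_def rack_hom_def)
  have ext: "f = g" if "f \<in> carrier ?G" "g \<in> carrier ?G" "\<And>a. a \<in> carrier N \<Longrightarrow> f a = g a" for f g
    using that by (auto simp: beck_hom_group_def intro: extensionalityI)
  have memI: "f \<in> carrier ?G"
    if "f \<in> extensional (carrier N)"
      "\<And>a. a \<in> carrier N \<Longrightarrow> f a \<in> carrier M" "\<And>a. a \<in> carrier N \<Longrightarrow> proj M (f a) = proj N a"
      "\<And>a b. \<lbrakk>a \<in> carrier N; b \<in> carrier N\<rbrakk> \<Longrightarrow> f (a \<rhd>\<^bsub>N\<^esub> b) = f a \<rhd>\<^bsub>M\<^esub> f b"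
      "\<And>a b. \<lbrakk>a \<in> carrier N; b \<in> carrier N; proj N a = proj N b\<rbrakk> \<Longrightarrow> f (badd N a b) = badd M (f a) (f b)"
    for f
    using that by (auto simp: beck_hom_group_def beck_hom_def slice_hom_def rack_hom_def)
  have mult: "(f \<otimes>\<^bsub>?G\<^esub> g) a = badd M (f a) (g a)" if "a \<in> carrier N" for f g a
    using that by (simp add: beck_hom_group_def)
  have one: "\<one>\<^bsub>?G\<^esub> a = bzero M (proj N a)" if "a \<in> carrier N" for a
    using that by (simp add: beck_hom_group_def)
  have interchange: "badd M (badd M a b) (badd M c d) = badd M (badd M a c) (badd M b d)"
    if "a \<in> carrier M" "b \<in> carrier M" "c \<in> carrier M" "d \<in> carrier M"
      "proj M a = proj M d" "proj M b = proj M d" "proj M c = proj M d" for a b c d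
  proof -
    have "badd M (badd M a b) (badd M c d) = badd M a (badd M (badd M b c) d)"
      using that by (simp add: M.badd_assoc M.badd_closed M.proj_badd)
    also have "\<dots> = badd M a (badd M (badd M c b) d)"
      using that by (simp add: M.badd_comm)
    also have "\<dots> = badd M (badd M a c) (badd M b d)"
      using that by (simp add: M.badd_assoc M.badd_closed M.proj_badd)
    finally show ?thesis .
  qed
  have zz: "badd M (bzero M x) (bzero M x) = bzero M x" if "x \<in> carrier X" for x
    using M.badd_zero[of "bzero M x"] that by (simp add: M.bzero_closed M.proj_bzero)
  have mcl: "f \<otimes>\<^bsub>?G\<^esub> g \<in> carrier ?G" if "f \<in> carrier ?G" "g \<in> carrier ?G" for f g
  proof (rule memI)
    show "f \<otimes>\<^bsub>?G\<^esub> g \<in> extensional (carrier N)" by (simp add: beck_hom_group_def)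
  qed (use that in \<open>auto simp: mult car N_act N.badd_closed N.proj_badd M.badd_closed M.proj_badd
      M.badd_act interchange\<close>)
  have ocl: "\<one>\<^bsub>?G\<^esub> \<in> carrier ?G"
  proof (rule memI)
    show "\<one>\<^bsub>?G\<^esub> \<in> extensional (carrier N)" by (simp add: beck_hom_group_def)
  qed (auto simp: one N_act N.badd_closed N.proj_badd N.proj_act N.proj_closed zz
      M.bzero_closed M.proj_bzero M.bzero_act)
  show ?thesis
  proof (rule comm_groupI)
    fix f g h assume fgh: "f \<in> carrier ?G" "g \<in> carrier ?G" "h \<in> carrier ?G"
    show "f \<otimes>\<^bsub>?G\<^esub> g \<otimes>\<^bsub>?G\<^esub> h = f \<otimes>\<^bsub>?G\<^esub> (g \<otimes>\<^bsub>?G\<^esub> h)"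
      by (rule ext) (auto simp: fgh mcl mult car M.badd_assoc)
  next
    fix f g assume fg: "f \<in> carrier ?G" "g \<in> carrier ?G"
    show "f \<otimes>\<^bsub>?G\<^esub> g = g \<otimes>\<^bsub>?G\<^esub> f"
      by (rule ext) (auto simp: fg mcl mult car intro: M.badd_comm)
  next
    fix f assume f: "f \<in> carrier ?G"
    show "\<one>\<^bsub>?G\<^esub> \<otimes>\<^bsub>?G\<^esub> f = f"
    proof (rule ext)
      fix a assume a: "a \<in> carrier N"
      show "(\<one>\<^bsub>?G\<^esub> \<otimes>\<^bsub>?G\<^esub> f) a = f a"
        using M.badd_zero[of "f a"] a f by (simp add: mult one car)
    qed (auto simp: f ocl mcl)
    let ?g = "\<lambda>a\<in>carrier N. bneg M (f a)"
    have neg_add: "bneg M (badd M b c) = badd M (bneg M b) (bneg M c)"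
      if bc: "b \<in> carrier M" "c \<in> carrier M" "proj M b = proj M c" for b c
    proof (rule M.badd_cancel[of _ _ "badd M b c"])
      have "badd M (badd M b c) (badd M (bneg M b) (bneg M c))
          = badd M (badd M b (bneg M b)) (badd M c (bneg M c))"
        using bc by (intro interchange) (auto simp: M.bneg_closed M.proj_bneg)
      also have "\<dots> = badd M (badd M (bneg M b) b) (badd M (bneg M c) c)"
        using bc by (simp add: M.badd_comm M.bneg_closed M.proj_bneg)
      also have "\<dots> = bzero M (proj M c)" using bc by (simp add: M.badd_neg zz M.proj_closed)
      also have "\<dots> = badd M (bneg M (badd M b c)) (badd M b c)"
        using bc by (simp add: M.badd_neg M.badd_closed M.proj_badd)
      also have "\<dots> = badd M (badd M b c) (bneg M (badd M b c))"
        using bc by (intro M.badd_comm) (auto simp: M.badd_closed M.bneg_closed M.proj_bneg)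
      finally show "badd M (badd M b c) (bneg M (badd M b c)) =
        badd M (badd M b c) (badd M (bneg M b) (bneg M c))" by simp
    qed (use bc in \<open>auto simp: M.badd_closed M.bneg_closed M.proj_bneg M.proj_badd\<close>)
    have g: "?g \<in> carrier ?G"
      by (rule memI) (auto simp: f car N_act N.badd_closed M.bneg_closed M.proj_bneg M.bneg_act neg_add)
    have "?g \<otimes>\<^bsub>?G\<^esub> f = \<one>\<^bsub>?G\<^esub>"
      by (rule ext) (auto simp: g f ocl mcl mult one car M.badd_neg)
    then show "\<exists>g\<in>carrier ?G. g \<otimes>\<^bsub>?G\<^esub> f = \<one>\<^bsub>?G\<^esub>" using g by blast
  qed (auto intro: mcl ocl)
qed

text \<open>The abelian group A as a Beck module over X.\<close>

definition trivial_beck_module ::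
    "('x, 'y) rack_scheme \<Rightarrow> ('a, 'z) monoid_scheme \<Rightarrow> ('a \<times> 'x, 'x) beck_module" where
  "trivial_beck_module X A = rack.extend (product_rack (trivial_rack (carrier A)) X)
     (beck_module.fields snd (\<lambda>(a, x) (b, y). (a \<otimes>\<^bsub>A\<^esub> b, x)) (\<lambda>x. (\<one>\<^bsub>A\<^esub>, x))
       (\<lambda>(a, x). (inv\<^bsub>A\<^esub> a, x)))"

lemma trivial_beck_module_simps [simp]:
  "carrier (trivial_beck_module X A) = carrier A \<times> carrier X"
  "act (trivial_beck_module X A) = (\<lambda>(a, x) (b, y). (b, x \<rhd>\<^bsub>X\<^esub> y))"
  "proj (trivial_beck_module X A) = snd"
  "badd (trivial_beck_module X A) = (\<lambda>(a, x) (b, y). (a \<otimes>\<^bsub>A\<^esub> b, x))"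
  "bzero (trivial_beck_module X A) = (\<lambda>x. (\<one>\<^bsub>A\<^esub>, x))"
  "bneg (trivial_beck_module X A) = (\<lambda>(a, x). (inv\<^bsub>A\<^esub> a, x))"
  by (simp_all add: trivial_beck_module_def product_rack_def trivial_rack_def rack.defs beck_module.defs)

theorem trivial_beck_module_is_beck_module:
  assumes X: "rack X" and A: "comm_group A"
  shows "beck_module X (trivial_beck_module X A)"
proof -
  interpret A: comm_group A by fact
  have "rack (trivial_beck_module X A)"
  proof
    fix c assume "c \<in> carrier (trivial_beck_module X A)"
    then obtain a x where c: "c = (a, x)" "x \<in> carrier X" by auto
    have eq: "(\<lambda>d. c \<rhd>\<^bsub>trivial_beck_module X A\<^esub> d) = map_prod id (\<lambda>y. x \<rhd>\<^bsub>X\<^esub> y)"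
      using c by (auto simp: fun_eq_iff)
    show "bij_betw (\<lambda>d. c \<rhd>\<^bsub>trivial_beck_module X A\<^esub> d)
      (carrier (trivial_beck_module X A)) (carrier (trivial_beck_module X A))"
      unfolding eq unfolding trivial_beck_module_simps
      by (intro bij_betw_map_prod bij_betw_id rack.act_bij[OF X] c)
  qed (auto simp: rack.act_distrib[OF X])
  then show ?thesis
    by (intro beck_module.intro)
      (auto simp: rack_hom_def slice_hom_def fibre_product_def product_rack_def rack_act_closed[OF X]
        A.m_assoc A.m_comm A.m_lcomm)
qed

subsection \<open>Free Beck modules\<close>

text \<open>The value \<open>Omega X Y p\<close> of the left adjoint of the forgetful functor from Beck modules over
  X to racks over X at \<open>p : Y \<rightarrow> X\<close>.  Its fibre over x consists of the formal terms over x, modulo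
  the congruence generated by the axioms of Beck modules and the requirement that the inclusion
  of the generators is a homomorphism.  The universal property is proved below.\<close>

datatype ('y, 'x) bterm = BGen 'y | BZero 'x | BAdd "('y, 'x) bterm" "('y, 'x) bterm"
  | BNeg "('y, 'x) bterm" | BAct "('y, 'x) bterm" "('y, 'x) bterm"
  | BDiv "('y, 'x) bterm" "('y, 'x) bterm"

inductive_set bterms :: "('x, 'u) rack_scheme \<Rightarrow> ('y, 'v) rack_scheme \<Rightarrow> ('y \<Rightarrow> 'x) \<Rightarrow>
    ('x \<times> ('y, 'x) bterm) set"
  for X :: "('x, 'u) rack_scheme" and Y :: "('y, 'v) rack_scheme" and p :: "'y \<Rightarrow> 'x" where
  gen: "y \<in> carrier Y \<Longrightarrow> (p y, BGen y) \<in> bterms X Y p"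
| zero: "x \<in> carrier X \<Longrightarrow> (x, BZero x) \<in> bterms X Y p"
| add: "\<lbrakk>(x, t) \<in> bterms X Y p; (x, u) \<in> bterms X Y p\<rbrakk> \<Longrightarrow> (x, BAdd t u) \<in> bterms X Y p"
| neg: "(x, t) \<in> bterms X Y p \<Longrightarrow> (x, BNeg t) \<in> bterms X Y p"
| act: "\<lbrakk>(x, t) \<in> bterms X Y p; (y, u) \<in> bterms X Y p\<rbrakk> \<Longrightarrow> (x \<rhd>\<^bsub>X\<^esub> y, BAct t u) \<in> bterms X Y p"
| div: "\<lbrakk>(x, t) \<in> bterms X Y p; y \<in> carrier X; (x \<rhd>\<^bsub>X\<^esub> y, u) \<in> bterms X Y p\<rbrakk>
    \<Longrightarrow> (y, BDiv t u) \<in> bterms X Y p"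

inductive beq :: "('x, 'u) rack_scheme \<Rightarrow> ('y, 'v) rack_scheme \<Rightarrow> ('y \<Rightarrow> 'x) \<Rightarrow>
    'x \<Rightarrow> ('y, 'x) bterm \<Rightarrow> ('y, 'x) bterm \<Rightarrow> bool"
  for X :: "('x, 'u) rack_scheme" and Y :: "('y, 'v) rack_scheme" and p :: "'y \<Rightarrow> 'x" where
  refl: "(x, t) \<in> bterms X Y p \<Longrightarrow> beq X Y p x t t"
| sym: "beq X Y p x t u \<Longrightarrow> beq X Y p x u t"
| trans: "\<lbrakk>beq X Y p x t u; beq X Y p x u v\<rbrakk> \<Longrightarrow> beq X Y p x t v"
| add_cong: "\<lbrakk>beq X Y p x t t'; beq X Y p x u u'\<rbrakk> \<Longrightarrow> beq X Y p x (BAdd t u) (BAdd t' u')"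
| neg_cong: "beq X Y p x t t' \<Longrightarrow> beq X Y p x (BNeg t) (BNeg t')"
| act_cong: "\<lbrakk>beq X Y p x t t'; beq X Y p y u u'\<rbrakk>
    \<Longrightarrow> beq X Y p (x \<rhd>\<^bsub>X\<^esub> y) (BAct t u) (BAct t' u')"
| div_cong: "\<lbrakk>beq X Y p x t t'; y \<in> carrier X; beq X Y p (x \<rhd>\<^bsub>X\<^esub> y) u u'\<rbrakk>
    \<Longrightarrow> beq X Y p y (BDiv t u) (BDiv t' u')"
| act_div: "\<lbrakk>(x, t) \<in> bterms X Y p; y \<in> carrier X; (x \<rhd>\<^bsub>X\<^esub> y, u) \<in> bterms X Y p\<rbrakk>
    \<Longrightarrow> beq X Y p (x \<rhd>\<^bsub>X\<^esub> y) (BAct t (BDiv t u)) u"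
| div_act: "\<lbrakk>(x, t) \<in> bterms X Y p; (y, u) \<in> bterms X Y p\<rbrakk>
    \<Longrightarrow> beq X Y p y (BDiv t (BAct t u)) u"
| distrib: "\<lbrakk>(x, t) \<in> bterms X Y p; (y, u) \<in> bterms X Y p; (z, v) \<in> bterms X Y p\<rbrakk>
    \<Longrightarrow> beq X Y p (x \<rhd>\<^bsub>X\<^esub> (y \<rhd>\<^bsub>X\<^esub> z)) (BAct t (BAct u v)) (BAct (BAct t u) (BAct t v))"
| assoc: "\<lbrakk>(x, t) \<in> bterms X Y p; (x, u) \<in> bterms X Y p; (x, v) \<in> bterms X Y p\<rbrakk>
    \<Longrightarrow> beq X Y p x (BAdd (BAdd t u) v) (BAdd t (BAdd u v))"
| comm: "\<lbrakk>(x, t) \<in> bterms X Y p; (x, u) \<in> bterms X Y p\<rbrakk> \<Longrightarrow> beq X Y p x (BAdd t u) (BAdd u t)"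
| add_zero: "(x, t) \<in> bterms X Y p \<Longrightarrow> beq X Y p x (BAdd (BZero x) t) t"
| add_neg: "(x, t) \<in> bterms X Y p \<Longrightarrow> beq X Y p x (BAdd (BNeg t) t) (BZero x)"
| add_act: "\<lbrakk>(x, t) \<in> bterms X Y p; (x, t') \<in> bterms X Y p; (y, u) \<in> bterms X Y p; (y, u') \<in> bterms X Y p\<rbrakk>
    \<Longrightarrow> beq X Y p (x \<rhd>\<^bsub>X\<^esub> y) (BAdd (BAct t u) (BAct t' u')) (BAct (BAdd t t') (BAdd u u'))"
| neg_act: "\<lbrakk>(x, t) \<in> bterms X Y p; (y, u) \<in> bterms X Y p\<rbrakk>
    \<Longrightarrow> beq X Y p (x \<rhd>\<^bsub>X\<^esub> y) (BNeg (BAct t u)) (BAct (BNeg t) (BNeg u))"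
| zero_act: "\<lbrakk>x \<in> carrier X; y \<in> carrier X\<rbrakk>
    \<Longrightarrow> beq X Y p (x \<rhd>\<^bsub>X\<^esub> y) (BZero (x \<rhd>\<^bsub>X\<^esub> y)) (BAct (BZero x) (BZero y))"
| gen_act: "\<lbrakk>y \<in> carrier Y; z \<in> carrier Y\<rbrakk>
    \<Longrightarrow> beq X Y p (p y \<rhd>\<^bsub>X\<^esub> p z) (BGen (y \<rhd>\<^bsub>Y\<^esub> z)) (BAct (BGen y) (BGen z))"

definition brel :: "('x, 'u) rack_scheme \<Rightarrow> ('y, 'v) rack_scheme \<Rightarrow> ('y \<Rightarrow> 'x) \<Rightarrow> 'x \<Rightarrow>
    (('y, 'x) bterm \<times> ('y, 'x) bterm) set" where
  "brel X Y p x = {(t, u). beq X Y p x t u}"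

definition Omega :: "('x, 'u) rack_scheme \<Rightarrow> ('y, 'v) rack_scheme \<Rightarrow> ('y \<Rightarrow> 'x) \<Rightarrow>
    ('x \<times> ('y, 'x) bterm set, 'x) beck_module" where
  "Omega X Y p = \<lparr>
     carrier = (SIGMA x : carrier X. {t. (x, t) \<in> bterms X Y p} // brel X Y p x),
     act = (\<lambda>(x, C) (y, D). (x \<rhd>\<^bsub>X\<^esub> y, \<Union>t\<in>C. \<Union>u\<in>D. brel X Y p (x \<rhd>\<^bsub>X\<^esub> y) `` {BAct t u})),
     proj = fst,
     badd = (\<lambda>(x, C) (_, D). (x, \<Union>t\<in>C. \<Union>u\<in>D. brel X Y p x `` {BAdd t u})),
     bzero = (\<lambda>x. (x, brel X Y p x `` {BZero x})),
     bneg = (\<lambda>(x, C). (x, \<Union>t\<in>C. brel X Y p x `` {BNeg t}))\<rparr>"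

definition Omega_unit :: "('x, 'u) rack_scheme \<Rightarrow> ('y, 'v) rack_scheme \<Rightarrow> ('y \<Rightarrow> 'x) \<Rightarrow>
    'y \<Rightarrow> 'x \<times> ('y, 'x) bterm set" where
  "Omega_unit X Y p y = (p y, brel X Y p (p y) `` {BGen y})"

primrec beval :: "('e, 'x, 'z) beck_module_scheme \<Rightarrow> ('y \<Rightarrow> 'e) \<Rightarrow> ('y, 'x) bterm \<Rightarrow> 'e" where
  "beval M g (BGen y) = g y"
| "beval M g (BZero x) = bzero M x"
| "beval M g (BAdd t u) = badd M (beval M g t) (beval M g u)"
| "beval M g (BNeg t) = bneg M (beval M g t)"
| "beval M g (BAct t u) = beval M g t \<rhd>\<^bsub>M\<^esub> beval M g u"
| "beval M g (BDiv t u) = ldiv M (beval M g t) (beval M g u)"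

text \<open>The morphism out of \<open>Omega X Y p\<close> that corresponds to a morphism g from Y to M over X.\<close>

definition Omega_lift :: "('x, 'u) rack_scheme \<Rightarrow> ('y, 'v) rack_scheme \<Rightarrow> ('y \<Rightarrow> 'x) \<Rightarrow>
    ('e, 'x, 'z) beck_module_scheme \<Rightarrow> ('y \<Rightarrow> 'e) \<Rightarrow> 'x \<times> ('y, 'x) bterm set \<Rightarrow> 'e" where
  "Omega_lift X Y p M g = (\<lambda>c\<in>carrier (Omega X Y p). the_elem (beval M g ` snd c))"

locale slice_object =
  fixes X :: "('x, 'u) rack_scheme" and Y :: "('y, 'v) rack_scheme" and p :: "'y \<Rightarrow> 'x"
  assumes rack_X: "rack X" and rack_Y: "rack Y" and p_hom: "p \<in> rack_hom Y X"
begin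

abbreviation T where "T \<equiv> bterms X Y p"
abbreviation E where "E \<equiv> beq X Y p"
abbreviation cls where "cls x t \<equiv> (x, brel X Y p x `` {t})"

lemma p_closed: "y \<in> carrier Y \<Longrightarrow> p y \<in> carrier X"
  and p_act: "\<lbrakk>y \<in> carrier Y; z \<in> carrier Y\<rbrakk> \<Longrightarrow> p (y \<rhd>\<^bsub>Y\<^esub> z) = p y \<rhd>\<^bsub>X\<^esub> p z"
  using p_hom by (auto simp: rack_hom_def)

lemma bterms_base: "(x, t) \<in> T \<Longrightarrow> x \<in> carrier X"
  by (induction rule: bterms.induct) (auto intro: p_closed rack_act_closed[OF rack_X])

lemma beq_bterms: "E x t u \<Longrightarrow> (x, t) \<in> T \<and> (x, u) \<in> T"
proof (induction rule: beq.induct)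
  case (distrib x t y u z v)
  then have "((x \<rhd>\<^bsub>X\<^esub> y) \<rhd>\<^bsub>X\<^esub> (x \<rhd>\<^bsub>X\<^esub> z), BAct (BAct t u) (BAct t v)) \<in> T"
    "(x \<rhd>\<^bsub>X\<^esub> (y \<rhd>\<^bsub>X\<^esub> z), BAct t (BAct u v)) \<in> T"
    by (intro bterms.act; simp)+
  moreover have "x \<rhd>\<^bsub>X\<^esub> (y \<rhd>\<^bsub>X\<^esub> z) = (x \<rhd>\<^bsub>X\<^esub> y) \<rhd>\<^bsub>X\<^esub> (x \<rhd>\<^bsub>X\<^esub> z)"
    using distrib bterms_base by (intro rack.act_distrib[OF rack_X])
  ultimately show ?case by simp
next
  case (gen_act y z)
  then show ?case using bterms.gen[OF rack_act_closed[OF rack_Y, of y z], of p X]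
    by (auto simp: p_act intro: bterms.intros)
next
  case (zero_act x y)
  then show ?case by (auto intro: bterms.intros rack_act_closed[OF rack_X])
qed (auto intro: bterms.intros rack_act_closed[OF rack_X] dest: bterms_base)

lemma equiv_brel: "equiv {t. (x, t) \<in> T} (brel X Y p x)"
  by (intro equivI refl_onI symI transI) (auto simp: brel_def dest: beq_bterms intro: beq.refl beq.sym beq.trans)

lemma Omega_carrier: "c \<in> carrier (Omega X Y p) \<longleftrightarrow> (\<exists>x t. (x, t) \<in> T \<and> c = cls x t)"
  by (auto simp: Omega_def quotient_def dest: bterms_base)

lemma cls_closed: "(x, t) \<in> T \<Longrightarrow> cls x t \<in> carrier (Omega X Y p)"
  by (auto simp: Omega_carrier)

lemma cls_eq:
  assumes "(x, t) \<in> T"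
  shows "cls x t = cls x u \<longleftrightarrow> E x t u"
proof
  show "E x t u" if "cls x t = cls x u"
    using assms that eq_equiv_class[OF _ equiv_brel, of x u t] by (auto simp: brel_def intro: beq.sym)
  show "cls x t = cls x u" if "E x t u"
    using that equiv_class_eq[OF equiv_brel, of t u x] by (simp add: brel_def)
qed

lemma Omega_proj [simp]: "proj (Omega X Y p) = fst"
  by (simp add: Omega_def)

lemma Omega_bzero: "bzero (Omega X Y p) x = cls x (BZero x)"
  by (simp add: Omega_def)

lemma Omega_act:
  assumes "(x, t) \<in> T" "(y, u) \<in> T"
  shows "cls x t \<rhd>\<^bsub>Omega X Y p\<^esub> cls y u = cls (x \<rhd>\<^bsub>X\<^esub> y) (BAct t u)"
  unfolding Omega_def rack.simps prod.case
  by (rule arg_cong[where f = "Pair _"], rule UN_class2[OF equiv_brel _ equiv_brel _ equiv_brel])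
    (use assms in \<open>auto simp: brel_def intro: beq.act_cong\<close>)

lemma Omega_badd:
  assumes "(x, t) \<in> T" "(x, u) \<in> T"
  shows "badd (Omega X Y p) (cls x t) (cls x u) = cls x (BAdd t u)"
  unfolding Omega_def beck_module.simps prod.case
  by (rule arg_cong[where f = "Pair _"], rule UN_class2[OF equiv_brel _ equiv_brel _ equiv_brel])
    (use assms in \<open>auto simp: brel_def intro: beq.add_cong\<close>)

lemma Omega_bneg:
  assumes "(x, t) \<in> T"
  shows "bneg (Omega X Y p) (cls x t) = cls x (BNeg t)"
  unfolding Omega_def beck_module.simps prod.case
  by (rule arg_cong[where f = "Pair _"], rule UN_class1[OF equiv_brel _ equiv_brel])
    (use assms in \<open>auto simp: brel_def intro: beq.neg_cong\<close>)

lemma Omega_rack: "rack (Omega X Y p)"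
proof
  fix c assume "c \<in> carrier (Omega X Y p)"
  then obtain x t where c: "(x, t) \<in> T" "c = cls x t" by (auto simp: Omega_carrier)
  then have x: "x \<in> carrier X" using bterms_base by blast
  show "bij_betw (\<lambda>d. c \<rhd>\<^bsub>Omega X Y p\<^esub> d) (carrier (Omega X Y p)) (carrier (Omega X Y p))"
  proof (rule bij_betwI')
    fix d e assume "d \<in> carrier (Omega X Y p)" "e \<in> carrier (Omega X Y p)"
    then obtain y u z v where d: "(y, u) \<in> T" "d = cls y u" and e: "(z, v) \<in> T" "e = cls z v"
      by (auto simp: Omega_carrier)
    then have y: "y \<in> carrier X" "z \<in> carrier X" using bterms_base by blast+
    show "(c \<rhd>\<^bsub>Omega X Y p\<^esub> d = c \<rhd>\<^bsub>Omega X Y p\<^esub> e) = (d = e)"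
    proof
      assume "c \<rhd>\<^bsub>Omega X Y p\<^esub> d = c \<rhd>\<^bsub>Omega X Y p\<^esub> e"
      then have eq: "cls (x \<rhd>\<^bsub>X\<^esub> y) (BAct t u) = cls (x \<rhd>\<^bsub>X\<^esub> z) (BAct t v)"
        using c d e by (simp only: Omega_act)
      then have yz: "y = z" using rack_act_inj[OF rack_X x y] by simp
      have "E (x \<rhd>\<^bsub>X\<^esub> y) (BAct t u) (BAct t v)"
        using eq yz bterms.act[OF c(1) d(1)] cls_eq by blast
      then have "E y (BDiv t (BAct t u)) (BDiv t (BAct t v))"
        using c y by (intro beq.div_cong[OF beq.refl])
      then have "E y u v" using c d e yz by (meson beq.div_act beq.sym beq.trans)
      then show "d = e" using d e yz cls_eq by blast
    qed simp
  next
    fix d assume "d \<in> carrier (Omega X Y p)"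
    then obtain y u where d: "(y, u) \<in> T" "d = cls y u" by (auto simp: Omega_carrier)
    then have y: "y \<in> carrier X" using bterms_base by blast
    show "c \<rhd>\<^bsub>Omega X Y p\<^esub> d \<in> carrier (Omega X Y p)"
      unfolding c d Omega_act[OF c(1) d(1)] by (rule cls_closed[OF bterms.act[OF c(1) d(1)]])
    obtain z where z: "z \<in> carrier X" "x \<rhd>\<^bsub>X\<^esub> z = y"
      using act_ldiv[OF rack_X x y] ldiv_closed[OF rack_X x y] by blast
    have Tz: "(z, BDiv t u) \<in> T" using c d z by (auto intro: bterms.div)
    have "c \<rhd>\<^bsub>Omega X Y p\<^esub> cls z (BDiv t u) = cls y (BAct t (BDiv t u))"
      unfolding c Omega_act[OF c(1) Tz] z ..
    also have "\<dots> = d"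
      using beq.act_div[OF c(1) z(1), of u] d z cls_eq beq_bterms by blast
    finally show "\<exists>e\<in>carrier (Omega X Y p). d = c \<rhd>\<^bsub>Omega X Y p\<^esub> e"
      using cls_closed[OF Tz] by metis
  qed
next
  fix c d e
  assume "c \<in> carrier (Omega X Y p)" "d \<in> carrier (Omega X Y p)" "e \<in> carrier (Omega X Y p)"
  then obtain x t y u z v where c: "(x, t) \<in> T" "c = cls x t" and d: "(y, u) \<in> T" "d = cls y u"
    and e: "(z, v) \<in> T" "e = cls z v" by (auto simp: Omega_carrier)
  have eq: "x \<rhd>\<^bsub>X\<^esub> (y \<rhd>\<^bsub>X\<^esub> z) = (x \<rhd>\<^bsub>X\<^esub> y) \<rhd>\<^bsub>X\<^esub> (x \<rhd>\<^bsub>X\<^esub> z)"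
    using c d e bterms_base rack.act_distrib[OF rack_X] by blast
  have "c \<rhd>\<^bsub>Omega X Y p\<^esub> (d \<rhd>\<^bsub>Omega X Y p\<^esub> e) = cls (x \<rhd>\<^bsub>X\<^esub> (y \<rhd>\<^bsub>X\<^esub> z)) (BAct t (BAct u v))"
    using c d e by (simp only: Omega_act bterms.act)
  also have "\<dots> = cls (x \<rhd>\<^bsub>X\<^esub> (y \<rhd>\<^bsub>X\<^esub> z)) (BAct (BAct t u) (BAct t v))"
    using beq.distrib[OF c(1) d(1) e(1)] beq_bterms cls_eq by blast
  also have "\<dots> = (c \<rhd>\<^bsub>Omega X Y p\<^esub> d) \<rhd>\<^bsub>Omega X Y p\<^esub> (c \<rhd>\<^bsub>Omega X Y p\<^esub> e)"
    using c d e by (simp only: Omega_act bterms.act eq)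
  finally show "c \<rhd>\<^bsub>Omega X Y p\<^esub> (d \<rhd>\<^bsub>Omega X Y p\<^esub> e) =
    (c \<rhd>\<^bsub>Omega X Y p\<^esub> d) \<rhd>\<^bsub>Omega X Y p\<^esub> (c \<rhd>\<^bsub>Omega X Y p\<^esub> e)" .
qed

lemma cls_eqI: "E x t u \<Longrightarrow> cls x t = cls x u"
  using beq_bterms cls_eq by blast

theorem Omega_beck_module: "beck_module X (Omega X Y p)"
proof (rule beck_module.intro)
  note simps = Omega_act Omega_badd Omega_bneg Omega_bzero
  show "rack (Omega X Y p)" by (rule Omega_rack)
  show "proj (Omega X Y p) \<in> rack_hom (Omega X Y p) X"
    unfolding rack_hom_def
  proof (intro CollectI conjI ballI funcsetI)
    fix c d assume "c \<in> carrier (Omega X Y p)" "d \<in> carrier (Omega X Y p)"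
    then show "proj (Omega X Y p) (c \<rhd>\<^bsub>Omega X Y p\<^esub> d) = proj (Omega X Y p) c \<rhd>\<^bsub>X\<^esub> proj (Omega X Y p) d"
      by (elim Omega_carrier[THEN iffD1, elim_format] exE conjE) (simp add: Omega_act)
  qed (auto simp: Omega_carrier dest: bterms_base)
  show "case_prod (badd (Omega X Y p)) \<in> slice_hom
      (fibre_product (Omega X Y p) (proj (Omega X Y p)) (Omega X Y p) (proj (Omega X Y p)))
      (proj (Omega X Y p) \<circ> fst) (Omega X Y p) (proj (Omega X Y p))"
  proof -
    have act: "badd (Omega X Y p) (cls x t \<rhd>\<^bsub>Omega X Y p\<^esub> cls y u) (cls x t' \<rhd>\<^bsub>Omega X Y p\<^esub> cls y u')
        = badd (Omega X Y p) (cls x t) (cls x t') \<rhd>\<^bsub>Omega X Y p\<^esub> badd (Omega X Y p) (cls y u) (cls y u')"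
      if "(x, t) \<in> T" "(x, t') \<in> T" "(y, u) \<in> T" "(y, u') \<in> T" for x y t t' u u'
      using that by (simp only: simps bterms.intros) (intro cls_eqI beq.add_act)
    have cl: "badd (Omega X Y p) (cls x t) (cls x t') \<in> carrier (Omega X Y p)"
        "fst (badd (Omega X Y p) (cls x t) (cls x t')) = x"
      if "(x, t) \<in> T" "(x, t') \<in> T" for x t t'
      using that by (simp_all only: simps fst_conv cls_closed bterms.intros)
    have pair: "\<exists>x t t'. (x, t) \<in> T \<and> (x, t') \<in> T \<and> c = cls x t \<and> c' = cls x t'"
      if "c \<in> carrier (Omega X Y p)" "c' \<in> carrier (Omega X Y p)" "fst c = fst c'" for c c'
      using that by (fastforce simp: Omega_carrier)
    have add: "badd (Omega X Y p) c c' \<in> carrier (Omega X Y p)" "fst (badd (Omega X Y p) c c') = fst c"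
      if asm: "c \<in> carrier (Omega X Y p)" "c' \<in> carrier (Omega X Y p)" "fst c = fst c'" for c c'
    proof -
      obtain x t t' where "(x, t) \<in> T" "(x, t') \<in> T" "c = cls x t" "c' = cls x t'"
        using pair[OF asm] by metis
      then show "badd (Omega X Y p) c c' \<in> carrier (Omega X Y p)" "fst (badd (Omega X Y p) c c') = fst c"
        using cl by (simp_all only: fst_conv)
    qed
    have "badd (Omega X Y p) (c \<rhd>\<^bsub>Omega X Y p\<^esub> d) (c' \<rhd>\<^bsub>Omega X Y p\<^esub> d')
        = badd (Omega X Y p) c c' \<rhd>\<^bsub>Omega X Y p\<^esub> badd (Omega X Y p) d d'"
      if asm: "c \<in> carrier (Omega X Y p)" "c' \<in> carrier (Omega X Y p)" "fst c = fst c'"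
        "d \<in> carrier (Omega X Y p)" "d' \<in> carrier (Omega X Y p)" "fst d = fst d'" for c c' d d'
    proof -
      obtain x t t' where "(x, t) \<in> T" "(x, t') \<in> T" "c = cls x t" "c' = cls x t'"
        using pair[OF asm(1-3)] by metis
      moreover obtain y u u' where "(y, u) \<in> T" "(y, u') \<in> T" "d = cls y u" "d' = cls y u'"
        using pair[OF asm(4-6)] by metis
      ultimately show ?thesis by (simp only: act)
    qed
    then show ?thesis
      using add by (auto simp: slice_hom_def rack_hom_def fibre_product_def product_rack_def)
  qed
  show "bzero (Omega X Y p) \<in> slice_hom X id (Omega X Y p) (proj (Omega X Y p))"
    unfolding slice_hom_def rack_hom_def
  proof (intro CollectI conjI ballI funcsetI)
    fix x y assume xy: "x \<in> carrier X" "y \<in> carrier X"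
    show "bzero (Omega X Y p) (x \<rhd>\<^bsub>X\<^esub> y) = bzero (Omega X Y p) x \<rhd>\<^bsub>Omega X Y p\<^esub> bzero (Omega X Y p) y"
      using xy by (simp only: simps bterms.zero) (intro cls_eqI beq.zero_act)
  qed (auto simp: Omega_bzero intro!: cls_closed bterms.zero)
  show "bneg (Omega X Y p) \<in> slice_hom (Omega X Y p) (proj (Omega X Y p)) (Omega X Y p) (proj (Omega X Y p))"
    unfolding slice_hom_def rack_hom_def
  proof (intro CollectI conjI ballI funcsetI)
    fix c d assume "c \<in> carrier (Omega X Y p)" "d \<in> carrier (Omega X Y p)"
    then obtain x t y u where c: "(x, t) \<in> T" "c = cls x t" and d: "(y, u) \<in> T" "d = cls y u"
      by (auto simp: Omega_carrier)
    show "bneg (Omega X Y p) (c \<rhd>\<^bsub>Omega X Y p\<^esub> d) =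
        bneg (Omega X Y p) c \<rhd>\<^bsub>Omega X Y p\<^esub> bneg (Omega X Y p) d"
      using c d by (simp only: simps bterms.intros) (intro cls_eqI beq.neg_act)
  next
    fix c assume "c \<in> carrier (Omega X Y p)"
    then obtain x t where c: "(x, t) \<in> T" "c = cls x t" by (auto simp: Omega_carrier)
    show "bneg (Omega X Y p) c \<in> carrier (Omega X Y p)"
      "proj (Omega X Y p) (bneg (Omega X Y p) c) = proj (Omega X Y p) c"
      unfolding c(2) Omega_bneg[OF c(1)] using cls_closed[OF bterms.neg[OF c(1)]] by simp_all
  qed
next
  fix a b c assume "a \<in> carrier (Omega X Y p)" "b \<in> carrier (Omega X Y p)" "c \<in> carrier (Omega X Y p)"
    "proj (Omega X Y p) a = proj (Omega X Y p) b" "proj (Omega X Y p) b = proj (Omega X Y p) c"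
  then obtain x t u v where "(x, t) \<in> T" "(x, u) \<in> T" "(x, v) \<in> T"
    "a = cls x t" "b = cls x u" "c = cls x v" by (fastforce simp: Omega_carrier)
  then show "badd (Omega X Y p) (badd (Omega X Y p) a b) c = badd (Omega X Y p) a (badd (Omega X Y p) b c)"
    by (simp only: Omega_badd bterms.add) (intro cls_eqI beq.assoc)
next
  fix a b assume "a \<in> carrier (Omega X Y p)" "b \<in> carrier (Omega X Y p)"
    "proj (Omega X Y p) a = proj (Omega X Y p) b"
  then obtain x t u where "(x, t) \<in> T" "(x, u) \<in> T" "a = cls x t" "b = cls x u"
    by (fastforce simp: Omega_carrier)
  then show "badd (Omega X Y p) a b = badd (Omega X Y p) b a"
    by (simp only: Omega_badd) (intro cls_eqI beq.comm)
next
  fix a assume "a \<in> carrier (Omega X Y p)"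
  then obtain x t where a: "(x, t) \<in> T" "a = cls x t" by (auto simp: Omega_carrier)
  then have x: "x \<in> carrier X" by (auto dest: bterms_base)
  show "badd (Omega X Y p) (bzero (Omega X Y p) (proj (Omega X Y p) a)) a = a"
    using a x by (simp only: Omega_badd Omega_bzero Omega_proj fst_conv bterms.zero)
      (intro cls_eqI beq.add_zero)
  show "badd (Omega X Y p) (bneg (Omega X Y p) a) a = bzero (Omega X Y p) (proj (Omega X Y p) a)"
    using a x by (simp only: Omega_badd Omega_bneg Omega_bzero Omega_proj fst_conv bterms.neg)
      (intro cls_eqI beq.add_neg)
qed

theorem Omega_unit_hom: "Omega_unit X Y p \<in> slice_hom Y p (Omega X Y p) (proj (Omega X Y p))"
  unfolding slice_hom_def rack_hom_def
proof (intro CollectI conjI ballI funcsetI)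
  fix y z assume yz: "y \<in> carrier Y" "z \<in> carrier Y"
  show "Omega_unit X Y p (y \<rhd>\<^bsub>Y\<^esub> z) = Omega_unit X Y p y \<rhd>\<^bsub>Omega X Y p\<^esub> Omega_unit X Y p z"
    using yz by (simp only: Omega_unit_def Omega_act bterms.gen p_act) (intro cls_eqI beq.gen_act)
qed (auto simp: Omega_unit_def intro!: cls_closed bterms.gen)

context
  fixes M :: "('e, 'x, 'z) beck_module_scheme" and g :: "'y \<Rightarrow> 'e"
  assumes M: "beck_module X M" and g: "g \<in> slice_hom Y p M (proj M)"
begin

interpretation M: beck_module X M by (rule M)

lemma g_closed: "y \<in> carrier Y \<Longrightarrow> g y \<in> carrier M"
  and g_proj: "y \<in> carrier Y \<Longrightarrow> proj M (g y) = p y"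
  and g_act: "\<lbrakk>y \<in> carrier Y; z \<in> carrier Y\<rbrakk> \<Longrightarrow> g (y \<rhd>\<^bsub>Y\<^esub> z) = g y \<rhd>\<^bsub>M\<^esub> g z"
  using g by (auto simp: slice_hom_def rack_hom_def)

lemma ldiv_proj:
  assumes "a \<in> carrier M" "b \<in> carrier M" "y \<in> carrier X" "proj M b = proj M a \<rhd>\<^bsub>X\<^esub> y"
  shows "proj M (ldiv M a b) = y"
  by (rule rack_act_inj[OF rack_X, of "proj M a"])
    (use assms M.proj_act[OF assms(1) ldiv_closed[OF M.rack_M assms(1,2)]] in
      \<open>auto simp: M.proj_closed ldiv_closed[OF M.rack_M] act_ldiv[OF M.rack_M]\<close>)

lemma beval_closed: "(x, t) \<in> T \<Longrightarrow> beval M g t \<in> carrier M \<and> proj M (beval M g t) = x"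
  by (induction rule: bterms.induct)
    (auto simp: g_closed g_proj M.bzero_closed M.proj_bzero M.badd_closed M.proj_badd M.bneg_closed
      M.proj_bneg M.proj_act rack_act_closed[OF M.rack_M] ldiv_closed[OF M.rack_M] ldiv_proj)

lemma beval_beq: "E x t u \<Longrightarrow> beval M g t = beval M g u"
proof (induction rule: beq.induct)
  case (add_zero x t)
  then show ?case using beval_closed[OF add_zero] M.badd_zero[of "beval M g t"] by auto
next
  case (add_neg x t)
  then show ?case using beval_closed[OF add_neg] M.badd_neg[of "beval M g t"] by auto
next
  case (comm x t u)
  then show ?case by (auto dest!: beval_closed intro: M.badd_comm)
next
  case (assoc x t u v)
  then show ?case by (auto dest!: beval_closed intro: M.badd_assoc)
next
  case (add_act x t t' y u u')
  then show ?case by (auto dest!: beval_closed intro: M.badd_act)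
next
  case (distrib x t y u z v)
  then show ?case by (auto dest!: beval_closed intro: rack.act_distrib[OF M.rack_M])
next
  case (neg_act x t y u)
  then show ?case by (auto dest!: beval_closed intro: M.bneg_act)
next
  case (act_div x t y u)
  then show ?case by (auto dest!: beval_closed intro: act_ldiv[OF M.rack_M])
next
  case (div_act x t y u)
  then show ?case by (auto dest!: beval_closed intro: ldiv_act[OF M.rack_M])
qed (auto simp: M.bzero_act g_act)

lemma Omega_lift_cls:
  assumes "(x, t) \<in> T"
  shows "Omega_lift X Y p M g (cls x t) = beval M g t"
proof -
  have "beval M g u = beval M g t" if "u \<in> brel X Y p x `` {t}" for u
    using that beval_beq by (auto simp: brel_def)
  moreover have "t \<in> brel X Y p x `` {t}" using assms by (simp add: brel_def beq.refl)
  ultimately have "beval M g ` (brel X Y p x `` {t}) = {beval M g t}" by blast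
  then show ?thesis using cls_closed[OF assms] by (simp add: Omega_lift_def)
qed

theorem Omega_lift_hom: "Omega_lift X Y p M g \<in> carrier (beck_hom_group (Omega X Y p) M)"
proof -
  have "Omega_lift X Y p M g \<in> beck_hom (Omega X Y p) M"
    unfolding beck_hom_def slice_hom_def rack_hom_def
  proof (intro CollectI conjI ballI funcsetI impI)
    fix c assume "c \<in> carrier (Omega X Y p)"
    then obtain x t where c: "(x, t) \<in> T" "c = cls x t" by (auto simp: Omega_carrier)
    show "Omega_lift X Y p M g c \<in> carrier M"
      "proj M (Omega_lift X Y p M g c) = proj (Omega X Y p) c"
      unfolding c(2) Omega_lift_cls[OF c(1)] using beval_closed[OF c(1)] by auto
  next
    fix c d assume "c \<in> carrier (Omega X Y p)" "d \<in> carrier (Omega X Y p)"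
    then obtain x t y u where c: "(x, t) \<in> T" "c = cls x t" and d: "(y, u) \<in> T" "d = cls y u"
      by (auto simp: Omega_carrier)
    show "Omega_lift X Y p M g (c \<rhd>\<^bsub>Omega X Y p\<^esub> d) =
        Omega_lift X Y p M g c \<rhd>\<^bsub>M\<^esub> Omega_lift X Y p M g d"
      using c d by (simp only: Omega_act Omega_lift_cls bterms.act beval.simps)
    assume "proj (Omega X Y p) c = proj (Omega X Y p) d"
    then have "x = y" using c d by simp
    then show "Omega_lift X Y p M g (badd (Omega X Y p) c d) =
        badd M (Omega_lift X Y p M g c) (Omega_lift X Y p M g d)"
      using c d by (simp only: Omega_badd Omega_lift_cls bterms.add beval.simps)
  qed
  then show ?thesis by (simp add: beck_hom_group_def Omega_lift_def)
qed

theorem Omega_lift_unit: "y \<in> carrier Y \<Longrightarrow> Omega_lift X Y p M g (Omega_unit X Y p y) = g y"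
  unfolding Omega_unit_def by (simp only: Omega_lift_cls bterms.gen beval.simps)

theorem Omega_lift_unique:
  assumes k: "k \<in> carrier (beck_hom_group (Omega X Y p) M)"
    and kg: "\<And>y. y \<in> carrier Y \<Longrightarrow> k (Omega_unit X Y p y) = g y"
  shows "k = Omega_lift X Y p M g"
proof -
  have kcl: "k c \<in> carrier M" and kpr: "proj M (k c) = fst c" if "c \<in> carrier (Omega X Y p)" for c
    using k that by (auto simp: beck_hom_group_def beck_hom_def slice_hom_def rack_hom_def)
  have kact: "k (c \<rhd>\<^bsub>Omega X Y p\<^esub> d) = k c \<rhd>\<^bsub>M\<^esub> k d"
    and kadd: "fst c = fst d \<Longrightarrow> k (badd (Omega X Y p) c d) = badd M (k c) (k d)"
    if "c \<in> carrier (Omega X Y p)" "d \<in> carrier (Omega X Y p)" for c d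
    using k that by (auto simp: beck_hom_group_def beck_hom_def slice_hom_def rack_hom_def)
  have kzero: "k (cls x (BZero x)) = bzero M x" if x: "x \<in> carrier X" for x
  proof -
    have T: "(x, BZero x) \<in> T" using x by (rule bterms.zero)
    let ?z = "cls x (BZero x)"
    have z: "?z \<in> carrier (Omega X Y p)" by (rule cls_closed[OF T])
    have "badd (Omega X Y p) ?z ?z = ?z"
      unfolding Omega_badd[OF T T] by (rule cls_eqI[OF beq.add_zero[OF T]])
    then have "badd M (k ?z) (k ?z) = k ?z" using kadd[OF z z] by simp
    also have "\<dots> = badd M (bzero M x) (k ?z)"
      using M.badd_zero[OF kcl[OF z]] kpr[OF z] by simp
    also have "\<dots> = badd M (k ?z) (bzero M x)"
      using x kcl[OF z] kpr[OF z] by (intro M.badd_comm) (auto simp: M.bzero_closed M.proj_bzero)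
    finally show ?thesis
      using M.badd_cancel[of "k ?z" "bzero M x" "k ?z"] x kcl[OF z] kpr[OF z]
      by (auto simp: M.bzero_closed M.proj_bzero)
  qed
  have "k (cls x t) = beval M g t" if "(x, t) \<in> T" for x t
    using that
  proof (induction rule: bterms.induct)
    case (gen y)
    then show ?case using kg by (simp add: Omega_unit_def)
  next
    case (zero x)
    then show ?case using kzero by simp
  next
    case (add x t u)
    then show ?case using kadd[OF cls_closed[OF add(1)] cls_closed[OF add(2)]] Omega_badd by simp
  next
    case (neg x t)
    let ?c = "cls x t" and ?d = "cls x (BNeg t)"
    have T: "(x, BNeg t) \<in> T" using neg by (intro bterms.neg)
    have cd: "?c \<in> carrier (Omega X Y p)" "?d \<in> carrier (Omega X Y p)"
      using neg T cls_closed by auto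
    have x: "x \<in> carrier X" using bterms_base[OF neg(1)] .
    have "badd (Omega X Y p) ?d ?c = cls x (BZero x)"
      unfolding Omega_badd[OF T neg(1)] by (rule cls_eqI[OF beq.add_neg[OF neg(1)]])
    then have "badd M (k ?d) (k ?c) = bzero M x" using kadd[OF cd(2,1)] kzero[OF x] by simp
    also have "\<dots> = badd M (bneg M (k ?c)) (k ?c)" using M.badd_neg[OF kcl[OF cd(1)]] kpr[OF cd(1)] by simp
    finally have "badd M (k ?c) (k ?d) = badd M (k ?c) (bneg M (k ?c))"
      using M.badd_comm[of "k ?c" "k ?d"] M.badd_comm[of "k ?c" "bneg M (k ?c)"] kcl[OF cd(1)] kcl[OF cd(2)] kpr[OF cd(1)] kpr[OF cd(2)]
      by (simp add: M.bneg_closed M.proj_bneg)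
    then have "k ?d = bneg M (k ?c)"
      using M.badd_cancel[of "k ?d" "bneg M (k ?c)" "k ?c"] kcl[OF cd(1)] kcl[OF cd(2)] kpr[OF cd(1)] kpr[OF cd(2)]
      by (simp add: M.bneg_closed M.proj_bneg)
    then show ?case using neg by simp
  next
    case (act x t y u)
    then show ?case using kact[OF cls_closed[OF act(1)] cls_closed[OF act(2)]] Omega_act by simp
  next
    case (div x t y u)
    let ?c = "cls x t" and ?d = "cls y (BDiv t u)"
    have T: "(y, BDiv t u) \<in> T" using div by (intro bterms.div)
    have cd: "?c \<in> carrier (Omega X Y p)" "?d \<in> carrier (Omega X Y p)"
      using div T cls_closed by auto
    have "?c \<rhd>\<^bsub>Omega X Y p\<^esub> ?d = cls (x \<rhd>\<^bsub>X\<^esub> y) u"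
      unfolding Omega_act[OF div(1) T] by (rule cls_eqI[OF beq.act_div]) (use div in auto)
    then have "beval M g t \<rhd>\<^bsub>M\<^esub> k ?d = beval M g u" using kact[OF cd] div by simp
    then show ?case using ldiv_act[OF M.rack_M _ kcl[OF cd(2)]] beval_closed[OF div(1)] by fastforce
  qed
  then have "k c = Omega_lift X Y p M g c" if "c \<in> carrier (Omega X Y p)" for c
    using that Omega_lift_cls by (auto simp: Omega_carrier)
  then show ?thesis
    using k by (auto simp: beck_hom_group_def Omega_lift_def intro!: extensionalityI)
qed

end

end

text \<open>The effect of the left adjoint on a morphism f from Y to Z over X.\<close>

definition Omega_map :: "('x, 'u) rack_scheme \<Rightarrow> ('y, 'v) rack_scheme \<Rightarrow> ('y \<Rightarrow> 'x) \<Rightarrow>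
    ('z, 'w) rack_scheme \<Rightarrow> ('z \<Rightarrow> 'x) \<Rightarrow> ('y \<Rightarrow> 'z) \<Rightarrow>
    'x \<times> ('y, 'x) bterm set \<Rightarrow> 'x \<times> ('z, 'x) bterm set" where
  "Omega_map X Y p Z r f = Omega_lift X Y p (Omega X Z r) (Omega_unit X Z r \<circ> f)"

section \<open>Quillen cohomology\<close>

text \<open>The simplicial Beck module \<open>\<lambda>q. cotangent X F \<epsilon> q\<close>, with faces \<open>cotangent_face X F \<epsilon>\<close>, is the
  cotangent complex of X computed from \<open>\<epsilon> : F \<rightarrow> X\<close>.\<close>

definition cotangent :: "('x, 'u) rack_scheme \<Rightarrow> ('f, 'v) simplicial_rack_scheme \<Rightarrow> (nat \<Rightarrow> 'f \<Rightarrow> 'x) \<Rightarrow>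
    nat \<Rightarrow> ('x \<times> ('f, 'x) bterm set, 'x) beck_module" where
  "cotangent X F \<epsilon> q = Omega X (level F q) (\<epsilon> q)"

definition cotangent_face :: "('x, 'u) rack_scheme \<Rightarrow> ('f, 'v) simplicial_rack_scheme \<Rightarrow> (nat \<Rightarrow> 'f \<Rightarrow> 'x) \<Rightarrow>
    nat \<Rightarrow> nat \<Rightarrow> 'x \<times> ('f, 'x) bterm set \<Rightarrow> 'x \<times> ('f, 'x) bterm set" where
  "cotangent_face X F \<epsilon> q i =
     Omega_map X (level F q) (\<epsilon> q) (level F (q - 1)) (\<epsilon> (q - 1)) (face F q i)"

definition quillen_cochains :: "('x, 'u) rack_scheme \<Rightarrow> ('f, 'v) simplicial_rack_scheme \<Rightarrow>
    (nat \<Rightarrow> 'f \<Rightarrow> 'x) \<Rightarrow> ('m, 'x, 'w) beck_module_scheme \<Rightarrow> nat \<Rightarrow>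
    ('x \<times> ('f, 'x) bterm set \<Rightarrow> 'm) monoid" where
  "quillen_cochains X F \<epsilon> M q = beck_hom_group (cotangent X F \<epsilon> q) M"

definition quillen_coboundary :: "('x, 'u) rack_scheme \<Rightarrow> ('f, 'v) simplicial_rack_scheme \<Rightarrow>
    (nat \<Rightarrow> 'f \<Rightarrow> 'x) \<Rightarrow> ('m, 'x, 'w) beck_module_scheme \<Rightarrow> nat \<Rightarrow>
    ('x \<times> ('f, 'x) bterm set \<Rightarrow> 'm) \<Rightarrow> ('x \<times> ('f, 'x) bterm set \<Rightarrow> 'm)" where
  "quillen_coboundary X F \<epsilon> M q \<phi> =
     finprod (quillen_cochains X F \<epsilon> M (Suc q))
       (\<lambda>i. compose (carrier (cotangent X F \<epsilon> (Suc q))) \<phi> (cotangent_face X F \<epsilon> (Suc q) i)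
          [^]\<^bsub>quillen_cochains X F \<epsilon> M (Suc q)\<^esub> ((-1) ^ i :: int))
       {..Suc q}"

text \<open>The Quillen cohomology of X with coefficients in M, computed from a cofibrant replacement
  \<open>\<epsilon> : F \<rightarrow> X\<close>.\<close>

definition quillen_cohomology :: "('x, 'u) rack_scheme \<Rightarrow> ('f, 'v) simplicial_rack_scheme \<Rightarrow>
    (nat \<Rightarrow> 'f \<Rightarrow> 'x) \<Rightarrow> ('m, 'x, 'w) beck_module_scheme \<Rightarrow> nat \<Rightarrow>
    ('x \<times> ('f, 'x) bterm set \<Rightarrow> 'm) set monoid" where
  "quillen_cohomology X F \<epsilon> M n =
     cohomology (quillen_cochains X F \<epsilon> M) (quillen_coboundary X F \<epsilon> M) n"

end

theory Submission
  imports Defs "HOL-Algebra.Bij"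
begin

text \<open>Consider the bicomplex with the homomorphisms from \<open>\<int>[F\<^sub>q ^ (p + 1)]\<close> to A in position \<open>(p, q)\<close>,
  where the differential d in direction p is that of rack cochains and the differential D in
  direction q is the alternating sum over the faces of F.  Its lines in both directions are exact
  away from their beginnings.  At the beginning of the lines in direction q the kernel of D is the
  complex of rack cochains of X, shifted by one; at the beginning of the lines in direction p the
  kernel of d is the complex of Quillen cochains.  Walking down the staircases of the bicomplex
  identifies the cohomology of the two (\<open>staircase\<close>).

  The lines in direction q.  Apply the definition of a weak equivalence to the Kan complex
  \<open>\<int>[F]\<close>: up to a simplicial homotopy H, the inclusion of F into \<open>\<int>[F]\<close> factors through the
  discrete X (\<open>weak_equivalence_discrete\<close>).  Since H takes values in abelian groups, it can be
  multiplied with itself, and the tensor powers of H are simplicial homotopies for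
  \<open>\<int>[F ^ p]\<close>, the degreewise tensor power of \<open>\<int>[F]\<close>.  Hence the
  prism operator of a tensor power of H is a contraction of the chains on the power of F
  (\<open>simplicial_power_contraction\<close>); being linear, it applies to coefficients in any A.

  The lines in direction p.  Each \<open>F\<^sub>q\<close> is a retract of a free rack, so a contraction of the rack
  chains of a free rack in degrees at least 2 is needed (\<open>free_rack_contraction\<close>).  Prepending an
  element b to a tuple is a chain homotopy from the identity to the action of b.  These homotopies
  compose as in the Fox calculus, so that every word \<open>\<sigma>\<close> in the generators carries a homotopy \<open>\<phi>\<close>
  from the identity to the action of \<open>\<sigma>\<close>.  An element x of the free rack is \<open>\<sigma> b\<close> for a
  generator b and a word \<open>\<sigma>\<close>, and the contraction applies the homotopy \<open>\<phi>\<close> to the tuple that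
  begins with x, moved back by \<open>\<sigma>\<close>.

  The kernel of d in position \<open>(0, q)\<close> consists of the functions f from \<open>F\<^sub>q\<close> to A that satisfy
  \<open>f (y \<rhd> z) = f z\<close>.  They are the morphisms over X from \<open>F\<^sub>q\<close> to \<open>A \<times> X\<close>, hence by adjunction the
  morphisms of Beck modules from \<open>\<Omega> F\<^sub>q\<close> to \<open>A \<times> X\<close> (\<open>quillen_cohomology_edge\<close>).\<close>

section \<open>Linear maps between free abelian groups\<close>

definition push :: "('a \<Rightarrow> 'b) \<Rightarrow> ('a \<Rightarrow>\<^sub>0 int) \<Rightarrow> ('b \<Rightarrow>\<^sub>0 int)" where
  "push f = frag_extend (\<lambda>x. frag_of (f x))"

lemma push_frag_of [simp]: "push f (frag_of x) = frag_of (f x)"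
  and push_0 [simp]: "push f 0 = 0"
  and push_diff: "push f (a - b) = push f a - push f b"
  and push_add: "push f (a + b) = push f a + push f b"
  and push_minus: "push f (- a) = - push f a"
  and push_cmul: "push f (frag_cmul k a) = frag_cmul k (push f a)"
  by (simp_all add: push_def frag_extend_diff frag_extend_add frag_extend_minus frag_extend_cmul)

lemma frag_extend_frag_extend:
  "frag_extend f (frag_extend g c) = frag_extend (\<lambda>x. frag_extend f (g x)) c"
  using subset_UNIV by (induction c rule: frag_induction) (auto simp: frag_extend_diff)

lemma frag_extend_add_fun: "frag_extend (\<lambda>x. f x + g x) c = frag_extend f c + frag_extend g c"
  using subset_UNIV by (induction c rule: frag_induction) (auto simp: frag_extend_diff)

lemma frag_extend_diff_fun: "frag_extend (\<lambda>x. f x - g x) c = frag_extend f c - frag_extend g c"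
  using subset_UNIV by (induction c rule: frag_induction) (auto simp: frag_extend_diff)

lemma frag_extend_cmul_fun: "frag_extend (\<lambda>x. frag_cmul k (f x)) c = frag_cmul k (frag_extend f c)"
  using subset_UNIV
proof (induction c rule: frag_induction)
  case (diff a b)
  then show ?case
    by (metis (no_types) frag_cmul_distrib2 add_diff_cancel_right' diff_add_cancel frag_extend_diff)
qed auto

lemma frag_extend_sum_fun: "frag_extend (\<lambda>x. \<Sum>i\<in>I. f i x) c = (\<Sum>i\<in>I. frag_extend (f i) c)"
  using subset_UNIV
  by (induction c rule: frag_induction) (auto simp: frag_extend_diff sum_subtractf)

lemma frag_extend_frag_of [simp]: "frag_extend frag_of c = c"
  using frag_expansion[of c] by simp

lemma push_push: "push f (push g c) = push (f \<circ> g) c"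
  by (simp add: push_def frag_extend_frag_extend)

lemma frag_extend_push: "frag_extend f (push g c) = frag_extend (f \<circ> g) c"
  by (simp add: push_def frag_extend_frag_extend comp_def)

lemma push_frag_extend: "push f (frag_extend g c) = frag_extend (push f \<circ> g) c"
  by (simp add: push_def frag_extend_frag_extend comp_def)

lemma push_sum: "push f (sum g I) = (\<Sum>i\<in>I. push f (g i))"
  by (induction I rule: infinite_finite_induct) (auto simp: push_add)

lemma frag_extend_sum': "frag_extend f (sum g I) = (\<Sum>i\<in>I. frag_extend f (g i))"
  by (induction I rule: infinite_finite_induct) (auto simp: frag_extend_add)

lemma push_cong: "(\<And>x. x \<in> Poly_Mapping.keys c \<Longrightarrow> f x = g x) \<Longrightarrow> push f c = push g c"
  unfolding push_def by (rule frag_extend_eq) simp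

lemma push_ident: "(\<And>x. x \<in> Poly_Mapping.keys c \<Longrightarrow> f x = x) \<Longrightarrow> push f c = c"
  using push_cong[of c f "\<lambda>x. x"] by (simp add: push_def)

lemma keys_push: "Poly_Mapping.keys (push f c) \<subseteq> f ` Poly_Mapping.keys c"
  unfolding push_def by (rule order_trans[OF keys_frag_extend]) auto

lemma keys_extend_subset:
  assumes "Poly_Mapping.keys c \<subseteq> S" "\<And>x. x \<in> S \<Longrightarrow> Poly_Mapping.keys (f x) \<subseteq> T"
  shows "Poly_Mapping.keys (frag_extend f c) \<subseteq> T"
  using keys_frag_extend[of f c] assms by blast

lemma keys_push_subset: "Poly_Mapping.keys c \<subseteq> S \<Longrightarrow> f \<in> S \<rightarrow> T \<Longrightarrow> Poly_Mapping.keys (push f c) \<subseteq> T"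
  using keys_push[of f c] by blast

lemma keys_diff_subset:
  "Poly_Mapping.keys a \<subseteq> S \<Longrightarrow> Poly_Mapping.keys b \<subseteq> S \<Longrightarrow> Poly_Mapping.keys (a - b) \<subseteq> S"
  using keys_diff[of a b] by blast

lemma keys_add_subset:
  "Poly_Mapping.keys a \<subseteq> S \<Longrightarrow> Poly_Mapping.keys b \<subseteq> S \<Longrightarrow> Poly_Mapping.keys (a + b) \<subseteq> S"
  using keys_add[of a b] by blast

lemma keys_sum_subset:
  "(\<And>i. i \<in> I \<Longrightarrow> Poly_Mapping.keys (f i) \<subseteq> S) \<Longrightarrow> Poly_Mapping.keys (sum f I) \<subseteq> S"
  using keys_sum[of f I] by blast

lemma keys_cmul_subset: "Poly_Mapping.keys a \<subseteq> S \<Longrightarrow> Poly_Mapping.keys (frag_cmul k a) \<subseteq> S"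
  using keys_cmul[of k a] by blast

section \<open>The rack chain complex\<close>

abbreviation tuples :: "'x set \<Rightarrow> nat \<Rightarrow> 'x list set" where
  "tuples S n \<equiv> {xs. length xs = n \<and> set xs \<subseteq> S}"

lemma map_tuples: "f \<in> S \<rightarrow> T \<Longrightarrow> map f \<in> tuples S n \<rightarrow> tuples T n"
  by (auto simp: Pi_iff subset_iff)

lemma rack_boundary_extend:
  "rack_boundary X c = frag_extend (\<lambda>xs. rack_boundary X (frag_of xs)) c"
  by (simp add: rack_boundary_def frag_extend_diff_fun)

lemma rack_boundary_0 [simp]: "rack_boundary X 0 = 0"
  and rack_boundary_diff: "rack_boundary X (a - b) = rack_boundary X a - rack_boundary X b"
  and rack_boundary_add: "rack_boundary X (a + b) = rack_boundary X a + rack_boundary X b"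
  by (simp_all add: rack_boundary_extend[of X "a - b"] rack_boundary_extend[of X "a + b"]
      rack_boundary_extend[of X a] rack_boundary_extend[of X b] rack_boundary_extend[of X 0]
      frag_extend_diff frag_extend_add)

lemma rack_boundary_Nil [simp]: "rack_boundary X (frag_of []) = 0"
  by (simp add: rack_boundary_def)

text \<open>The terms that delete or apply the first entry x are separated from the rest.  Read as an
  identity of operators, this says that prepending x is a chain homotopy from the identity to the
  action of x.  All later computations with the boundary go through this recursion.\<close>

lemma rack_boundary_Cons:
  "rack_boundary X (frag_of (x # w)) =
     frag_of (map (\<lambda>y. x \<rhd>\<^bsub>X\<^esub> y) w) - frag_of w - push ((#) x) (rack_boundary X (frag_of w))"
proof -
  have 0: "(\<Sum>i<length (x # w). frag_cmul ((-1) ^ Suc i) (frag_of (rack_face0 i (x # w)))) =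
      - frag_of w - push ((#) x) (\<Sum>i<length w. frag_cmul ((-1) ^ Suc i) (frag_of (rack_face0 i w)))"
    by (simp add: rack_face0_def sum.lessThan_Suc_shift push_sum push_cmul flip: sum_negf
        del: sum.lessThan_Suc)
  have 1: "(\<Sum>i<length (x # w). frag_cmul ((-1) ^ Suc i) (frag_of (rack_face1 X i (x # w)))) =
      - frag_of (map (\<lambda>y. x \<rhd>\<^bsub>X\<^esub> y) w)
      - push ((#) x) (\<Sum>i<length w. frag_cmul ((-1) ^ Suc i) (frag_of (rack_face1 X i w)))"
    by (simp add: rack_face1_def sum.lessThan_Suc_shift push_sum push_cmul flip: sum_negf
        del: sum.lessThan_Suc)
  show ?thesis
    unfolding rack_boundary_def frag_extend_of 0 1 push_diff by simp
qed

lemma rack_boundary_cons: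
  "rack_boundary X (push ((#) x) c) =
     push (map (\<lambda>y. x \<rhd>\<^bsub>X\<^esub> y)) c - c - push ((#) x) (rack_boundary X c)"
  using subset_UNIV
  by (induction c rule: frag_induction) (auto simp: rack_boundary_Cons rack_boundary_diff push_diff)

lemma rack_translation_hom: "\<lbrakk>rack X; x \<in> carrier X\<rbrakk> \<Longrightarrow> (\<lambda>y. x \<rhd>\<^bsub>X\<^esub> y) \<in> rack_hom X X"
  by (auto simp: rack_hom_def intro: rack_act_closed rack.act_distrib)

lemma rack_boundary_natural_tuple:
  assumes f: "f \<in> rack_hom X Y"
  shows "set w \<subseteq> carrier X \<Longrightarrow>
    rack_boundary Y (frag_of (map f w)) = push (map f) (rack_boundary X (frag_of w))"
proof (induction w)
  case (Cons x w)
  have "map (\<lambda>y. f x \<rhd>\<^bsub>Y\<^esub> y) (map f w) = map f (map (\<lambda>y. x \<rhd>\<^bsub>X\<^esub> y) w)"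
    using f Cons(2) by (auto simp: rack_hom_def)
  then have "map (\<lambda>y. f x \<rhd>\<^bsub>Y\<^esub> f y) w = map (\<lambda>y. f (x \<rhd>\<^bsub>X\<^esub> y)) w"
    by (simp add: comp_def)
  then show ?case
    using Cons by (simp add: rack_boundary_Cons push_diff push_push comp_def del: map_eq_conv)
qed simp

lemma rack_boundary_natural:
  assumes "f \<in> rack_hom X Y" "Poly_Mapping.keys c \<subseteq> lists (carrier X)"
  shows "rack_boundary Y (push (map f) c) = push (map f) (rack_boundary X c)"
  using assms(2)
  by (induction c rule: frag_induction)
    (auto simp: rack_boundary_diff push_diff subset_iff intro: rack_boundary_natural_tuple[OF assms(1)])

lemma keys_rack_boundary_tuple:
  assumes "rack X"
  shows "w \<in> tuples (carrier X) (Suc n) \<Longrightarrow>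
    Poly_Mapping.keys (rack_boundary X (frag_of w)) \<subseteq> tuples (carrier X) n"
proof (induction w arbitrary: n)
  case (Cons x w)
  have "Poly_Mapping.keys (push ((#) x) (rack_boundary X (frag_of w))) \<subseteq> tuples (carrier X) n"
  proof (cases w)
    case (Cons y w')
    then obtain m where m: "n = Suc m" using Cons.prems by auto
    show ?thesis
      by (rule keys_push_subset[OF Cons.IH[of m]]) (use Cons.prems m in auto)
  qed simp
  then show ?case
    using Cons.prems unfolding rack_boundary_Cons
    by (intro keys_diff_subset) (auto intro: rack_act_closed[OF assms])
qed auto

lemma keys_rack_boundary:
  assumes "rack X" "Poly_Mapping.keys c \<subseteq> tuples (carrier X) (Suc n)"
  shows "Poly_Mapping.keys (rack_boundary X c) \<subseteq> tuples (carrier X) n"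
  by (subst rack_boundary_extend, rule keys_extend_subset[OF assms(2)])
    (rule keys_rack_boundary_tuple[OF assms(1)])

text \<open>The recursion reduces this to the shorter tuple, because the boundary commutes with the
  homomorphism \<open>\<lambda>y. x \<rhd> y\<close>.\<close>

lemma rack_boundary_boundary_tuple:
  assumes X: "rack X"
  shows "set w \<subseteq> carrier X \<Longrightarrow> rack_boundary X (rack_boundary X (frag_of w)) = 0"
proof (induction w)
  case (Cons x w)
  then have "push (map (\<lambda>y. x \<rhd>\<^bsub>X\<^esub> y)) (rack_boundary X (frag_of w)) =
      rack_boundary X (frag_of (map (\<lambda>y. x \<rhd>\<^bsub>X\<^esub> y) w))"
    using rack_boundary_natural_tuple[OF rack_translation_hom[OF X]] by auto
  then show ?case
    using Cons by (simp add: rack_boundary_Cons rack_boundary_diff rack_boundary_cons)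
qed simp

lemma rack_boundary_boundary:
  assumes "rack X" "Poly_Mapping.keys c \<subseteq> lists (carrier X)"
  shows "rack_boundary X (rack_boundary X c) = 0"
  using assms(2)
  by (induction c rule: frag_induction)
    (auto simp: rack_boundary_diff subset_iff intro: rack_boundary_boundary_tuple[OF assms(1)])

section \<open>Free racks are acyclic\<close>

lemma rack_iso_inv:
  assumes "f \<in> rack_iso X Y" "rack X"
  shows "inv_into (carrier X) f \<in> rack_iso Y X"
proof -
  have bij: "bij_betw f (carrier X) (carrier Y)"
    and hom: "\<And>x y. \<lbrakk>x \<in> carrier X; y \<in> carrier X\<rbrakk> \<Longrightarrow> f (x \<rhd>\<^bsub>X\<^esub> y) = f x \<rhd>\<^bsub>Y\<^esub> f y"
    using assms by (auto simp: rack_iso_def rack_hom_def)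
  let ?g = "inv_into (carrier X) f"
  have g: "?g y \<in> carrier X" "f (?g y) = y" if "y \<in> carrier Y" for y
    using bij that by (auto simp: bij_betw_def inv_into_into f_inv_into_f)
  have "?g (x \<rhd>\<^bsub>Y\<^esub> y) = ?g x \<rhd>\<^bsub>X\<^esub> ?g y" if "x \<in> carrier Y" "y \<in> carrier Y" for x y
    using hom[of "?g x" "?g y"] g that bij
    by (metis assms(2) bij_betw_inv_into_left rack_act_closed)
  then show ?thesis
    using g bij_betw_inv_into[OF bij] by (auto simp: rack_iso_def rack_hom_def)
qed

lemma rack_hom_comp: "\<lbrakk>f \<in> rack_hom X Y; g \<in> rack_hom Y Z\<rbrakk> \<Longrightarrow> g \<circ> f \<in> rack_hom X Z"
  by (auto simp: rack_hom_def Pi_iff)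

text \<open>The universal property of the free rack on B, for a rack that is only isomorphic to it.\<close>

lemma free_on_lift:
  assumes free: "free_on X B" and E: "rack E" and f: "f \<in> B \<rightarrow> carrier E"
  obtains k where "k \<in> rack_hom X E" "\<And>b. b \<in> B \<Longrightarrow> k b = f b"
proof -
  obtain h where h: "h \<in> rack_iso (free_rack B) X" and hb: "\<And>b. b \<in> B \<Longrightarrow> h (free_rack_unit B b) = b"
    using free by (auto simp: free_on_def)
  obtain k where k: "k \<in> rack_hom (free_rack B) E" and kb: "\<And>b. b \<in> B \<Longrightarrow> k (free_rack_unit B b) = f b"
    using free_rack_universal[OF E f] by blast
  let ?i = "inv_into (carrier (free_rack B)) h"
  have "?i \<in> rack_hom X (free_rack B)"
    using rack_iso_inv[OF h free_rack_is_rack] by (simp add: rack_iso_def)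
  moreover have "?i b = free_rack_unit B b" if "b \<in> B" for b
  proof -
    have "free_rack_unit B b \<in> carrier (free_rack B)"
      using that by (auto simp: free_rack_unit_def free_rack_carrier)
    moreover have "bij_betw h (carrier (free_rack B)) (carrier X)" using h by (simp add: rack_iso_def)
    ultimately show ?thesis using bij_betw_inv_into_left hb[OF that] by metis
  qed
  ultimately show ?thesis
    using that[of "k \<circ> ?i"] rack_hom_comp k kb by force
qed

lemma free_on_hom_eqI:
  assumes free: "free_on X B" and E: "rack E" and k: "k \<in> rack_hom X E" and l: "l \<in> rack_hom X E"
    and eq: "\<And>b. b \<in> B \<Longrightarrow> k b = l b" and x: "x \<in> carrier X"
  shows "k x = l x"
proof -
  let ?L = "free_rack B"
  obtain h where h: "h \<in> rack_iso ?L X" and hb: "\<And>b. b \<in> B \<Longrightarrow> h (free_rack_unit B b) = b"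
    using free by (auto simp: free_on_def)
  have B: "B \<subseteq> carrier X" using free by (simp add: free_on_def)
  have restr: "restrict (m \<circ> h) (carrier ?L) \<in> rack_hom ?L E \<inter> extensional (carrier ?L)"
    if "m \<in> rack_hom X E" for m
    using h that rack_act_closed[OF free_rack_is_rack] by (auto simp: rack_iso_def rack_hom_def Pi_iff)
  have unit: "free_rack_unit B b \<in> carrier ?L" if "b \<in> B" for b
    using that by (auto simp: free_rack_unit_def free_rack_carrier)
  have "k \<in> B \<rightarrow> carrier E" using k B by (auto simp: rack_hom_def)
  from ex1_implies_ex[OF free_rack_universal[OF E this]] free_rack_universal[OF E this]
  obtain m where m: "\<And>n. n \<in> rack_hom ?L E \<inter> extensional (carrier ?L) \<and>
      (\<forall>b\<in>B. n (free_rack_unit B b) = k b) \<Longrightarrow> n = m"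
    unfolding Ex1_def by blast
  have "restrict (k \<circ> h) (carrier ?L) = m" "restrict (l \<circ> h) (carrier ?L) = m"
    by (rule m; use restr[OF k] restr[OF l] unit hb eq in simp)+
  then have "restrict (k \<circ> h) (carrier ?L) = restrict (l \<circ> h) (carrier ?L)" by simp
  moreover obtain y where "y \<in> carrier ?L" "x = h y"
    using h x by (auto simp: rack_iso_def bij_betw_def)
  ultimately show ?thesis by (metis comp_apply restrict_apply')
qed

text \<open>When G is the free group on B and \<open>\<theta>\<close> the inclusion, this is the free rack on B, the
  element \<open>(g, b)\<close> standing for the conjugate of b by g.\<close>

definition conjugate_rack :: "('g, 'z) monoid_scheme \<Rightarrow> 'b set \<Rightarrow> ('b \<Rightarrow> 'g) \<Rightarrow> ('g \<times> 'b) rack" where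
  "conjugate_rack G B \<theta> = \<lparr>carrier = carrier G \<times> B,
     act = (\<lambda>(g, b) (h, c). (g \<otimes>\<^bsub>G\<^esub> \<theta> b \<otimes>\<^bsub>G\<^esub> inv\<^bsub>G\<^esub> g \<otimes>\<^bsub>G\<^esub> h, c))\<rparr>"

lemma conjugate_rack_is_rack:
  fixes G (structure)
  assumes "group G" and \<theta>: "\<theta> \<in> B \<rightarrow> carrier G"
  shows "rack (conjugate_rack G B \<theta>)"
proof -
  interpret group G by fact
  have \<theta>': "\<theta> b \<in> carrier G" if "b \<in> B" for b using \<theta> that by auto
  let ?c = "\<lambda>g b. g \<otimes> \<theta> b \<otimes> inv g"
  show ?thesis
  proof (rule rack.intro)
    fix x assume "x \<in> carrier (conjugate_rack G B \<theta>)"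
    then obtain g b where x: "x = (g, b)" "g \<in> carrier G" "b \<in> B" by (auto simp: conjugate_rack_def)
    then have c: "?c g b \<in> carrier G" by (simp add: \<theta>')
    show "bij_betw (\<lambda>y. x \<rhd>\<^bsub>conjugate_rack G B \<theta>\<^esub> y) (carrier (conjugate_rack G B \<theta>))
        (carrier (conjugate_rack G B \<theta>))"
    proof (rule bij_betw_byWitness[where f' = "\<lambda>(h, c). (inv (?c g b) \<otimes> h, c)"])
      show "\<forall>y\<in>carrier (conjugate_rack G B \<theta>). (case x \<rhd>\<^bsub>conjugate_rack G B \<theta>\<^esub> y of (h, c) \<Rightarrow> (inv (?c g b) \<otimes> h, c)) = y"
        "\<forall>y\<in>carrier (conjugate_rack G B \<theta>). x \<rhd>\<^bsub>conjugate_rack G B \<theta>\<^esub> (case y of (h, c) \<Rightarrow> (inv (?c g b) \<otimes> h, c)) = y"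
        using x c by (auto simp: conjugate_rack_def m_assoc[symmetric] simp del: inv_mult_group)
    qed (use x c in \<open>auto simp: conjugate_rack_def\<close>)
  next
    fix x y z assume "x \<in> carrier (conjugate_rack G B \<theta>)" "y \<in> carrier (conjugate_rack G B \<theta>)"
      "z \<in> carrier (conjugate_rack G B \<theta>)"
    then obtain g b h c k d where xyz: "x = (g, b)" "y = (h, c)" "z = (k, d)"
      and cl: "g \<in> carrier G" "b \<in> B" "h \<in> carrier G" "c \<in> B" "k \<in> carrier G"
      by (auto simp: conjugate_rack_def)
    define u where "u = ?c g b"
    have u: "u \<in> carrier G" using cl by (simp add: u_def \<theta>')
    have "inv u \<otimes> (u \<otimes> k) = k" using cl u by (simp add: m_assoc[symmetric])
    then have "u \<otimes> h \<otimes> \<theta> c \<otimes> inv (u \<otimes> h) \<otimes> (u \<otimes> k) = u \<otimes> h \<otimes> \<theta> c \<otimes> inv h \<otimes> k"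
      using cl u by (simp add: inv_mult_group m_assoc \<theta>')
    also have "\<dots> = u \<otimes> (h \<otimes> \<theta> c \<otimes> inv h \<otimes> k)"
      using cl u by (simp add: m_assoc \<theta>')
    finally show "x \<rhd>\<^bsub>conjugate_rack G B \<theta>\<^esub> (y \<rhd>\<^bsub>conjugate_rack G B \<theta>\<^esub> z) =
        (x \<rhd>\<^bsub>conjugate_rack G B \<theta>\<^esub> y) \<rhd>\<^bsub>conjugate_rack G B \<theta>\<^esub> (x \<rhd>\<^bsub>conjugate_rack G B \<theta>\<^esub> z)"
      by (simp add: xyz conjugate_rack_def flip: u_def)
  qed
qed

text \<open>The map g acts on pairs of a tuple and a chain by \<open>(w, a) \<mapsto> (\<sigma> w, a + \<phi> w)\<close>, and the
  equation says that \<open>\<phi>\<close> is a chain homotopy from the identity to the action of \<open>\<sigma>\<close>.  Pairs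
  \<open>(\<sigma>, \<phi>)\<close> are encoded as permutations so that their group laws are those of composition.\<close>

definition chain_affine :: "('r, 'z) rack_scheme \<Rightarrow> ('r \<Rightarrow> 'r) \<Rightarrow> ('r list \<Rightarrow> ('r list \<Rightarrow>\<^sub>0 int)) \<Rightarrow>
    ('r list \<times> ('r list \<Rightarrow>\<^sub>0 int) \<Rightarrow> 'r list \<times> ('r list \<Rightarrow>\<^sub>0 int)) \<Rightarrow> bool" where
  "chain_affine R \<sigma> \<phi> g \<longleftrightarrow> \<sigma> \<in> rack_iso R R \<and>
     g \<in> extensional (lists (carrier R) \<times> UNIV) \<and>
     (\<forall>w\<in>lists (carrier R).
        Poly_Mapping.keys (\<phi> w) \<subseteq> tuples (carrier R) (Suc (length w)) \<and>
        rack_boundary R (\<phi> w) + frag_extend \<phi> (rack_boundary R (frag_of w))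
          = frag_of (map \<sigma> w) - frag_of w \<and>
        (\<forall>a. g (w, a) = (map \<sigma> w, a + \<phi> w)))"

context
  fixes R :: "('r, 'z) rack_scheme" (structure)
  assumes R: "rack R"
begin

abbreviation "points \<equiv> lists (carrier R) \<times> (UNIV :: ('r list \<Rightarrow>\<^sub>0 int) set)"
abbreviation "affine \<equiv> chain_affine R"

lemma map_iso_lists: "\<sigma> \<in> rack_iso R R \<Longrightarrow> w \<in> lists (carrier R) \<Longrightarrow> map \<sigma> w \<in> lists (carrier R)"
  by (auto simp: rack_iso_def rack_hom_def Pi_iff)

lemma map_inv_iso:
  assumes "\<sigma> \<in> rack_iso R R" "w \<in> lists (carrier R)"
  shows "map \<sigma> (map (inv_into (carrier R) \<sigma>) w) = w" "map (inv_into (carrier R) \<sigma>) (map \<sigma> w) = w"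
proof -
  have bij: "bij_betw \<sigma> (carrier R) (carrier R)" using assms by (simp add: rack_iso_def)
  show "map \<sigma> (map (inv_into (carrier R) \<sigma>) w) = w" "map (inv_into (carrier R) \<sigma>) (map \<sigma> w) = w"
    using assms(2) bij_betw_inv_into_right[OF bij] bij_betw_inv_into_left[OF bij]
    by (auto intro!: map_idI simp: subset_iff lists_eq_set)
qed

lemma affine_Bij:
  assumes "affine \<sigma> \<phi> g"
  shows "g \<in> Bij points"
proof -
  have \<sigma>: "\<sigma> \<in> rack_iso R R" and g: "\<And>w a. w \<in> lists (carrier R) \<Longrightarrow> g (w, a) = (map \<sigma> w, a + \<phi> w)"
    and ext: "g \<in> extensional points"
    using assms by (auto simp: chain_affine_def)
  note \<sigma>' = rack_iso_inv[OF \<sigma> R]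
  let ?i = "\<lambda>(w, a). (map (inv_into (carrier R) \<sigma>) w, a - \<phi> (map (inv_into (carrier R) \<sigma>) w))"
  have "bij_betw g points points"
  proof (rule bij_betw_byWitness[where f' = ?i])
    have *: "g p \<in> points" "?i (g p) = p" "?i p \<in> points" "g (?i p) = p" if p: "p \<in> points" for p
    proof -
      obtain w a where p': "p = (w, a)" and w: "w \<in> lists (carrier R)" using p by blast
      note iso = map_iso_lists[OF \<sigma> w] map_iso_lists[OF \<sigma>' w] map_inv_iso[OF \<sigma> w]
      show "g p \<in> points" "?i (g p) = p" "?i p \<in> points" "g (?i p) = p"
        unfolding p' prod.case g[OF w] g[OF iso(2)] iso(3,4) using iso(1,2) w by simp_all
    qed
    show "\<forall>p\<in>points. ?i (g p) = p" "g ` points \<subseteq> points"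
      "\<forall>p\<in>points. g (?i p) = p" "?i ` points \<subseteq> points"
      using * by blast+
  qed
  then show ?thesis using ext by (simp add: Bij_def)
qed

text \<open>The homotopies compose according to \<open>\<sigma> \<tau> - 1 = (\<sigma> - 1) \<tau> + (\<tau> - 1)\<close>.\<close>

lemma affine_compose:
  assumes "affine \<sigma> \<phi> g" "affine \<tau> \<psi> h"
  shows "affine (\<sigma> \<circ> \<tau>) (\<lambda>w. \<psi> w + \<phi> (map \<tau> w)) (compose points g h)"
  unfolding chain_affine_def
proof (intro conjI ballI allI)
  have \<sigma>: "\<sigma> \<in> rack_iso R R" and \<tau>: "\<tau> \<in> rack_iso R R" using assms by (auto simp: chain_affine_def)
  show "\<sigma> \<circ> \<tau> \<in> rack_iso R R"
    using \<sigma> \<tau> by (auto simp: rack_iso_def intro: rack_hom_comp bij_betw_trans)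
  show "compose points g h \<in> extensional points" by simp
  fix w assume w: "w \<in> lists (carrier R)"
  note \<tau>w = map_iso_lists[OF \<tau> w]
  show "compose points g h (w, a) = (map (\<sigma> \<circ> \<tau>) w, a + (\<psi> w + \<phi> (map \<tau> w)))" for a
    using assms w \<tau>w by (simp add: compose_def chain_affine_def add.assoc)
  show "Poly_Mapping.keys (\<psi> w + \<phi> (map \<tau> w)) \<subseteq> tuples (carrier R) (Suc (length w))"
  proof (rule keys_add_subset)
    show "Poly_Mapping.keys (\<psi> w) \<subseteq> tuples (carrier R) (Suc (length w))"
      using assms w unfolding chain_affine_def by blast
    have "Poly_Mapping.keys (\<phi> (map \<tau> w)) \<subseteq> tuples (carrier R) (Suc (length (map \<tau> w)))"
      using assms \<tau>w unfolding chain_affine_def by blast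
    then show "Poly_Mapping.keys (\<phi> (map \<tau> w)) \<subseteq> tuples (carrier R) (Suc (length w))" by simp
  qed
  have "frag_extend (\<lambda>w. \<phi> (map \<tau> w)) (rack_boundary R (frag_of w))
      = frag_extend \<phi> (push (map \<tau>) (rack_boundary R (frag_of w)))"
    by (simp add: frag_extend_push comp_def)
  also have "push (map \<tau>) (rack_boundary R (frag_of w)) = rack_boundary R (frag_of (map \<tau> w))"
    by (rule rack_boundary_natural_tuple[symmetric]) (use \<tau> w in \<open>auto simp: rack_iso_def\<close>)
  moreover have "rack_boundary R (\<psi> w) + frag_extend \<psi> (rack_boundary R (frag_of w)) = frag_of (map \<tau> w) - frag_of w"
    "rack_boundary R (\<phi> (map \<tau> w)) + frag_extend \<phi> (rack_boundary R (frag_of (map \<tau> w)))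
      = frag_of (map \<sigma> (map \<tau> w)) - frag_of (map \<tau> w)"
    using assms w \<tau>w unfolding chain_affine_def by blast+
  moreover have "(a + c) + (b + d) = s - t" if "a + b = u - t" "c + d = s - u"
    for a b c d s t u :: "'r list \<Rightarrow>\<^sub>0 int"
    using arg_cong2[OF that, of "(+)"] by (simp add: algebra_simps)
  ultimately show "rack_boundary R (\<psi> w + \<phi> (map \<tau> w)) +
      frag_extend (\<lambda>w. \<psi> w + \<phi> (map \<tau> w)) (rack_boundary R (frag_of w))
    = frag_of (map (\<sigma> \<circ> \<tau>) w) - frag_of w"
    by (simp add: rack_boundary_add frag_extend_add_fun)
qed

lemma affine_inverse:
  assumes "affine \<sigma> \<phi> g"
  shows "affine (inv_into (carrier R) \<sigma>) (\<lambda>w. - \<phi> (map (inv_into (carrier R) \<sigma>) w))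
    (\<lambda>p\<in>points. inv_into points g p)"
  unfolding chain_affine_def
proof (intro conjI ballI allI)
  let ?\<tau> = "inv_into (carrier R) \<sigma>"
  have \<sigma>: "\<sigma> \<in> rack_iso R R" using assms by (auto simp: chain_affine_def)
  note \<tau> = rack_iso_inv[OF \<sigma> R]
  show "?\<tau> \<in> rack_iso R R" by (fact \<tau>)
  fix w assume w: "w \<in> lists (carrier R)"
  define v where "v = map ?\<tau> w"
  have v: "v \<in> lists (carrier R)" and vw: "map \<sigma> v = w"
    unfolding v_def using map_iso_lists[OF \<tau> w] map_inv_iso(1)[OF \<sigma> w] by auto
  show "Poly_Mapping.keys (- \<phi> (map ?\<tau> w)) \<subseteq> tuples (carrier R) (Suc (length w))"
  proof -
    have "Poly_Mapping.keys (\<phi> v) \<subseteq> tuples (carrier R) (Suc (length v))"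
      using assms v unfolding chain_affine_def by blast
    then show ?thesis by (simp add: v_def)
  qed
  have "frag_extend (\<lambda>w. \<phi> (map ?\<tau> w)) (rack_boundary R (frag_of w))
      = frag_extend \<phi> (push (map ?\<tau>) (rack_boundary R (frag_of w)))"
    by (simp add: frag_extend_push comp_def)
  also have "push (map ?\<tau>) (rack_boundary R (frag_of w)) = rack_boundary R (frag_of v)"
    unfolding v_def
    by (rule rack_boundary_natural_tuple[symmetric]) (use \<tau> w in \<open>auto simp: rack_iso_def\<close>)
  finally have *: "frag_extend (\<lambda>w. - \<phi> (map ?\<tau> w)) (rack_boundary R (frag_of w)) =
      - frag_extend \<phi> (rack_boundary R (frag_of v))"
    using frag_extend_cmul_fun[of "-1" "\<lambda>w. \<phi> (map ?\<tau> w)"] by simp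
  have "rack_boundary R (\<phi> v) + frag_extend \<phi> (rack_boundary R (frag_of v)) = frag_of w - frag_of v"
    using assms v vw unfolding chain_affine_def by metis
  then show "rack_boundary R (- \<phi> (map ?\<tau> w)) +
      frag_extend (\<lambda>w. - \<phi> (map ?\<tau> w)) (rack_boundary R (frag_of w)) = frag_of (map ?\<tau> w) - frag_of w"
    unfolding * v_def[symmetric] using rack_boundary_diff[of R 0 "\<phi> v"] by (simp add: algebra_simps)
  show "(\<lambda>p\<in>points. inv_into points g p) (w, a) = (map ?\<tau> w, a + - \<phi> (map ?\<tau> w))" for a
  proof -
    have "inv_into points g (w, a) = (v, a - \<phi> v)"
    proof (rule inv_into_f_eq)
      show "inj_on g points" using affine_Bij[OF assms] by (simp add: Bij_def bij_betw_def)
      show "g (v, a - \<phi> v) = (w, a)" using assms v vw by (simp add: chain_affine_def)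
    qed (use v in auto)
    then show ?thesis using w by (simp add: v_def)
  qed
qed simp

text \<open>Hence \<open>\<sigma>\<close> and \<open>\<phi>\<close> can be compared along equations between products in the group.\<close>

lemma affine_unique:
  assumes "affine \<sigma> \<phi> g" "affine \<tau> \<psi> g"
  shows "x \<in> carrier R \<Longrightarrow> \<sigma> x = \<tau> x" "w \<in> lists (carrier R) \<Longrightarrow> \<phi> w = \<psi> w"
proof -
  have eq: "(map \<sigma> w, 0 + \<phi> w) = (map \<tau> w, 0 + \<psi> w)" if "w \<in> lists (carrier R)" for w
    using assms that unfolding chain_affine_def by metis
  show "w \<in> lists (carrier R) \<Longrightarrow> \<phi> w = \<psi> w" using eq by simp
  show "x \<in> carrier R \<Longrightarrow> \<sigma> x = \<tau> x" using eq[of "[x]"] by simp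
qed

definition affine_group :: "('r list \<times> ('r list \<Rightarrow>\<^sub>0 int) \<Rightarrow> 'r list \<times> ('r list \<Rightarrow>\<^sub>0 int)) monoid" where
  "affine_group = BijGroup points \<lparr>carrier := {g. \<exists>\<sigma> \<phi>. affine \<sigma> \<phi> g}\<rparr>"

lemma affine_one: "affine (\<lambda>x. x) (\<lambda>w. 0) \<one>\<^bsub>BijGroup points\<^esub>"
  by (auto simp: chain_affine_def BijGroup_def rack_iso_def rack_hom_def frag_extend_eq_0 bij_betw_def)

lemma affine_subgroup: "subgroup {g. \<exists>\<sigma> \<phi>. affine \<sigma> \<phi> g} (BijGroup points)"
proof (rule subgroup.intro)
  show "{g. \<exists>\<sigma> \<phi>. affine \<sigma> \<phi> g} \<subseteq> carrier (BijGroup points)"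
    using affine_Bij by (auto simp: BijGroup_def)
  show "\<one>\<^bsub>BijGroup points\<^esub> \<in> {g. \<exists>\<sigma> \<phi>. affine \<sigma> \<phi> g}" using affine_one by blast
next
  fix g h assume "g \<in> {g. \<exists>\<sigma> \<phi>. affine \<sigma> \<phi> g}" "h \<in> {g. \<exists>\<sigma> \<phi>. affine \<sigma> \<phi> g}"
  then obtain \<sigma> \<phi> \<tau> \<psi> where *: "affine \<sigma> \<phi> g" "affine \<tau> \<psi> h" by blast
  show "g \<otimes>\<^bsub>BijGroup points\<^esub> h \<in> {g. \<exists>\<sigma> \<phi>. affine \<sigma> \<phi> g}"
    using affine_compose[OF *] affine_Bij[OF *(1)] affine_Bij[OF *(2)] by (auto simp: BijGroup_def)
next
  fix g assume "g \<in> {g. \<exists>\<sigma> \<phi>. affine \<sigma> \<phi> g}"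
  then obtain \<sigma> \<phi> where "affine \<sigma> \<phi> g" by blast
  from affine_inverse[OF this] show "inv\<^bsub>BijGroup points\<^esub> g \<in> {g. \<exists>\<sigma> \<phi>. affine \<sigma> \<phi> g}"
    unfolding inv_BijGroup[OF affine_Bij[OF \<open>affine \<sigma> \<phi> g\<close>]] by blast
qed

lemma group_affine_group: "group affine_group"
  unfolding affine_group_def by (rule subgroup.subgroup_is_group[OF affine_subgroup group_BijGroup])

lemma affine_group_mult:
  "\<lbrakk>affine \<sigma> \<phi> g; affine \<tau> \<psi> h\<rbrakk> \<Longrightarrow>
    affine (\<sigma> \<circ> \<tau>) (\<lambda>w. \<psi> w + \<phi> (map \<tau> w)) (g \<otimes>\<^bsub>affine_group\<^esub> h)"
  using affine_compose affine_Bij by (simp add: affine_group_def BijGroup_def)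

lemma affine_group_inv:
  assumes "affine \<sigma> \<phi> g"
  shows "affine (inv_into (carrier R) \<sigma>) (\<lambda>w. - \<phi> (map (inv_into (carrier R) \<sigma>) w)) (inv\<^bsub>affine_group\<^esub> g)"
proof -
  have "inv\<^bsub>affine_group\<^esub> g = inv\<^bsub>BijGroup points\<^esub> g"
    unfolding affine_group_def
    by (rule group.m_inv_consistent[OF group_BijGroup affine_subgroup]) (use assms in blast)
  then show ?thesis using affine_inverse[OF assms] inv_BijGroup[OF affine_Bij[OF assms]] by simp
qed

definition translation :: "'r \<Rightarrow> 'r list \<times> ('r list \<Rightarrow>\<^sub>0 int) \<Rightarrow> 'r list \<times> ('r list \<Rightarrow>\<^sub>0 int)" where
  "translation b = (\<lambda>(w, a)\<in>points. (map (\<lambda>y. b \<rhd> y) w, a + frag_of (b # w)))"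

text \<open>The recursion for the boundary, read as a homotopy.\<close>

lemma affine_translation:
  assumes b: "b \<in> carrier R"
  shows "affine (\<lambda>y. b \<rhd> y) (\<lambda>w. frag_of (b # w)) (translation b)"
  unfolding chain_affine_def
proof (intro conjI ballI allI)
  show "(\<lambda>y. b \<rhd> y) \<in> rack_iso R R"
    using rack_translation_hom[OF R b] rack.act_bij[OF R b] by (simp add: rack_iso_def)
  fix w assume w: "w \<in> lists (carrier R)"
  have "frag_extend (\<lambda>w. frag_of (b # w)) = push ((#) b)" by (simp add: push_def fun_eq_iff)
  then show "rack_boundary R (frag_of (b # w)) + frag_extend (\<lambda>w. frag_of (b # w)) (rack_boundary R (frag_of w))
      = frag_of (map (\<lambda>y. b \<rhd> y) w) - frag_of w"
    by (simp add: rack_boundary_Cons)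
qed (use b in \<open>auto simp: translation_def lists_eq_set\<close>)

text \<open>The universal property, applied to the conjugates of the translations by generators, attaches to
  each x an automorphism \<open>\<sigma> x\<close>, a homotopy \<open>\<phi> x\<close> from 1 to \<open>\<sigma> x\<close>, and a generator \<open>\<beta> x\<close> with
  \<open>\<sigma> x (\<beta> x) = x\<close>.  The contraction sends a tuple w with first entry x to \<open>\<phi> x\<close> at the tuple that
  \<open>\<sigma> x\<close> moves to w; its first entry is \<open>\<beta> x\<close>.  In length one the left hand side of the second
  property is \<open>w - [\<beta> x]\<close> instead, in accordance with the homology in degree 1.\<close>

theorem free_rack_contraction:
  assumes free: "free_on R B"
  obtains s where
    "\<And>w. w \<in> lists (carrier R) \<Longrightarrow> Poly_Mapping.keys (s w) \<subseteq> tuples (carrier R) (Suc (length w))"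
    "\<And>w. w \<in> lists (carrier R) \<Longrightarrow> 2 \<le> length w \<Longrightarrow>
       rack_boundary R (s w) + frag_extend s (rack_boundary R (frag_of w)) = frag_of w"
proof -
  let ?G = affine_group
  interpret G: group ?G by (rule group_affine_group)
  have B: "B \<subseteq> carrier R" using free by (simp add: free_on_def)
  have \<theta>: "translation \<in> B \<rightarrow> carrier ?G"
    using affine_translation B by (force simp: affine_group_def)
  define E where "E = conjugate_rack ?G B translation"
  have E: "rack E" unfolding E_def by (rule conjugate_rack_is_rack[OF group_affine_group \<theta>])
  have "(\<lambda>b. (\<one>\<^bsub>?G\<^esub>, b)) \<in> B \<rightarrow> carrier E" by (auto simp: E_def conjugate_rack_def)
  from free_on_lift[OF free E this] obtain k where k: "k \<in> rack_hom R E"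
    and kB: "\<And>b. b \<in> B \<Longrightarrow> k b = (\<one>\<^bsub>?G\<^esub>, b)" by metis
  define g where "g x = fst (k x)" for x
  define \<beta> where "\<beta> x = snd (k x)" for x
  have kE: "g x \<in> carrier ?G" "\<beta> x \<in> B" if "x \<in> carrier R" for x
    using k that by (auto simp: g_def \<beta>_def rack_hom_def E_def conjugate_rack_def Pi_iff mem_Times_iff)
  then have \<beta>R: "\<beta> x \<in> carrier R" if "x \<in> carrier R" for x using that B by blast
  have kact: "g (x \<rhd> y) = g x \<otimes>\<^bsub>?G\<^esub> translation (\<beta> x) \<otimes>\<^bsub>?G\<^esub> inv\<^bsub>?G\<^esub> g x \<otimes>\<^bsub>?G\<^esub> g y" "\<beta> (x \<rhd> y) = \<beta> y"
    if "x \<in> carrier R" "y \<in> carrier R" for x y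
  proof -
    have "k (x \<rhd> y) = k x \<rhd>\<^bsub>E\<^esub> k y" using k that by (auto simp: rack_hom_def)
    then show "g (x \<rhd> y) = g x \<otimes>\<^bsub>?G\<^esub> translation (\<beta> x) \<otimes>\<^bsub>?G\<^esub> inv\<^bsub>?G\<^esub> g x \<otimes>\<^bsub>?G\<^esub> g y" "\<beta> (x \<rhd> y) = \<beta> y"
      by (simp_all add: g_def \<beta>_def E_def conjugate_rack_def split_beta)
  qed
  have "\<forall>x\<in>carrier R. \<exists>\<sigma> \<phi>. affine \<sigma> \<phi> (g x)" using kE(1) by (simp add: affine_group_def)
  then obtain \<sigma> \<phi> where aff: "\<And>x. x \<in> carrier R \<Longrightarrow> affine (\<sigma> x) (\<phi> x) (g x)" by metis
  define \<tau> where "\<tau> x = inv_into (carrier R) (\<sigma> x)" for x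
  have iso: "\<sigma> x \<in> rack_iso R R" if "x \<in> carrier R" for x using aff[OF that] by (simp add: chain_affine_def)
  have \<tau>_iso: "\<tau> x \<in> rack_iso R R" if "x \<in> carrier R" for x
    unfolding \<tau>_def by (rule rack_iso_inv[OF iso[OF that] R])
  have \<sigma>R: "\<sigma> x y \<in> carrier R" and \<tau>R: "\<tau> x y \<in> carrier R"
    and \<sigma>\<tau>: "\<sigma> x (\<tau> x y) = y" and \<tau>\<sigma>: "\<tau> x (\<sigma> x y) = y" if "x \<in> carrier R" "y \<in> carrier R" for x y
    using map_iso_lists[OF iso[OF that(1)], of "[y]"] map_iso_lists[OF \<tau>_iso[OF that(1)], of "[y]"]
      map_inv_iso[OF iso[OF that(1)], of "[y]"] that(2) by (auto simp: \<tau>_def)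
  have \<sigma>act: "\<sigma> x (y \<rhd> z) = \<sigma> x y \<rhd> \<sigma> x z" if "x \<in> carrier R" "y \<in> carrier R" "z \<in> carrier R" for x y z
    using iso[OF that(1)] that by (auto simp: rack_iso_def rack_hom_def)
  have data: "affine (\<sigma> x \<circ> (\<lambda>z. \<beta> x \<rhd> z) \<circ> \<tau> x \<circ> \<sigma> y)
    (\<lambda>w. \<phi> y w + (- \<phi> x (map (\<tau> x) (map (\<sigma> y) w))
      + (frag_of (\<beta> x # map (\<tau> x) (map (\<sigma> y) w))
      + \<phi> x (map (\<lambda>z. \<beta> x \<rhd> z) (map (\<tau> x) (map (\<sigma> y) w))))))
    (g (x \<rhd> y))" if "x \<in> carrier R" "y \<in> carrier R" for x y
    unfolding kact[OF that] \<tau>_def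
    by (intro affine_group_mult affine_group_inv affine_translation aff that \<beta>R)
  \<comment> \<open>g (x \<rhd> y) has the data chosen for it and those of the product in \<open>data\<close>\<close>
  have data1: "\<sigma> (x \<rhd> y) z = \<sigma> x (\<beta> x \<rhd> \<tau> x (\<sigma> y z))" if "x \<in> carrier R" "y \<in> carrier R" "z \<in> carrier R" for x y z
      using affine_unique(1)[OF aff data[OF that(1,2)] that(3)] that rack_act_closed[OF R] by simp
  have data2: "\<phi> (x \<rhd> y) w = \<phi> y w + (- \<phi> x (map (\<tau> x) (map (\<sigma> y) w))
      + (frag_of (\<beta> x # map (\<tau> x) (map (\<sigma> y) w))
      + \<phi> x (map (\<lambda>z. \<beta> x \<rhd> z) (map (\<tau> x) (map (\<sigma> y) w)))))"
      if "x \<in> carrier R" "y \<in> carrier R" "w \<in> lists (carrier R)" for x y w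
      using affine_unique(2)[OF aff data[OF that(1,2)] that(3)] that rack_act_closed[OF R] by simp
  \<comment> \<open>an endomorphism that fixes the generators is the identity\<close>
  have \<sigma>\<beta>: "\<sigma> x (\<beta> x) = x" if "x \<in> carrier R" for x
  proof (rule free_on_hom_eqI[OF free R _ _ _ that, of "\<lambda>x. \<sigma> x (\<beta> x)" "\<lambda>x. x"])
    show "(\<lambda>x. \<sigma> x (\<beta> x)) \<in> rack_hom R R"
      unfolding rack_hom_def
    proof (intro CollectI conjI ballI funcsetI)
      fix x y assume xy: "x \<in> carrier R" "y \<in> carrier R"
      show "\<sigma> (x \<rhd> y) (\<beta> (x \<rhd> y)) = \<sigma> x (\<beta> x) \<rhd> \<sigma> y (\<beta> y)"
        unfolding kact(2)[OF xy] data1[OF xy \<beta>R[OF xy(2)]]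
        using xy by (simp add: \<sigma>act \<beta>R \<tau>R \<sigma>R \<sigma>\<tau>)
    qed (simp add: \<sigma>R \<beta>R)
    show "(\<lambda>x. x) \<in> rack_hom R R" by (auto simp: rack_hom_def)
    fix b assume b: "b \<in> B"
    have "\<one>\<^bsub>?G\<^esub> = \<one>\<^bsub>BijGroup points\<^esub>" by (simp add: affine_group_def)
    then show "\<sigma> b (\<beta> b) = b"
      using affine_unique(1)[OF aff, of b _ _ "\<beta> b"] affine_one kB[OF b] b B by (force simp: g_def \<beta>_def)
  qed
  define s where "s w = (case w of [] \<Rightarrow> 0 | x # ws \<Rightarrow> \<phi> x (map (\<tau> x) w))" for w
  have s_Cons: "s (x # w) = \<phi> x (\<beta> x # map (\<tau> x) w)" if "x \<in> carrier R" for x w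
    using \<tau>\<sigma>[OF that \<beta>R[OF that]] \<sigma>\<beta>[OF that] by (simp add: s_def)
  have keys: "Poly_Mapping.keys (s w) \<subseteq> tuples (carrier R) (Suc (length w))" if w: "w \<in> lists (carrier R)" for w
  proof (cases w)
    case (Cons x ws)
    then have x: "x \<in> carrier R" using w by simp
    have "map (\<tau> x) w \<in> lists (carrier R)" by (rule map_iso_lists[OF \<tau>_iso[OF x] w])
    then have "Poly_Mapping.keys (\<phi> x (map (\<tau> x) w)) \<subseteq> tuples (carrier R) (Suc (length (map (\<tau> x) w)))"
      using aff[OF x] unfolding chain_affine_def by blast
    then show ?thesis by (simp add: s_def Cons)
  qed (simp add: s_def)
  have "rack_boundary R (s (x # w)) + frag_extend s (rack_boundary R (frag_of (x # w))) = frag_of (x # w)"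
    if xw: "x \<in> carrier R" "w \<in> lists (carrier R)" and ne: "w \<noteq> []" for x w
  proof -
    note x = xw(1) and w = xw(2)
    define v where "v = map (\<tau> x) w"
    have v: "v \<in> lists (carrier R)" unfolding v_def by (rule map_iso_lists[OF \<tau>_iso[OF x] w])
    have \<sigma>v: "map (\<sigma> x) v = w" unfolding v_def \<tau>_def by (rule map_inv_iso(1)[OF iso[OF x] w])
    obtain y ws where w': "w = y # ws" using ne by (cases w) auto
    have y: "y \<in> carrier R" using w w' by simp
    \<comment> \<open>s changes under the action of x by the homotopy attached to the translation by x\<close>
    have act: "s (map (\<lambda>z. x \<rhd> z) w) = s w - \<phi> x v + (frag_of (\<beta> x # v) + \<phi> x (map (\<lambda>z. \<beta> x \<rhd> z) v))"
    proof -
      define u where "u = map (\<tau> y) w"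
      have u: "u \<in> lists (carrier R)" unfolding u_def by (rule map_iso_lists[OF \<tau>_iso[OF y] w])
      have \<sigma>u: "map (\<sigma> y) u = w" unfolding u_def \<tau>_def by (rule map_inv_iso(1)[OF iso[OF y] w])
      have xy: "x \<rhd> y \<in> carrier R" by (rule rack_act_closed[OF R x y])
      have "\<sigma> (x \<rhd> y) z = x \<rhd> \<sigma> y z" if "z \<in> carrier R" for z
        unfolding data1[OF x y that] using x y that by (simp add: \<sigma>act \<beta>R \<tau>R \<sigma>R \<sigma>\<tau> \<sigma>\<beta>)
      then have "map (\<sigma> (x \<rhd> y)) u = map (\<lambda>z. x \<rhd> z) (map (\<sigma> y) u)" using u by (simp add: lists_eq_set subset_iff)
      also have "\<dots> = map (\<lambda>z. x \<rhd> z) w" unfolding \<sigma>u ..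
      finally have "map (\<tau> (x \<rhd> y)) (map (\<lambda>z. x \<rhd> z) w) = u"
        using map_inv_iso(2)[OF iso[OF xy] u] by (simp add: \<tau>_def)
      then have "s (map (\<lambda>z. x \<rhd> z) w) = \<phi> (x \<rhd> y) u" by (simp add: s_def w')
      also have "\<dots> = \<phi> y u + (- \<phi> x v + (frag_of (\<beta> x # v) + \<phi> x (map (\<lambda>z. \<beta> x \<rhd> z) v)))"
        unfolding data2[OF x y u] \<sigma>u v_def[symmetric] ..
      also have "\<phi> y u = s w" by (simp add: s_def w' u_def)
      finally show ?thesis by simp
    qed
    have "frag_extend s (push ((#) x) (rack_boundary R (frag_of w)))
        = frag_extend (\<phi> x) (push ((#) (\<beta> x)) (rack_boundary R (frag_of v)))"
    proof -
      have "rack_boundary R (frag_of v) = push (map (\<tau> x)) (rack_boundary R (frag_of w))"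
        unfolding v_def by (rule rack_boundary_natural_tuple) (use \<tau>_iso[OF x] w in \<open>auto simp: rack_iso_def\<close>)
      then show ?thesis by (simp add: push_push frag_extend_push comp_def s_Cons[OF x])
    qed
    then have "frag_extend s (rack_boundary R (frag_of (x # w))) =
        frag_of (\<beta> x # v) + frag_extend (\<phi> x) (rack_boundary R (frag_of (\<beta> x # v)))"
      by (simp add: rack_boundary_Cons frag_extend_diff act)
    moreover have "rack_boundary R (\<phi> x (\<beta> x # v)) + frag_extend (\<phi> x) (rack_boundary R (frag_of (\<beta> x # v)))
        = frag_of (map (\<sigma> x) (\<beta> x # v)) - frag_of (\<beta> x # v)"
      using aff[OF x] v \<beta>R[OF x] unfolding chain_affine_def by (metis Cons_in_lists_iff)
    moreover have "map (\<sigma> x) (\<beta> x # v) = x # w" using \<sigma>v \<sigma>\<beta>[OF x] by simp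
    moreover have "s (x # w) = \<phi> x (\<beta> x # v)" by (simp add: s_Cons[OF x] v_def)
    ultimately show ?thesis by (simp add: algebra_simps)
  qed
  then have "rack_boundary R (s w) + frag_extend s (rack_boundary R (frag_of w)) = frag_of w"
    if "w \<in> lists (carrier R)" "2 \<le> length w" for w
    using that by (cases w) force+
  with keys show ?thesis using that by blast
qed

end

text \<open>A contraction passes to retracts, since the boundary commutes with both maps of the retraction.\<close>

lemma retract_contraction:
  assumes F: "rack F" and R: "rack R" and i: "i \<in> rack_hom F R" and r: "r \<in> rack_hom R F"
    and ri: "\<And>x. x \<in> carrier F \<Longrightarrow> r (i x) = x" and free: "free_on R B"
  obtains s where
    "\<And>w. w \<in> lists (carrier F) \<Longrightarrow> Poly_Mapping.keys (s w) \<subseteq> tuples (carrier F) (Suc (length w))"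
    "\<And>w. w \<in> lists (carrier F) \<Longrightarrow> 2 \<le> length w \<Longrightarrow>
       rack_boundary F (s w) + frag_extend s (rack_boundary F (frag_of w)) = frag_of w"
proof -
  obtain s where
    keys: "\<And>w. w \<in> lists (carrier R) \<Longrightarrow> Poly_Mapping.keys (s w) \<subseteq> tuples (carrier R) (Suc (length w))"
    and s: "\<And>w. w \<in> lists (carrier R) \<Longrightarrow> 2 \<le> length w \<Longrightarrow>
       rack_boundary R (s w) + frag_extend s (rack_boundary R (frag_of w)) = frag_of w"
    by (rule free_rack_contraction[OF R free]) (rule that)
  show ?thesis
  proof (rule that[of "\<lambda>w. push (map r) (s (map i w))"])
    fix w assume w: "w \<in> lists (carrier F)"
    then have iw: "map i w \<in> lists (carrier R)" using i by (auto simp: rack_hom_def Pi_iff)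
    note k = keys[OF iw]
    have "map r \<in> tuples (carrier R) (Suc (length w)) \<rightarrow> tuples (carrier F) (Suc (length w))"
      using r by (intro map_tuples) (auto simp: rack_hom_def)
    then show "Poly_Mapping.keys (push (map r) (s (map i w))) \<subseteq> tuples (carrier F) (Suc (length w))"
      using k by (intro keys_push_subset[of _ "tuples (carrier R) (Suc (length w))"]) auto
    assume "2 \<le> length w"
    then have *: "rack_boundary R (s (map i w)) + frag_extend s (rack_boundary R (frag_of (map i w))) = frag_of (map i w)"
      using s[OF iw] by simp
    have "rack_boundary F (push (map r) (s (map i w))) = push (map r) (rack_boundary R (s (map i w)))"
      by (rule rack_boundary_natural[OF r]) (use k in blast)
    moreover have "frag_extend (\<lambda>w. push (map r) (s (map i w))) (rack_boundary F (frag_of w)) =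
        push (map r) (frag_extend s (push (map i) (rack_boundary F (frag_of w))))"
      by (simp add: push_frag_extend frag_extend_push comp_def)
    moreover have "push (map i) (rack_boundary F (frag_of w)) = rack_boundary R (frag_of (map i w))"
      using w by (intro rack_boundary_natural_tuple[OF i, symmetric]) auto
    moreover have "map r (map i w) = w" using w ri by (auto intro!: map_idI simp: lists_eq_set subset_iff)
    ultimately show "rack_boundary F (push (map r) (s (map i w))) +
        frag_extend (\<lambda>w. push (map r) (s (map i w))) (rack_boundary F (frag_of w)) = frag_of w"
      using arg_cong[OF *, of "push (map r)"] by (simp add: push_add del: map_map)
  qed
qed

section \<open>Simplicial abelian groups\<close>

definition free_abelian :: "('s, 'z) simplicial_set_scheme \<Rightarrow> ('s \<Rightarrow>\<^sub>0 int) simplicial_set" where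
  "free_abelian S = \<lparr>cells = (\<lambda>q. {c. Poly_Mapping.keys c \<subseteq> cells S q}),
     face = (\<lambda>q i. push (face S q i)), degen = (\<lambda>q i. push (degen S q i))\<rparr>"

lemma free_abelian_simplicial_set:
  assumes "simplicial_set S"
  shows "simplicial_set (free_abelian S)"
proof -
  interpret S: simplicial_set S by fact
  note simps = free_abelian_def push_push
  show ?thesis
  proof (rule simplicial_set.intro)
    show "face (free_abelian S) (Suc q) i x \<in> cells (free_abelian S) q"
      if "x \<in> cells (free_abelian S) (Suc q)" "i \<le> Suc q" for x q i
      using that by (simp add: free_abelian_def keys_push_subset[of x "cells S (Suc q)"] S.face_closed)
    show "degen (free_abelian S) q i x \<in> cells (free_abelian S) (Suc q)"
      if "x \<in> cells (free_abelian S) q" "i \<le> q" for x q i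
      using that by (simp add: free_abelian_def keys_push_subset[of x "cells S q"] S.degen_closed)
    show "face (free_abelian S) (Suc q) j (degen (free_abelian S) q j x) = x"
      if "x \<in> cells (free_abelian S) q" "j \<le> q" for x q j
      using that by (auto simp: simps subset_iff S.face_degen_eq intro!: push_ident)
    show "face (free_abelian S) (Suc q) (Suc j) (degen (free_abelian S) q j x) = x"
      if "x \<in> cells (free_abelian S) q" "j \<le> q" for x q j
      using that by (auto simp: simps subset_iff S.face_degen_Suc intro!: push_ident)
  qed (auto simp: simps subset_iff S.face_face S.degen_degen S.face_degen_less S.face_degen_greater
      intro!: push_cong)
qed

text \<open>Moore's argument for simplicial abelian groups.  A horn is filled one face at a time: the error u
  of w at a face is removed by subtracting a degeneracy of u.  This leaves the faces alone that are
  already right, because the corresponding faces of u vanish.  The faces below the missing one are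
  treated in increasing order and those above it in decreasing order.\<close>

theorem free_abelian_kan:
  assumes "simplicial_set S"
  shows "kan_complex (free_abelian S)"
  unfolding kan_complex_def
proof (intro conjI allI impI)
  show simp: "simplicial_set (free_abelian S)" by (rule free_abelian_simplicial_set[OF assms])
  interpret K: simplicial_set "free_abelian S" by (fact simp)
  let ?K = "free_abelian S"
  have cells_diff: "a - b \<in> cells ?K q" if "a \<in> cells ?K q" "b \<in> cells ?K q" for a b q
    using that by (simp add: free_abelian_def keys_diff_subset)
  have face_diff: "face ?K q i (a - b) = face ?K q i a - face ?K q i b" for q i a b
    by (simp add: free_abelian_def push_diff)
  have degen_0: "degen ?K q i 0 = 0" for q i
    by (simp add: free_abelian_def)
  fix n k and x :: "nat \<Rightarrow> 'a \<Rightarrow>\<^sub>0 int"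
  assume asm: "k \<le> Suc n \<and> (\<forall>i\<le>Suc n. i \<noteq> k \<longrightarrow> x i \<in> cells ?K n) \<and>
        (\<forall>i j. i < j \<and> j \<le> Suc n \<and> i \<noteq> k \<and> j \<noteq> k \<and> n > 0 \<longrightarrow>
           face ?K n i (x j) = face ?K n (j - 1) (x i))"
  then have k: "k \<le> Suc n" and x: "\<And>i. i \<le> Suc n \<Longrightarrow> i \<noteq> k \<Longrightarrow> x i \<in> cells ?K n"
    and compat: "\<And>i j. \<lbrakk>i < j; j \<le> Suc n; i \<noteq> k; j \<noteq> k; n > 0\<rbrakk> \<Longrightarrow> face ?K n i (x j) = face ?K n (j - 1) (x i)"
    by auto
  \<comment> \<open>the error of w at a face r, as seen from the faces where w is already right\<close>
  have err_less: "face ?K n i (face ?K (Suc n) r w - x r) = 0"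
    if w: "w \<in> cells ?K (Suc n)" and i: "i < r" "r \<le> Suc n" "i \<noteq> k" "r \<noteq> k" "n > 0"
      and wi: "face ?K (Suc n) i w = x i" for w i r
  proof -
    obtain m where m: "n = Suc m" using i by (cases n) auto
    have "face ?K n i (face ?K (Suc n) r w) = face ?K n (r - 1) (face ?K (Suc n) i w)"
      using K.face_face[of w m i r] w i m by simp
    then show ?thesis using compat[of i r] i wi by (simp add: face_diff)
  qed
  have err_greater: "face ?K n (i - 1) (face ?K (Suc n) r w - x r) = 0"
    if w: "w \<in> cells ?K (Suc n)" and i: "r < i" "i \<le> Suc n" "i \<noteq> k" "r \<noteq> k" "n > 0"
      and wi: "face ?K (Suc n) i w = x i" for w i r
  proof -
    obtain m where m: "n = Suc m" using i by (cases n) auto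
    have "face ?K n r (face ?K (Suc n) i w) = face ?K n (i - 1) (face ?K (Suc n) r w)"
      using K.face_face[of w m r i] w i m by simp
    then show ?thesis using compat[of r i] i wi by (simp add: face_diff)
  qed
  have low: "\<exists>w\<in>cells ?K (Suc n). \<forall>i<r. face ?K (Suc n) i w = x i" if "r \<le> k" for r
    using that
  proof (induction r)
    case 0
    have "0 \<in> cells ?K (Suc n)" by (simp add: free_abelian_def)
    then show ?case by auto
  next
    case (Suc r)
    then obtain w where w: "w \<in> cells ?K (Suc n)" and wi: "\<And>i. i < r \<Longrightarrow> face ?K (Suc n) i w = x i" by auto
    define u where "u = face ?K (Suc n) r w - x r"
    have r: "r \<le> n" "r < k" using Suc.prems k by auto
    have u: "u \<in> cells ?K n" unfolding u_def using K.face_closed[OF w, of r] x[of r] r by (intro cells_diff) auto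
    define w' where "w' = w - degen ?K n r u"
    have "w' \<in> cells ?K (Suc n)" unfolding w'_def by (intro cells_diff w K.degen_closed u r)
    moreover have "face ?K (Suc n) i w' = x i" if "i < Suc r" for i
    proof (cases "i = r")
      case True
      then show ?thesis using K.face_degen_eq[OF u r(1)] by (simp add: w'_def face_diff) (simp add: u_def)
    next
      case False
      then have i: "i < r" using that by simp
      then have "face ?K n i u = 0" unfolding u_def using r k wi by (intro err_less w) auto
      then have "face ?K (Suc n) i (degen ?K n r u) = 0"
        using K.face_degen_less[OF u i r(1)] by (simp add: degen_0)
      then show ?thesis using wi[OF i] by (simp add: w'_def face_diff)
    qed
    ultimately show ?case by blast
  qed
  \<comment> \<open>r counts the faces above the missing one that have been treated, beginning with the last\<close>
  have high: "\<exists>w\<in>cells ?K (Suc n). \<forall>i\<le>Suc n. i < k \<or> k + (Suc n - k - r) < i \<longrightarrow> face ?K (Suc n) i w = x i"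
    if "r \<le> Suc n - k" for r
    using that
  proof (induction r)
    case 0
    then show ?case using low[of k] k by auto
  next
    case (Suc r)
    define l where "l = k + (Suc n - k - r)"
    obtain w where w: "w \<in> cells ?K (Suc n)"
      and wi: "\<And>i. i \<le> Suc n \<Longrightarrow> i < k \<or> l < i \<Longrightarrow> face ?K (Suc n) i w = x i"
      using Suc unfolding l_def by auto
    have l: "k < l" "l \<le> Suc n" "k + (Suc n - k - Suc r) = l - 1" using Suc.prems by (auto simp: l_def)
    define u where "u = face ?K (Suc n) l w - x l"
    have u: "u \<in> cells ?K n" unfolding u_def using K.face_closed[OF w, of l] x[of l] l by (intro cells_diff) auto
    have l1: "l - 1 \<le> n" using l by simp
    define w' where "w' = w - degen ?K n (l - 1) u"
    have "w' \<in> cells ?K (Suc n)" unfolding w'_def by (intro cells_diff w K.degen_closed u l1)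
    moreover have "face ?K (Suc n) i w' = x i" if i: "i \<le> Suc n" "i < k \<or> l - 1 < i" for i
    proof -
      consider "i = l" | "i < k" | "l < i" using i l by linarith
      then show ?thesis
      proof cases
        case 1
        then show ?thesis using K.face_degen_Suc[OF u l1] l by (simp add: w'_def face_diff) (simp add: u_def)
      next
        case 2
        then have "face ?K n i u = 0" unfolding u_def using l wi by (intro err_less w) auto
        then have "face ?K (Suc n) i (degen ?K n (l - 1) u) = 0"
          using K.face_degen_less[OF u _ l1, of i] 2 l by (simp add: degen_0)
        then show ?thesis using wi[of i] 2 i by (simp add: w'_def face_diff)
      next
        case 3
        then have "face ?K n (i - 1) u = 0" unfolding u_def using l i wi by (intro err_greater w) auto
        then have "face ?K (Suc n) i (degen ?K n (l - 1) u) = 0"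
          using K.face_degen_greater[OF u _ i(1), of "l - 1"] 3 l by (simp add: degen_0)
        then show ?thesis using wi[of i] 3 i by (simp add: w'_def face_diff)
      qed
    qed
    ultimately show ?case unfolding l(3) by blast
  qed
  from high[of "Suc n - k"] k
  show "\<exists>y\<in>cells ?K (Suc n). \<forall>i\<le>Suc n. i \<noteq> k \<longrightarrow> face ?K (Suc n) i y = x i"
    by (simp add: nat_neq_iff)
qed

section \<open>Weak equivalences\<close>

text \<open>The test complexes in the definition of a weak equivalence have simplices in one particular type.
  Along an injection into this type, every Kan complex of another type can serve as a test complex.\<close>

definition transport_simplicial_set :: "('s \<Rightarrow> 't) \<Rightarrow> 's simplicial_set \<Rightarrow> 't simplicial_set" where
  "transport_simplicial_set e K = \<lparr>cells = (\<lambda>q. e ` cells K q),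
     face = (\<lambda>q i. e \<circ> face K q i \<circ> inv_into UNIV e), degen = (\<lambda>q i. e \<circ> degen K q i \<circ> inv_into UNIV e)\<rparr>"

lemma transport_kan:
  assumes e: "inj e" and K: "kan_complex K"
  shows "kan_complex (transport_simplicial_set e K)"
proof -
  let ?T = "transport_simplicial_set e K"
  interpret K: simplicial_set K using K by (simp add: kan_complex_def)
  have simp: "simplicial_set ?T"
    by (rule simplicial_set.intro)
      (use e in \<open>auto simp: transport_simplicial_set_def K.face_closed K.degen_closed K.face_face K.degen_degen
        K.face_degen_less K.face_degen_eq K.face_degen_Suc K.face_degen_greater\<close>)
  have fill: "\<exists>y\<in>cells ?T (Suc n). \<forall>i\<le>Suc n. i \<noteq> k \<longrightarrow> face ?T (Suc n) i y = x i"
    if k: "k \<le> Suc n" and x: "\<And>i. i \<le> Suc n \<Longrightarrow> i \<noteq> k \<Longrightarrow> x i \<in> cells ?T n"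
      and compat: "\<And>i j. i < j \<Longrightarrow> j \<le> Suc n \<Longrightarrow> i \<noteq> k \<Longrightarrow> j \<noteq> k \<Longrightarrow> n > 0 \<Longrightarrow>
        face ?T n i (x j) = face ?T n (j - 1) (x i)" for n k x
  proof -
    have x': "inv_into UNIV e (x i) \<in> cells K n" "e (inv_into UNIV e (x i)) = x i" if "i \<le> Suc n" "i \<noteq> k" for i
      using x[OF that] e by (auto simp: transport_simplicial_set_def)
    have "\<exists>y\<in>cells K (Suc n). \<forall>i\<le>Suc n. i \<noteq> k \<longrightarrow> face K (Suc n) i y = inv_into UNIV e (x i)"
    proof (rule K[unfolded kan_complex_def, THEN conjunct2, rule_format], intro conjI allI impI)
      show "face K n i (inv_into UNIV e (x j)) = face K n (j - 1) (inv_into UNIV e (x i))"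
        if "i < j \<and> j \<le> Suc n \<and> i \<noteq> k \<and> j \<noteq> k \<and> 0 < n" for i j
        using compat[of i j] that injD[OF e] by (auto simp: transport_simplicial_set_def)
    qed (use k x' in auto)
    then obtain y where y: "y \<in> cells K (Suc n)" "\<And>i. i \<le> Suc n \<Longrightarrow> i \<noteq> k \<Longrightarrow> face K (Suc n) i y = inv_into UNIV e (x i)"
      by blast
    then show ?thesis
      using x' e by (intro bexI[of _ "e y"]) (auto simp: transport_simplicial_set_def)
  qed
  show ?thesis
    unfolding kan_complex_def
  proof (intro conjI allI impI)
    fix n k and x :: "nat \<Rightarrow> 'b"
    assume asm: "k \<le> Suc n \<and> (\<forall>i\<le>Suc n. i \<noteq> k \<longrightarrow> x i \<in> cells ?T n) \<and>
        (\<forall>i j. i < j \<and> j \<le> Suc n \<and> i \<noteq> k \<and> j \<noteq> k \<and> n > 0 \<longrightarrow>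
           face ?T n i (x j) = face ?T n (j - 1) (x i))"
    show "\<exists>y\<in>cells ?T (Suc n). \<forall>i\<le>Suc n. i \<noteq> k \<longrightarrow> face ?T (Suc n) i y = x i"
      by (rule fill) (use asm in simp_all)
  qed (fact simp)
qed

lemma simplicial_maps_transport:
  assumes "inj e"
  shows "g \<in> simplicial_maps S K \<Longrightarrow> (\<lambda>q. e \<circ> g q) \<in> simplicial_maps S (transport_simplicial_set e K)"
    and "h \<in> simplicial_maps S (transport_simplicial_set e K) \<Longrightarrow> (\<lambda>q. inv_into UNIV e \<circ> h q) \<in> simplicial_maps S K"
proof -
  show "g \<in> simplicial_maps S K \<Longrightarrow> (\<lambda>q. e \<circ> g q) \<in> simplicial_maps S (transport_simplicial_set e K)"
    using assms by (auto simp: simplicial_maps_def transport_simplicial_set_def Pi_iff)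
  assume h: "h \<in> simplicial_maps S (transport_simplicial_set e K)"
  have "inv_into UNIV e (h q x) \<in> cells K q" if "x \<in> cells S q" for q x
    using h that assms by (force simp: simplicial_maps_def transport_simplicial_set_def Pi_iff)
  then show "(\<lambda>q. inv_into UNIV e \<circ> h q) \<in> simplicial_maps S K"
    using h assms by (auto simp: simplicial_maps_def transport_simplicial_set_def)
qed

lemma simplicially_homotopic_transport:
  assumes e: "inj e"
  shows "simplicially_homotopic S (transport_simplicial_set e K) (\<lambda>q. e \<circ> f q) (\<lambda>q. e \<circ> g q) \<longleftrightarrow>
    simplicially_homotopic S K f g"
proof
  assume "simplicially_homotopic S (transport_simplicial_set e K) (\<lambda>q. e \<circ> f q) (\<lambda>q. e \<circ> g q)"
  then obtain H where "H \<in> simplicial_maps (simplicial_product S (std_simplex 1)) (transport_simplicial_set e K)"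
    "\<forall>q. \<forall>x\<in>cells S q. H q (x, replicate (Suc q) 0) = e (f q x) \<and> H q (x, replicate (Suc q) 1) = e (g q x)"
    by (auto simp: simplicially_homotopic_def)
  then show "simplicially_homotopic S K f g"
    unfolding simplicially_homotopic_def
    by (intro bexI[OF _ simplicial_maps_transport(2)[OF e]]) (auto simp: e)
next
  assume "simplicially_homotopic S K f g"
  then obtain H where "H \<in> simplicial_maps (simplicial_product S (std_simplex 1)) K"
    "\<forall>q. \<forall>x\<in>cells S q. H q (x, replicate (Suc q) 0) = f q x \<and> H q (x, replicate (Suc q) 1) = g q x"
    by (auto simp: simplicially_homotopic_def)
  then show "simplicially_homotopic S (transport_simplicial_set e K) (\<lambda>q. e \<circ> f q) (\<lambda>q. e \<circ> g q)"
    unfolding simplicially_homotopic_def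
    by (intro bexI[OF _ simplicial_maps_transport(1)[OF e]]) auto
qed

lemma weak_equivalence_lift:
  fixes S :: "('s, 'y) simplicial_set_scheme" and T :: "('t, 'z) simplicial_set_scheme"
    and K :: "'k simplicial_set" and e :: "'k \<Rightarrow> ('s, 't) large"
  assumes w: "weak_equivalence S T f" and K: "kan_complex K" and e: "inj e"
  shows "g \<in> simplicial_maps S K \<Longrightarrow> \<exists>h \<in> simplicial_maps T K. simplicially_homotopic S K (\<lambda>q. h q \<circ> f q) g"
    and "\<lbrakk>h \<in> simplicial_maps T K; h' \<in> simplicial_maps T K;
      simplicially_homotopic S K (\<lambda>q. h q \<circ> f q) (\<lambda>q. h' q \<circ> f q)\<rbrakk> \<Longrightarrow> simplicially_homotopic T K h h'"
proof -
  let ?K = "transport_simplicial_set e K"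
  have surj: "\<forall>g \<in> simplicial_maps S ?K. \<exists>h \<in> simplicial_maps T ?K. simplicially_homotopic S ?K (\<lambda>q. h q \<circ> f q) g"
    and inj: "\<forall>h \<in> simplicial_maps T ?K. \<forall>h' \<in> simplicial_maps T ?K.
      simplicially_homotopic S ?K (\<lambda>q. h q \<circ> f q) (\<lambda>q. h' q \<circ> f q) \<longrightarrow> simplicially_homotopic T ?K h h'"
    using w transport_kan[OF e K] unfolding weak_equivalence_def by blast+
  have f: "f q x \<in> cells T q" if "x \<in> cells S q" for q x
    using w that by (auto simp: weak_equivalence_def simplicial_maps_def)
  show "\<exists>h \<in> simplicial_maps T K. simplicially_homotopic S K (\<lambda>q. h q \<circ> f q) g" if g: "g \<in> simplicial_maps S K"
  proof -
    obtain h where h: "h \<in> simplicial_maps T ?K" and hom: "simplicially_homotopic S ?K (\<lambda>q. h q \<circ> f q) (\<lambda>q. e \<circ> g q)"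
      using surj simplicial_maps_transport(1)[OF e g] by blast
    have "h q y \<in> range e" if "y \<in> cells T q" for q y
      using h that by (force simp: simplicial_maps_def transport_simplicial_set_def Pi_iff)
    then have "e (inv_into UNIV e (h q y)) = h q y" if "y \<in> cells T q" for q y
      using that by (simp add: f_inv_into_f)
    then have "simplicially_homotopic S ?K (\<lambda>q. e \<circ> (inv_into UNIV e \<circ> h q \<circ> f q)) (\<lambda>q. e \<circ> g q)"
      using hom f by (simp add: simplicially_homotopic_def)
    then show ?thesis
      using simplicially_homotopic_transport[OF e] simplicial_maps_transport(2)[OF e h] by blast
  qed
  show "simplicially_homotopic T K h h'" if "h \<in> simplicial_maps T K" "h' \<in> simplicial_maps T K"
    "simplicially_homotopic S K (\<lambda>q. h q \<circ> f q) (\<lambda>q. h' q \<circ> f q)"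
    using inj[rule_format, OF simplicial_maps_transport(1)[OF e that(1)] simplicial_maps_transport(1)[OF e that(2)]]
      that(3) simplicially_homotopic_transport[OF e, of S K "\<lambda>q. h q \<circ> f q" "\<lambda>q. h' q \<circ> f q"]
      simplicially_homotopic_transport[OF e, of T K h h']
    by (simp add: comp_assoc)
qed

text \<open>A chain, as a set of lists: the graph of its coefficient function, whose values are coded in the
  summand \<open>nat\<close>.\<close>

definition graph_code :: "('a \<Rightarrow> 's + 't + nat) \<Rightarrow> ('a \<Rightarrow>\<^sub>0 int) \<Rightarrow> ('s, 't) large" where
  "graph_code i c = range (\<lambda>x. [i x, Inr (Inr (int_encode (Poly_Mapping.lookup c x)))])"

lemma inj_graph_code:
  assumes "inj i"
  shows "inj (graph_code i)"
proof (rule injI)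
  fix c d assume eq: "graph_code i c = graph_code i d"
  have "Poly_Mapping.lookup c x = Poly_Mapping.lookup d x" for x
  proof -
    have "[i x, Inr (Inr (int_encode (Poly_Mapping.lookup c x)))] \<in> graph_code i d"
      unfolding eq[symmetric] by (auto simp: graph_code_def)
    then show ?thesis using injD[OF assms] injD[OF inj_int_encode] by (auto simp: graph_code_def)
  qed
  then show "c = d" by (rule poly_mapping_eqI)
qed

section \<open>From simplicial homotopies to chain homotopies\<close>

definition simplicial_boundary :: "('s, 'z) simplicial_set_scheme \<Rightarrow> nat \<Rightarrow> ('s \<Rightarrow>\<^sub>0 int) \<Rightarrow> ('s \<Rightarrow>\<^sub>0 int)" where
  "simplicial_boundary S q =
     frag_extend (\<lambda>x. \<Sum>i\<le>Suc q. frag_cmul ((-1) ^ i) (frag_of (face S (Suc q) i x)))"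

lemma simplicial_boundary_push:
  "simplicial_boundary S q c = (\<Sum>i\<le>Suc q. frag_cmul ((-1) ^ i) (push (face S (Suc q) i) c))"
  unfolding simplicial_boundary_def frag_extend_sum_fun frag_extend_cmul_fun push_def ..

lemma simplicial_boundary_0 [simp]: "simplicial_boundary S q 0 = 0"
  and simplicial_boundary_diff: "simplicial_boundary S q (a - b) = simplicial_boundary S q a - simplicial_boundary S q b"
  and simplicial_boundary_add: "simplicial_boundary S q (a + b) = simplicial_boundary S q a + simplicial_boundary S q b"
  by (simp_all add: simplicial_boundary_def frag_extend_diff frag_extend_add del: sum.atMost_Suc)

lemma alternating_sum_const:
  "(\<Sum>i\<le>n. frag_cmul ((-1) ^ i) c) = (if even n then c else 0)"
  by (induction n) auto

lemma sum_pairs: "(\<Sum>j\<in>J. \<Sum>i\<in>I. f i j) = (\<Sum>(j, i)\<in>J \<times> I. f i j)"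
  by (simp add: sum.cartesian_product)

text \<open>The terms with \<open>i < j\<close> cancel against the others under \<open>(i, j) \<mapsto> (j - 1, i)\<close>.\<close>

lemma alternating_square_zero:
  fixes a :: "nat \<Rightarrow> nat \<Rightarrow> ('b \<Rightarrow>\<^sub>0 int)"
  assumes a: "\<And>i j. \<lbrakk>i < j; j \<le> Suc n\<rbrakk> \<Longrightarrow> a i j = a (j - 1) i"
  shows "(\<Sum>j\<le>Suc n. \<Sum>i\<le>n. frag_cmul ((-1) ^ (i + j)) (a i j)) = 0"
proof -
  let ?f = "\<lambda>(j, i). frag_cmul ((-1) ^ (i + j)) (a i j)"
  let ?P = "{(j, i). i < j \<and> j \<le> Suc n}" and ?Q = "{(j, i). j \<le> i \<and> i \<le> n}"
  have fin: "finite ?P" "finite ?Q"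
    by (rule finite_subset[of _ "{..Suc n} \<times> {..Suc n}"]; auto)+
  have split: "{..Suc n} \<times> {..n} = ?P \<union> ?Q" by auto
  have "sum ?f ?P = (\<Sum>p\<in>?Q. - ?f p)"
    by (rule sum.reindex_bij_witness[where i = "\<lambda>(j, i). (Suc i, j)" and j = "\<lambda>(j, i). (i, j - 1)"])
      (auto simp: a add.commute minus_one_power_iff even_diff_nat)
  then have "sum ?f ?P + sum ?f ?Q = 0" by (simp add: sum_negf)
  moreover have "sum ?f (?P \<union> ?Q) = sum ?f ?P + sum ?f ?Q" by (rule sum.union_disjoint[OF fin]) auto
  ultimately show ?thesis unfolding sum_pairs split by simp
qed

lemma simplicial_boundary_boundary:
  assumes "simplicial_set S" and c: "Poly_Mapping.keys c \<subseteq> cells S (Suc (Suc q))"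
  shows "simplicial_boundary S q (simplicial_boundary S (Suc q) c) = 0"
proof -
  interpret K: simplicial_set "free_abelian S" by (rule free_abelian_simplicial_set[OF assms(1)])
  let ?a = "\<lambda>i j. push (face S (Suc q) i) (push (face S (Suc (Suc q)) j) c)"
  have "simplicial_boundary S q (simplicial_boundary S (Suc q) c) =
      (\<Sum>j\<le>Suc (Suc q). \<Sum>i\<le>Suc q. frag_cmul ((-1) ^ (i + j)) (?a i j))"
    unfolding simplicial_boundary_push push_sum push_cmul frag_cmul_sum frag_cmul_cmul power_add
    by (rule sum.swap)
  also have "\<dots> = 0"
    by (rule alternating_square_zero) (use K.face_face[of c q] c in \<open>simp add: free_abelian_def\<close>)
  finally show ?thesis .
qed

text \<open>The simplex of dimension \<open>n - 1\<close> of the standard 1-simplex that has its first k vertices at 0.\<close>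

definition edge_path :: "nat \<Rightarrow> nat \<Rightarrow> nat list" where
  "edge_path n k = replicate k 0 @ replicate (n - k) 1"

lemma edge_path_cell: "k \<le> Suc q \<Longrightarrow> edge_path (Suc q) k \<in> cells (std_simplex 1) q"
  by (auto simp: edge_path_def std_simplex_def sorted_append)

lemma face_edge_path:
  assumes "i \<le> n" "k \<le> Suc n"
  shows "face (std_simplex 1) q i (edge_path (Suc n) k) = edge_path n (if i < k then k - 1 else k)"
proof (cases "i < k")
  case True
  then have "replicate i 0 @ replicate (k - Suc i) 0 = replicate (k - 1) (0 :: nat)"
    unfolding replicate_add[symmetric] by simp
  then show ?thesis using True assms by (simp add: std_simplex_def edge_path_def take_Cons' flip: append_assoc)
next
  case False
  then have "replicate (i - k) 1 @ replicate (Suc n - k - (Suc i - k)) 1 = replicate (n - k) (1 :: nat)"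
    unfolding replicate_add[symmetric] using assms by simp
  then show ?thesis using False assms by (simp add: std_simplex_def edge_path_def)
qed

text \<open>The signed count of the faces of a prism.  Here \<open>a i j\<close> is the i-th face of the j-th simplex of
  the prism and \<open>h i j\<close> the j-th simplex of the prism over the i-th face.  The faces below and above
  the diagonals are of the second kind; those on the two diagonals are the walls \<open>e j\<close>,
  which occur twice with opposite signs, except for the first and the last one.\<close>

lemma prism_sum:
  fixes a h :: "nat \<Rightarrow> nat \<Rightarrow> ('b \<Rightarrow>\<^sub>0 int)" and e :: "nat \<Rightarrow> ('b \<Rightarrow>\<^sub>0 int)"
  assumes less: "\<And>i j. \<lbrakk>i < j; j \<le> Suc m\<rbrakk> \<Longrightarrow> a i j = h i (j - 1)"
    and eq: "\<And>j. j \<le> Suc m \<Longrightarrow> a j j = e j" and Suc: "\<And>j. j \<le> Suc m \<Longrightarrow> a (Suc j) j = e (Suc j)"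
    and greater: "\<And>i j. \<lbrakk>Suc j < i; i \<le> Suc (Suc m)\<rbrakk> \<Longrightarrow> a i j = h (i - 1) j"
  shows "(\<Sum>j\<le>Suc m. \<Sum>i\<le>Suc (Suc m). frag_cmul ((-1) ^ (i + j)) (a i j)) +
    (\<Sum>j\<le>m. \<Sum>i\<le>Suc m. frag_cmul ((-1) ^ (i + j)) (h i j)) = e 0 - e (Suc (Suc m))"
proof -
  let ?f = "\<lambda>(j, i). frag_cmul ((-1) ^ (i + j)) (a i j)"
  let ?g = "\<lambda>(j, i). frag_cmul ((-1) ^ (i + j)) (h i j)"
  define L where "L = {(j, i). i < j \<and> j \<le> Suc m}"
  define U where "U = {(j, i). Suc j < i \<and> i \<le> Suc (Suc m)}"
  define D where "D = (\<lambda>j. (j, j)) ` {..Suc m}"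
  define E where "E = (\<lambda>j. (j, Suc j)) ` {..Suc m}"
  define L' where "L' = {(j, i). i \<le> j \<and> j \<le> m}"
  define U' where "U' = {(j, i). j < i \<and> i \<le> Suc m}"
  note defs = L_def U_def D_def E_def L'_def U'_def
  have "L \<subseteq> {..Suc (Suc m)} \<times> {..Suc (Suc m)}" "U \<subseteq> {..Suc (Suc m)} \<times> {..Suc (Suc m)}"
    "L' \<subseteq> {..Suc (Suc m)} \<times> {..Suc (Suc m)}" "U' \<subseteq> {..Suc (Suc m)} \<times> {..Suc (Suc m)}"
    by (auto simp: defs)
  then have fin: "finite L" "finite U" "finite L'" "finite U'" "finite D" "finite E"
    by (auto intro: finite_subset simp: D_def E_def)
  have square: "{..Suc m} \<times> {..Suc (Suc m)} = L \<union> (U \<union> (D \<union> E))" "{..m} \<times> {..Suc m} = L' \<union> U'"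
    by (auto simp: defs image_iff)
  have "L \<inter> (U \<union> (D \<union> E)) = {}" "U \<inter> (D \<union> E) = {}" "D \<inter> E = {}" "L' \<inter> U' = {}"
    by (auto simp: defs)
  then have "sum ?f (L \<union> (U \<union> (D \<union> E))) = sum ?f L + (sum ?f U + (sum ?f D + sum ?f E))"
    and "sum ?g (L' \<union> U') = sum ?g L' + sum ?g U'"
    using fin by (simp_all add: sum.union_disjoint del: split_beta)
  moreover have "sum ?f D + sum ?f E = e 0 - e (Suc (Suc m))"
  proof -
    have "sum ?f D = (\<Sum>j\<le>Suc m. e j)"
    proof -
      have "sum ?f D = (\<Sum>j\<le>Suc m. ?f (j, j))"
        unfolding D_def by (subst sum.reindex) (auto simp: inj_on_def comp_def simp del: sum.atMost_Suc)
      then show ?thesis by (simp add: minus_one_power_iff eq del: sum.atMost_Suc cong: sum.cong_simp)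
    qed
    moreover have "sum ?f E = (\<Sum>j\<le>Suc m. - e (Suc j))"
    proof -
      have "sum ?f E = (\<Sum>j\<le>Suc m. ?f (j, Suc j))"
        unfolding E_def by (subst sum.reindex) (auto simp: inj_on_def comp_def simp del: sum.atMost_Suc)
      then show ?thesis by (simp add: minus_one_power_iff Suc del: sum.atMost_Suc cong: sum.cong_simp)
    qed
    ultimately have "sum ?f D + sum ?f E = (\<Sum>j\<le>Suc m. e j - e (Suc j))"
      by (simp only: sum.distrib[symmetric] diff_conv_add_uminus)
    then show ?thesis by (simp only: sum_telescope)
  qed
  moreover have "sum ?f L = (\<Sum>p\<in>L'. - ?g p)"
    by (rule sum.reindex_bij_witness[where i = "\<lambda>(j, i). (Suc j, i)" and j = "\<lambda>(j, i). (j - 1, i)"])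
      (auto simp: less defs minus_one_power_iff even_diff_nat)
  moreover have "sum ?f U = (\<Sum>p\<in>U'. - ?g p)"
    by (rule sum.reindex_bij_witness[where i = "\<lambda>(j, i). (j, Suc i)" and j = "\<lambda>(j, i). (j, i - 1)"])
      (auto simp: greater defs minus_one_power_iff even_diff_nat)
  ultimately show ?thesis unfolding sum_pairs square by (simp add: sum_negf)
qed

context
  fixes S :: "('s, 'y) simplicial_set_scheme" and H :: "nat \<Rightarrow> 's \<times> nat list \<Rightarrow> ('s \<Rightarrow>\<^sub>0 int)"
  assumes S: "simplicial_set S"
    and H: "H \<in> simplicial_maps (simplicial_product S (std_simplex 1)) (free_abelian S)"
begin

interpretation S: simplicial_set S by (rule S)

text \<open>The image under H of the prism over x, cut into \<open>q + 1\<close> simplices in the usual way.\<close>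

definition prism :: "nat \<Rightarrow> 's \<Rightarrow> ('s \<Rightarrow>\<^sub>0 int)" where
  "prism q x = (\<Sum>j\<le>q. frag_cmul ((-1) ^ j) (H (Suc q) (degen S q j x, edge_path (Suc (Suc q)) (Suc j))))"

lemma keys_H: "x \<in> cells S q \<Longrightarrow> v \<in> cells (std_simplex 1) q \<Longrightarrow> Poly_Mapping.keys (H q (x, v)) \<subseteq> cells S q"
  using H by (auto simp: simplicial_maps_def simplicial_product_def free_abelian_def Pi_iff)

lemma face_H:
  "\<lbrakk>x \<in> cells S (Suc q); v \<in> cells (std_simplex 1) (Suc q); i \<le> Suc q\<rbrakk> \<Longrightarrow>
    push (face S (Suc q) i) (H (Suc q) (x, v)) = H q (face S (Suc q) i x, face (std_simplex 1) (Suc q) i v)"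
  using H by (auto simp: simplicial_maps_def simplicial_product_def free_abelian_def)

lemma keys_prism: "x \<in> cells S q \<Longrightarrow> Poly_Mapping.keys (prism q x) \<subseteq> cells S (Suc q)"
  unfolding prism_def
  by (intro keys_sum_subset keys_cmul_subset keys_H S.degen_closed edge_path_cell) auto

lemma boundary_prism:
  assumes x: "x \<in> cells S q"
  shows "simplicial_boundary S q (prism q x) = (\<Sum>j\<le>q. \<Sum>i\<le>Suc q. frag_cmul ((-1) ^ (i + j))
    (H q (face S (Suc q) i (degen S q j x), edge_path (Suc q) (if i \<le> j then j else Suc j))))"
proof -
  have "push (face S (Suc q) i) (H (Suc q) (degen S q j x, edge_path (Suc (Suc q)) (Suc j))) =
      H q (face S (Suc q) i (degen S q j x), edge_path (Suc q) (if i \<le> j then j else Suc j))"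
    if "i \<le> Suc q" "j \<le> q" for i j
  proof -
    have "push (face S (Suc q) i) (H (Suc q) (degen S q j x, edge_path (Suc (Suc q)) (Suc j))) =
        H q (face S (Suc q) i (degen S q j x), face (std_simplex 1) (Suc q) i (edge_path (Suc (Suc q)) (Suc j)))"
      using that x by (intro face_H S.degen_closed edge_path_cell) auto
    also have "face (std_simplex 1) (Suc q) i (edge_path (Suc (Suc q)) (Suc j)) =
        edge_path (Suc q) (if i \<le> j then j else Suc j)"
      using that by (subst face_edge_path) auto
    finally show ?thesis .
  qed
  then show ?thesis
    unfolding simplicial_boundary_push prism_def push_sum push_cmul frag_cmul_sum frag_cmul_cmul
    by (subst sum.swap) (simp add: power_add)
qed

lemma prism_homotopy_0:
  assumes x: "x \<in> cells S 0"
  shows "simplicial_boundary S 0 (prism 0 x) = H 0 (x, replicate 1 1) - H 0 (x, replicate 1 0)"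
  unfolding boundary_prism[OF x] using x S.face_degen_eq[of x 0 0] S.face_degen_Suc[of x 0 0]
  by (simp add: edge_path_def)

lemma prism_homotopy_Suc:
  assumes x: "x \<in> cells S (Suc m)"
  shows "simplicial_boundary S (Suc m) (prism (Suc m) x) +
      frag_extend (prism m) (simplicial_boundary S m (frag_of x)) =
    H (Suc m) (x, replicate (Suc (Suc m)) 1) - H (Suc m) (x, replicate (Suc (Suc m)) 0)"
proof -
  let ?h = "\<lambda>i j. H (Suc m) (degen S m j (face S (Suc m) i x), edge_path (Suc (Suc m)) (Suc j))"
  let ?a = "\<lambda>i j. H (Suc m) (face S (Suc (Suc m)) i (degen S (Suc m) j x),
    edge_path (Suc (Suc m)) (if i \<le> j then j else Suc j))"
  have "frag_extend (prism m) (simplicial_boundary S m (frag_of x)) =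
      (\<Sum>j\<le>m. \<Sum>i\<le>Suc m. frag_cmul ((-1) ^ (i + j)) (?h i j))"
    unfolding simplicial_boundary_def frag_extend_of frag_extend_sum' frag_extend_cmul prism_def
      frag_cmul_sum frag_cmul_cmul
    by (subst sum.swap) (simp add: power_add)
  moreover have "(\<Sum>j\<le>Suc m. \<Sum>i\<le>Suc (Suc m). frag_cmul ((-1) ^ (i + j)) (?a i j)) +
      (\<Sum>j\<le>m. \<Sum>i\<le>Suc m. frag_cmul ((-1) ^ (i + j)) (?h i j)) =
      H (Suc m) (x, edge_path (Suc (Suc m)) 0) - H (Suc m) (x, edge_path (Suc (Suc m)) (Suc (Suc m)))"
    by (rule prism_sum[where e = "\<lambda>j. H (Suc m) (x, edge_path (Suc (Suc m)) j)"])
      (use x in \<open>auto simp: S.face_degen_eq S.face_degen_Suc S.face_degen_less S.face_degen_greater\<close>)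
  ultimately show ?thesis
    unfolding boundary_prism[OF x] by (simp add: edge_path_def)
qed

end

section \<open>Powers of a simplicial set weakly equivalent to a discrete one\<close>

definition simplicial_power :: "('s, 'z) simplicial_set_scheme \<Rightarrow> nat \<Rightarrow> 's list simplicial_set" where
  "simplicial_power S p = \<lparr>cells = (\<lambda>q. tuples (cells S q) p),
     face = (\<lambda>q i. map (face S q i)), degen = (\<lambda>q i. map (degen S q i))\<rparr>"

lemma simplicial_power_simps [simp]:
  "cells (simplicial_power S p) q = tuples (cells S q) p"
  "face (simplicial_power S p) q i = map (face S q i)"
  "degen (simplicial_power S p) q i = map (degen S q i)"
  by (simp_all add: simplicial_power_def)

lemma simplicial_power_simplicial_set:
  assumes "simplicial_set S"
  shows "simplicial_set (simplicial_power S p)"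
proof -
  interpret S: simplicial_set S by fact
  show ?thesis
    by (rule simplicial_set.intro)
      (auto simp: subset_iff S.face_closed S.degen_closed S.face_face S.degen_degen S.face_degen_less
        S.face_degen_eq S.face_degen_Suc S.face_degen_greater intro!: map_idI)
qed

text \<open>In each degree \<open>\<int>[S ^ p]\<close> is the p-fold tensor power of \<open>\<int>[S]\<close>; this is the pure tensor of a
  list of chains.\<close>

fun tensor :: "('b \<Rightarrow>\<^sub>0 int) list \<Rightarrow> ('b list \<Rightarrow>\<^sub>0 int)" where
  "tensor [] = frag_of []"
| "tensor (c # cs) = frag_extend (\<lambda>y. push ((#) y) (tensor cs)) c"

lemma tensor_push: "tensor (map (push f) cs) = push (map f) (tensor cs)"
  by (induction cs) (simp_all add: frag_extend_push push_frag_extend comp_def push_push)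

lemma tensor_frag_of: "tensor (map (\<lambda>x. frag_of (f x)) xs) = frag_of (map f xs)"
  by (induction xs) auto

lemma keys_tensor:
  "(\<And>c. c \<in> set cs \<Longrightarrow> Poly_Mapping.keys c \<subseteq> S) \<Longrightarrow> Poly_Mapping.keys (tensor cs) \<subseteq> tuples S (length cs)"
proof (induction cs)
  case (Cons c cs)
  have IH: "Poly_Mapping.keys (tensor cs) \<subseteq> tuples S (length cs)" using Cons by simp
  have "Poly_Mapping.keys (push ((#) y) (tensor cs)) \<subseteq> tuples S (length (c # cs))" if "y \<in> S" for y
    by (rule keys_push_subset[OF IH]) (use that in auto)
  then show ?case using Cons.prems by (simp add: keys_extend_subset[of c S])
qed simp

text \<open>A homotopy with values in chains can be multiplied with itself, because faces and degeneracies of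
  powers act diagonally and the tensor product is natural.\<close>

lemma tensor_homotopy:
  assumes S: "simplicial_set S"
    and H: "H \<in> simplicial_maps (simplicial_product S (std_simplex 1)) (free_abelian S)"
  shows "(\<lambda>q (xs, v). tensor (map (\<lambda>x. H q (x, v)) xs)) \<in>
    simplicial_maps (simplicial_product (simplicial_power S p) (std_simplex 1)) (free_abelian (simplicial_power S p))"
proof -
  have 1: "Poly_Mapping.keys (H q (x, v)) \<subseteq> cells S q" if "x \<in> cells S q" "v \<in> cells (std_simplex 1) q" for q x v
    using H that by (auto simp: simplicial_maps_def simplicial_product_def free_abelian_def Pi_iff)
  have 2: "H q (face S (Suc q) i x, face (std_simplex 1) (Suc q) i v) = push (face S (Suc q) i) (H (Suc q) (x, v))"
    if "x \<in> cells S (Suc q)" "v \<in> cells (std_simplex 1) (Suc q)" "i \<le> Suc q" for q x v i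
    using H that by (auto simp: simplicial_maps_def simplicial_product_def free_abelian_def)
  have 3: "H (Suc q) (degen S q i x, degen (std_simplex 1) q i v) = push (degen S q i) (H q (x, v))"
    if "x \<in> cells S q" "v \<in> cells (std_simplex 1) q" "i \<le> q" for q x v i
    using H that by (auto simp: simplicial_maps_def simplicial_product_def free_abelian_def)
  have k: "Poly_Mapping.keys (tensor (map (\<lambda>x. H q (x, v)) xs)) \<subseteq> tuples (cells S q) (length xs)"
    if "set xs \<subseteq> cells S q" "v \<in> cells (std_simplex 1) q" for q v xs
  proof -
    have "Poly_Mapping.keys c \<subseteq> cells S q" if "c \<in> set (map (\<lambda>x. H q (x, v)) xs)" for c
      using that \<open>set xs \<subseteq> cells S q\<close> 1[OF _ \<open>v \<in> cells (std_simplex 1) q\<close>] by fastforce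
    from keys_tensor[of "map (\<lambda>x. H q (x, v)) xs", OF this] show ?thesis by simp
  qed
  have f: "tensor (map (\<lambda>x. H q (x, face (std_simplex 1) (Suc q) i v)) (map (face S (Suc q) i) xs)) =
      push (map (face S (Suc q) i)) (tensor (map (\<lambda>x. H (Suc q) (x, v)) xs))"
    if "set xs \<subseteq> cells S (Suc q)" "v \<in> cells (std_simplex 1) (Suc q)" "i \<le> Suc q" for q i v xs
    unfolding tensor_push[symmetric] using that by (intro arg_cong[where f = tensor]) (auto simp: 2 simp del: One_nat_def)
  have d: "tensor (map (\<lambda>x. H (Suc q) (x, degen (std_simplex 1) q i v)) (map (degen S q i) xs)) =
      push (map (degen S q i)) (tensor (map (\<lambda>x. H q (x, v)) xs))"
    if "set xs \<subseteq> cells S q" "v \<in> cells (std_simplex 1) q" "i \<le> q" for q i v xs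
    unfolding tensor_push[symmetric] using that by (intro arg_cong[where f = tensor]) (auto simp: 3 simp del: One_nat_def)
  show ?thesis
    unfolding simplicial_maps_def
  proof (intro CollectI allI conjI ballI impI funcsetI)
    fix q y assume "y \<in> cells (simplicial_product (simplicial_power S p) (std_simplex 1)) q"
    then obtain xs v where y: "y = (xs, v)" "length xs = p" "set xs \<subseteq> cells S q" "v \<in> cells (std_simplex 1) q"
      by (auto simp: simplicial_product_def)
    show "(case y of (xs, v) \<Rightarrow> tensor (map (\<lambda>x. H q (x, v)) xs)) \<in> cells (free_abelian (simplicial_power S p)) q"
      using k[OF y(3,4)] y by (simp add: free_abelian_def)
    fix i assume "i \<le> q"
    then show "(case degen (simplicial_product (simplicial_power S p) (std_simplex 1)) q i y of
          (xs, v) \<Rightarrow> tensor (map (\<lambda>x. H (Suc q) (x, v)) xs)) =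
        degen (free_abelian (simplicial_power S p)) q i (case y of (xs, v) \<Rightarrow> tensor (map (\<lambda>x. H q (x, v)) xs))"
      using d[OF y(3,4)] y by (simp add: free_abelian_def simplicial_product_def del: map_map)
  next
    fix q y i assume "y \<in> cells (simplicial_product (simplicial_power S p) (std_simplex 1)) (Suc q)" "i \<le> Suc q"
    then obtain xs v where y: "y = (xs, v)" "length xs = p" "set xs \<subseteq> cells S (Suc q)" "v \<in> cells (std_simplex 1) (Suc q)"
      by (auto simp: simplicial_product_def)
    show "(case face (simplicial_product (simplicial_power S p) (std_simplex 1)) (Suc q) i y of
          (xs, v) \<Rightarrow> tensor (map (\<lambda>x. H q (x, v)) xs)) =
        face (free_abelian (simplicial_power S p)) (Suc q) i (case y of (xs, v) \<Rightarrow> tensor (map (\<lambda>x. H (Suc q) (x, v)) xs))"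
      using f[OF y(3,4) \<open>i \<le> Suc q\<close>] y by (simp add: free_abelian_def simplicial_product_def del: map_map)
  qed
qed

lemma constant_simplicial_rack_simps [simp]:
  "cells (constant_simplicial_rack X) q = carrier X"
  "face (constant_simplicial_rack X) q i x = x"
  "degen (constant_simplicial_rack X) q i x = x"
  "sact (constant_simplicial_rack X) q = act X"
  by (simp_all add: constant_simplicial_rack_def)

text \<open>Lifting the inclusion of F into \<open>\<int>[F]\<close> along \<open>\<epsilon>\<close> gives h and H.  For the last claim, compare the
  inclusion of X into \<open>\<int>[X]\<close> with h followed by \<open>\<epsilon>\<close>: they become homotopic on F, hence are homotopic
  on X, hence equal, as both X and \<open>\<int>[X]\<close> are constant.\<close>

theorem weak_equivalence_discrete:
  fixes F :: "('f, 'y) simplicial_set_scheme" and X :: "('x, 'z) rack_scheme"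
  assumes F: "simplicial_set F" and w: "weak_equivalence F (constant_simplicial_rack X) \<epsilon>"
  obtains h H where
    "h \<in> simplicial_maps (constant_simplicial_rack X) (free_abelian F)"
    "H \<in> simplicial_maps (simplicial_product F (std_simplex 1)) (free_abelian F)"
    "\<And>q x. x \<in> cells F q \<Longrightarrow> H q (x, replicate (Suc q) 0) = h q (\<epsilon> q x)"
    "\<And>q x. x \<in> cells F q \<Longrightarrow> H q (x, replicate (Suc q) 1) = frag_of x"
    "\<epsilon> 0 ` cells F 0 = carrier X"
proof -
  let ?X = "constant_simplicial_rack X"
  have \<epsilon>: "\<epsilon> \<in> simplicial_maps F ?X" using w by (simp add: weak_equivalence_def)
  have unit: "(\<lambda>q. frag_of) \<in> simplicial_maps F (free_abelian F)"
    by (auto simp: simplicial_maps_def free_abelian_def)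
  have "inj (Inl :: 'f \<Rightarrow> 'f + 'x + nat)" by simp
  from weak_equivalence_lift(1)[OF w free_abelian_kan[OF F] inj_graph_code[OF this] unit]
  obtain h H where h: "h \<in> simplicial_maps ?X (free_abelian F)"
    and H: "H \<in> simplicial_maps (simplicial_product F (std_simplex 1)) (free_abelian F)"
    and ends: "\<And>q x. x \<in> cells F q \<Longrightarrow> H q (x, replicate (Suc q) 0) = h q (\<epsilon> q x)"
      "\<And>q x. x \<in> cells F q \<Longrightarrow> H q (x, replicate (Suc q) 1) = frag_of x"
    unfolding simplicially_homotopic_def by auto
  \<comment> \<open>h is a section after linearising, hence every point of X is hit\<close>
  let ?K = "free_abelian ?X"
  have X: "simplicial_set ?X" by (rule simplicial_set.intro) auto
  have push\<epsilon>: "(\<lambda>q. push (\<epsilon> q)) \<in> simplicial_maps (free_abelian F) ?K"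
    using \<epsilon> unfolding simplicial_maps_def free_abelian_def
    by (auto simp: push_push subset_iff Pi_iff dest!: subsetD[OF keys_push] intro!: push_cong)
  have comp: "(\<lambda>q. g q \<circ> f q) \<in> simplicial_maps S V"
    if "f \<in> simplicial_maps S T" "g \<in> simplicial_maps T V"
    for f g and S :: "('u1, 'u2) simplicial_set_scheme" and T :: "('u3, 'u4) simplicial_set_scheme"
      and V :: "('u5, 'u6) simplicial_set_scheme"
    using that by (auto simp: simplicial_maps_def Pi_iff)
  have h2: "(\<lambda>q. push (\<epsilon> q) \<circ> h q) \<in> simplicial_maps ?X ?K" by (rule comp[OF h push\<epsilon>])
  have h1: "(\<lambda>q. frag_of) \<in> simplicial_maps ?X ?K" by (auto simp: simplicial_maps_def free_abelian_def)
  have "simplicially_homotopic F ?K (\<lambda>q. (push (\<epsilon> q) \<circ> h q) \<circ> \<epsilon> q) (\<lambda>q. frag_of \<circ> \<epsilon> q)"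
    unfolding simplicially_homotopic_def
    by (rule bexI[OF _ comp[OF H push\<epsilon>]]) (auto simp: ends simp del: replicate_Suc One_nat_def)
  moreover have "inj (Inr \<circ> Inl :: 'x \<Rightarrow> 'f + 'x + nat)" by (simp add: inj_compose)
  ultimately have "simplicially_homotopic ?X ?K (\<lambda>q. push (\<epsilon> q) \<circ> h q) (\<lambda>q. frag_of)"
    using weak_equivalence_lift(2)[OF w free_abelian_kan[OF X] inj_graph_code h2 h1] by blast
  then obtain G where G: "G \<in> simplicial_maps (simplicial_product ?X (std_simplex 1)) ?K"
    and "\<forall>q. \<forall>x\<in>cells ?X q. G q (x, replicate (Suc q) 0) = (push (\<epsilon> q) \<circ> h q) x \<and>
      G q (x, replicate (Suc q) 1) = frag_of x"
    unfolding simplicially_homotopic_def by blast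
  then have G_ends: "G 0 (x, [0]) = push (\<epsilon> 0) (h 0 x)" "G 0 (x, [1]) = frag_of x" if "x \<in> carrier X" for x
    using that by (auto dest: spec[of _ 0])
  have "x \<in> \<epsilon> 0 ` cells F 0" if x: "x \<in> carrier X" for x
  proof -
    have "(x, [0, 1]) \<in> cells (simplicial_product ?X (std_simplex 1)) 1"
      using x by (auto simp: simplicial_product_def std_simplex_def)
    then have "G 0 (face (simplicial_product ?X (std_simplex 1)) 1 i (x, [0, 1])) = face ?K 1 i (G 1 (x, [0, 1]))" if "i \<le> 1" for i
      using G that by (auto simp: simplicial_maps_def)
    from this[of 0] this[of 1] have "G 0 (x, [1]) = G 0 (x, [0])"
      by (simp add: simplicial_product_def std_simplex_def free_abelian_def push_ident)
    then have "Poly_Mapping.keys (push (\<epsilon> 0) (h 0 x)) = {x}" using G_ends[OF x] by simp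
    moreover have "Poly_Mapping.keys (h 0 x) \<subseteq> cells F 0"
      using h x by (auto simp: simplicial_maps_def free_abelian_def Pi_iff)
    ultimately show ?thesis using keys_push[of "\<epsilon> 0" "h 0 x"] by auto
  qed
  moreover have "\<epsilon> 0 ` cells F 0 \<subseteq> carrier X" using \<epsilon> by (auto simp: simplicial_maps_def)
  ultimately have "\<epsilon> 0 ` cells F 0 = carrier X" by blast
  then show ?thesis using that h H ends by blast
qed

text \<open>The prism operator of the p-th tensor power of H is a homotopy from the projection onto the
  constant part to the identity; here g is the tensor power of h in degree 0.  In positive degrees the constant
  part is itself contractible.\<close>

theorem simplicial_power_contraction:
  fixes F :: "('f, 'y) simplicial_set_scheme" and X :: "('x, 'z) rack_scheme"
  assumes F: "simplicial_set F" and w: "weak_equivalence F (constant_simplicial_rack X) \<epsilon>"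
  obtains t g where
    "\<And>q w. w \<in> tuples (cells F q) p \<Longrightarrow> Poly_Mapping.keys (t q w) \<subseteq> tuples (cells F (Suc q)) p"
    "\<And>v. v \<in> tuples (carrier X) p \<Longrightarrow> Poly_Mapping.keys (g v) \<subseteq> tuples (cells F 0) p"
    "\<And>w. w \<in> tuples (cells F 0) p \<Longrightarrow>
      simplicial_boundary (simplicial_power F p) 0 (t 0 w) = frag_of w - g (map (\<epsilon> 0) w)"
    "\<And>q w. w \<in> tuples (cells F (Suc q)) p \<Longrightarrow>
      simplicial_boundary (simplicial_power F p) (Suc q) (t (Suc q) w) +
      frag_extend (t q) (simplicial_boundary (simplicial_power F p) q (frag_of w)) = frag_of w"
proof -
  let ?P = "simplicial_power F p"
  interpret F: simplicial_set F by fact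
  obtain h H where h: "h \<in> simplicial_maps (constant_simplicial_rack X) (free_abelian F)"
    and H: "H \<in> simplicial_maps (simplicial_product F (std_simplex 1)) (free_abelian F)"
    and H0: "\<And>q x. x \<in> cells F q \<Longrightarrow> H q (x, replicate (Suc q) 0) = h q (\<epsilon> q x)"
    and H1: "\<And>q x. x \<in> cells F q \<Longrightarrow> H q (x, replicate (Suc q) 1) = frag_of x"
    by (rule weak_equivalence_discrete[OF F w]) (rule that)
  have \<epsilon>: "\<And>q x. x \<in> cells F q \<Longrightarrow> \<epsilon> q x \<in> carrier X"
    "\<And>q i x. \<lbrakk>x \<in> cells F (Suc q); i \<le> Suc q\<rbrakk> \<Longrightarrow> \<epsilon> q (face F (Suc q) i x) = \<epsilon> (Suc q) x"
    using w by (auto simp: weak_equivalence_def simplicial_maps_def Pi_iff)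
  have h_keys: "\<And>q x. x \<in> carrier X \<Longrightarrow> Poly_Mapping.keys (h q x) \<subseteq> cells F q"
    and h_face: "\<And>q i x. \<lbrakk>x \<in> carrier X; i \<le> Suc q\<rbrakk> \<Longrightarrow> push (face F (Suc q) i) (h (Suc q) x) = h q x"
    using h by (auto simp: simplicial_maps_def free_abelian_def Pi_iff)
  define HP where "HP = (\<lambda>q (xs, v). tensor (map (\<lambda>x. H q (x, v)) xs))"
  have HP: "HP \<in> simplicial_maps (simplicial_product ?P (std_simplex 1)) (free_abelian ?P)"
    unfolding HP_def by (rule tensor_homotopy[OF F H])
  have P: "simplicial_set ?P" by (rule simplicial_power_simplicial_set[OF F])
  define g where "g q v = tensor (map (h q) v)" for q v
  have g_keys: "Poly_Mapping.keys (g q v) \<subseteq> tuples (cells F q) p" if "v \<in> tuples (carrier X) p" for q v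
  proof -
    have "Poly_Mapping.keys c \<subseteq> cells F q" if "c \<in> set (map (h q) v)" for c
      using that \<open>v \<in> tuples (carrier X) p\<close> h_keys by fastforce
    from keys_tensor[of "map (h q) v", OF this] show ?thesis using that by (simp add: g_def)
  qed
  have g_face: "push (map (face F (Suc q) i)) (g (Suc q) v) = g q v"
    if "v \<in> tuples (carrier X) p" "i \<le> Suc q" for q i v
    unfolding g_def tensor_push[symmetric] map_map
    by (rule arg_cong[where f = tensor], rule map_cong) (use that h_face in auto)
  have HP_ends: "HP q (w, replicate (Suc q) 1) - HP q (w, replicate (Suc q) 0) = frag_of w - g q (map (\<epsilon> q) w)"
    if "w \<in> tuples (cells F q) p" for q w
  proof -
    have *: "map (\<lambda>x. H q (x, replicate (Suc q) 1)) w = map frag_of w"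
      "map (\<lambda>x. H q (x, replicate (Suc q) 0)) w = map (h q) (map (\<epsilon> q) w)"
      using that H0 H1 by (auto simp del: replicate_Suc One_nat_def)
    then show ?thesis
      unfolding HP_def prod.case g_def * using tensor_frag_of[of "\<lambda>x. x" w] by simp
  qed
  \<comment> \<open>the chain complex of a constant simplicial set has the differentials 0 and 1 alternately, and
    the second summand contracts it in positive degrees\<close>
  define t where "t q w = prism ?P HP q w + (if odd q then g (Suc q) (map (\<epsilon> q) w) else 0)" for q w
  have \<epsilon>w: "map (\<epsilon> q) w \<in> tuples (carrier X) p" if "w \<in> tuples (cells F q) p" for q w
    using that \<epsilon>(1) by (auto simp: subset_iff)
  have t0: "simplicial_boundary ?P 0 (t 0 w) = frag_of w - g 0 (map (\<epsilon> 0) w)" if "w \<in> tuples (cells F 0) p" for w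
    using prism_homotopy_0[OF P HP, of w] HP_ends[of w 0] that by (simp add: t_def)
  have tSuc: "simplicial_boundary ?P (Suc q) (t (Suc q) w) + frag_extend (t q) (simplicial_boundary ?P q (frag_of w)) = frag_of w"
    if ww: "w \<in> tuples (cells F (Suc q)) p" for q w
  proof -
    note \<epsilon>w[OF ww]
    have fw: "map (\<epsilon> q) (map (face F (Suc q) i) w) = map (\<epsilon> (Suc q)) w" if "i \<le> Suc q" for i
      using \<epsilon>(2) that ww by (auto simp: subset_iff)
    have 1: "simplicial_boundary ?P (Suc q) (t (Suc q) w) = simplicial_boundary ?P (Suc q) (prism ?P HP (Suc q) w) +
        (if even q then g (Suc q) (map (\<epsilon> (Suc q)) w) else 0)"
    proof -
      have "simplicial_boundary ?P (Suc q) (g (Suc (Suc q)) (map (\<epsilon> (Suc q)) w)) =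
          (\<Sum>i\<le>Suc (Suc q). frag_cmul ((-1) ^ i) (g (Suc q) (map (\<epsilon> (Suc q)) w)))"
        unfolding simplicial_boundary_push
        by (rule sum.cong) (use g_face[OF \<epsilon>w[OF ww]] in simp_all)
      also have "\<dots> = (if even q then g (Suc q) (map (\<epsilon> (Suc q)) w) else 0)"
        unfolding alternating_sum_const by simp
      finally show ?thesis unfolding t_def by (simp add: simplicial_boundary_add)
    qed
    have 2: "frag_extend (t q) (simplicial_boundary ?P q (frag_of w)) =
        frag_extend (prism ?P HP q) (simplicial_boundary ?P q (frag_of w)) +
        (if odd q then g (Suc q) (map (\<epsilon> (Suc q)) w) else 0)"
    proof (cases "odd q")
      case True
      have "frag_extend (\<lambda>w. g (Suc q) (map (\<epsilon> q) w)) (simplicial_boundary ?P q (frag_of w)) =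
          (\<Sum>i\<le>Suc q. frag_cmul ((-1) ^ i) (g (Suc q) (map (\<epsilon> (Suc q)) w)))"
        unfolding simplicial_boundary_def frag_extend_of frag_extend_sum' frag_extend_cmul
        by (rule sum.cong) (simp_all add: fw del: map_map)
      also have "\<dots> = g (Suc q) (map (\<epsilon> (Suc q)) w)"
        unfolding alternating_sum_const using True by simp
      finally show ?thesis using True unfolding t_def by (simp add: frag_extend_add_fun)
    next
      case False
      then have "t q = prism ?P HP q" by (simp add: t_def fun_eq_iff)
      then show ?thesis using False by simp
    qed
    have "simplicial_boundary ?P (Suc q) (prism ?P HP (Suc q) w) +
        frag_extend (prism ?P HP q) (simplicial_boundary ?P q (frag_of w)) =
        frag_of w - g (Suc q) (map (\<epsilon> (Suc q)) w)"
      using prism_homotopy_Suc[OF P HP, of w q] HP_ends[OF ww] ww by simp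
    then show ?thesis unfolding 1 2 by (cases "even q") (simp_all add: algebra_simps)
  qed
  have t_keys: "Poly_Mapping.keys (t q w) \<subseteq> tuples (cells F (Suc q)) p" if "w \<in> tuples (cells F q) p" for q w
    unfolding t_def using keys_prism[OF P HP, of w q] g_keys[OF \<epsilon>w[OF that]] that
    by (intro keys_add_subset) auto
  show ?thesis by (rule that[of t "g 0"]) (fact t_keys g_keys t0 tSuc)+
qed

section \<open>Staircases in a bicomplex\<close>

text \<open>Both quotients are isomorphic to the quotient of B by the common preimage of N and M.\<close>

lemma FactGroup_iso_span:
  assumes B: "group B" and G: "group G" and H: "group H" and N: "N \<lhd> G" and M: "M \<lhd> H"
    and f: "f \<in> hom B G" "f ` carrier B = carrier G" and g: "g \<in> hom B H" "g ` carrier B = carrier H"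
    and eq: "\<And>b. b \<in> carrier B \<Longrightarrow> f b \<in> N \<longleftrightarrow> g b \<in> M"
  shows "G Mod N \<cong> H Mod M"
proof -
  have quot: "group (B Mod {b \<in> carrier B. f b \<in> N}) \<and> B Mod {b \<in> carrier B. f b \<in> N} \<cong> G Mod N"
    if G: "group G" and N: "N \<lhd> G" and f: "f \<in> hom B G" "f ` carrier B = carrier G"
    for G :: "('u, 'v) monoid_scheme" and N f
  proof -
    interpret N: normal N G by (rule N)
    have sub: "subgroup N G" by (rule normal_imp_subgroup[OF N])
    let ?h = "\<lambda>b. N #>\<^bsub>G\<^esub> f b"
    have "?h \<in> hom B (G Mod N)"
      using hom_compose[OF f(1) N.r_coset_hom_Mod] by (simp add: comp_def)
    then have hom: "group_hom B (G Mod N) ?h"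
      using B N.factorgroup_is_group by (simp add: group_hom_def group_hom_axioms_def)
    have fc: "f b \<in> carrier G" if "b \<in> carrier B" for b using f(1) that by (auto simp: hom_def)
    have onto: "?h ` carrier B = carrier (G Mod N)"
      by (auto simp: FactGroup_def RCOSETS_def simp flip: f(2))
    have "N #>\<^bsub>G\<^esub> f b = N \<longleftrightarrow> f b \<in> N" if "b \<in> carrier B" for b
      using group.coset_join1[OF G _ fc[OF that] sub] group.coset_join2[OF G fc[OF that] sub] by blast
    then have "kernel B (G Mod N) ?h = {b \<in> carrier B. f b \<in> N}"
      by (auto simp: kernel_def FactGroup_def)
    then show ?thesis
      using group_hom.FactGroup_iso[OF hom onto] normal.factorgroup_is_group[OF group_hom.normal_kernel[OF hom]]
      by simp
  qed
  have "{b \<in> carrier B. f b \<in> N} = {b \<in> carrier B. g b \<in> M}" using eq by blast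
  then have "B Mod {b \<in> carrier B. f b \<in> N} \<cong> H Mod M" using quot[OF H M g] by simp
  moreover have "G Mod N \<cong> B Mod {b \<in> carrier B. f b \<in> N}"
    using quot[OF G N f] group.iso_sym by blast
  ultimately show ?thesis using iso_trans by blast
qed

lemma subgroup_comm_group:
  assumes G: "comm_group G" and H: "subgroup H G"
  shows "comm_group (G\<lparr>carrier := H\<rparr>)"
  using subgroup.subgroup_is_group[OF H comm_group.axioms(2)[OF G]]
    comm_monoid.m_comm[OF comm_group.axioms(1)[OF G]] subgroup.mem_carrier[OF H]
  by (intro group.group_comm_groupI) simp_all

text \<open>The two differentials commute, rather than anticommute.  Exactness is required in all positions that are
  the target of a differential in the same direction.\<close>

locale bicomplex =
  fixes C :: "nat \<Rightarrow> nat \<Rightarrow> 'c monoid" and d D :: "nat \<Rightarrow> nat \<Rightarrow> 'c \<Rightarrow> 'c"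
  assumes C_group: "comm_group (C p q)"
    and d_hom: "d p q \<in> hom (C p q) (C (Suc p) q)"
    and D_hom: "D p q \<in> hom (C p q) (C p (Suc q))"
    and d_d: "a \<in> carrier (C p q) \<Longrightarrow> d (Suc p) q (d p q a) = \<one>\<^bsub>C (Suc (Suc p)) q\<^esub>"
    and D_D: "a \<in> carrier (C p q) \<Longrightarrow> D p (Suc q) (D p q a) = \<one>\<^bsub>C p (Suc (Suc q))\<^esub>"
    and d_D: "a \<in> carrier (C p q) \<Longrightarrow> d p (Suc q) (D p q a) = D (Suc p) q (d p q a)"
    and d_exact: "\<lbrakk>a \<in> carrier (C (Suc p) q); d (Suc p) q a = \<one>\<^bsub>C (Suc (Suc p)) q\<^esub>\<rbrakk> \<Longrightarrow>
      \<exists>b\<in>carrier (C p q). d p q b = a"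
    and D_exact: "\<lbrakk>a \<in> carrier (C p (Suc q)); D p (Suc q) a = \<one>\<^bsub>C p (Suc (Suc q))\<^esub>\<rbrakk> \<Longrightarrow>
      \<exists>b\<in>carrier (C p q). D p q b = a"
begin

definition cocycles :: "nat \<Rightarrow> nat \<Rightarrow> 'c monoid" where
  "cocycles p q = C p q \<lparr>carrier := kernel (C p q) (C (Suc p) q) (d p q) \<inter> kernel (C p q) (C p (Suc q)) (D p q)\<rparr>"

text \<open>Away from the edges this is also the image of the kernel of d under D
  (\<open>boundaries_Suc_Suc\<close>), and by exactness the image of \<open>d \<circ> D\<close>.  On the edge \<open>p = 0\<close> only the
  description by D makes sense, and on the edge \<open>q = 0\<close> only the one by d.\<close>

definition boundaries :: "nat \<Rightarrow> nat \<Rightarrow> 'c set" where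
  "boundaries p q = (case p of
     Suc p' \<Rightarrow> d p' q ` kernel (C p' q) (C p' (Suc q)) (D p' q)
   | 0 \<Rightarrow> (case q of
       Suc q' \<Rightarrow> D 0 q' ` kernel (C 0 q') (C 1 q') (d 0 q')
     | 0 \<Rightarrow> {\<one>\<^bsub>C 0 0\<^esub>}))"

lemma d_group_hom: "group_hom (C p q) (C (Suc p) q) (d p q)"
  and D_group_hom: "group_hom (C p q) (C p (Suc q)) (D p q)"
  using C_group d_hom D_hom by (auto simp: group_hom_def group_hom_axioms_def comm_group_def)

lemmas d_closed = hom_in_carrier[OF d_hom] and D_closed = hom_in_carrier[OF D_hom]

lemma boundaries_Suc_Suc:
  "boundaries (Suc p) (Suc q) = D (Suc p) q ` kernel (C (Suc p) q) (C (Suc (Suc p)) q) (d (Suc p) q)"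
proof -
  have "a \<in> D (Suc p) q ` kernel (C (Suc p) q) (C (Suc (Suc p)) q) (d (Suc p) q)"
    if "a \<in> d p (Suc q) ` kernel (C p (Suc q)) (C p (Suc (Suc q))) (D p (Suc q))" for a
  proof -
    from that obtain b where b: "b \<in> carrier (C p (Suc q))" "D p (Suc q) b = \<one>\<^bsub>C p (Suc (Suc q))\<^esub>"
      and a: "a = d p (Suc q) b" by (auto simp: kernel_def)
    from D_exact[OF b] obtain c where c: "c \<in> carrier (C p q)" "b = D p q c" by blast
    show ?thesis
      unfolding a c(2) d_D[OF c(1)] using c(1) by (auto simp: kernel_def d_d d_closed)
  qed
  moreover have "a \<in> d p (Suc q) ` kernel (C p (Suc q)) (C p (Suc (Suc q))) (D p (Suc q))"
    if "a \<in> D (Suc p) q ` kernel (C (Suc p) q) (C (Suc (Suc p)) q) (d (Suc p) q)" for a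
  proof -
    from that obtain b where b: "b \<in> carrier (C (Suc p) q)" "d (Suc p) q b = \<one>\<^bsub>C (Suc (Suc p)) q\<^esub>"
      and a: "a = D (Suc p) q b" by (auto simp: kernel_def)
    from d_exact[OF b] obtain c where c: "c \<in> carrier (C p q)" "b = d p q c" by blast
    show ?thesis
      unfolding a c(2) d_D[OF c(1), symmetric] using c(1) by (auto simp: kernel_def D_D D_closed)
  qed
  ultimately show ?thesis by (auto simp: boundaries_def)
qed

lemma cocycles_subgroup: "subgroup (carrier (cocycles p q)) (C p q)"
  unfolding cocycles_def
  using group.subgroups_Inter_pair[OF comm_group.axioms(2)[OF C_group]]
    group_hom.subgroup_kernel[OF d_group_hom] group_hom.subgroup_kernel[OF D_group_hom]
  by simp

lemma cocycles_comm_group: "comm_group (cocycles p q)"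
  using subgroup_comm_group[OF C_group cocycles_subgroup] by (simp add: cocycles_def)

lemma boundaries_subset: "boundaries p q \<subseteq> carrier (cocycles p q)"
proof (cases p)
  case (Suc p')
  then show ?thesis
    using d_D[of _ p' q] group_hom.hom_one[OF d_group_hom]
    by (auto simp: boundaries_def cocycles_def kernel_def d_d d_closed)
       (metis d_D)
next
  case 0
  then show ?thesis
    using group_hom.hom_one[OF D_group_hom] group_hom.hom_one[OF d_group_hom]
      monoid.one_closed[OF comm_group.axioms(1)[OF C_group, THEN comm_monoid.axioms(1)]]
    by (cases q) (auto simp: boundaries_def cocycles_def kernel_def D_D D_closed d_D)
qed

lemma boundaries_subgroup: "subgroup (boundaries p q) (C p q)"
proof (cases p)
  case (Suc p')
  show ?thesis
    unfolding boundaries_def Suc nat.case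
    by (rule group_hom.subgroup_img_is_subgroup[OF d_group_hom group_hom.subgroup_kernel[OF D_group_hom]])
next
  case 0
  show ?thesis
  proof (cases q)
    case (Suc q')
    show ?thesis
      unfolding boundaries_def Suc 0 nat.case using group_hom.subgroup_kernel[OF d_group_hom, of 0 q']
      by (intro group_hom.subgroup_img_is_subgroup[OF D_group_hom]) simp
  next
    case 0
    with \<open>p = 0\<close> show ?thesis
      using group.triv_subgroup[OF comm_group.axioms(2)[OF C_group]] by (simp add: boundaries_def)
  qed
qed

lemma boundaries_normal: "boundaries p q \<lhd> cocycles p q"
proof -
  have "subgroup (boundaries p q) (C p q \<lparr>carrier := carrier (cocycles p q)\<rparr>)"
    using group.subgroup_incl[OF comm_group.axioms(2)[OF C_group] boundaries_subgroup cocycles_subgroup boundaries_subset] .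
  moreover have "C p q \<lparr>carrier := carrier (cocycles p q)\<rparr> = cocycles p q" by (simp add: cocycles_def)
  ultimately show ?thesis using comm_group.subgroup_imp_normal[OF cocycles_comm_group] by metis
qed

text \<open>The elements b of position \<open>(p, q)\<close> with \<open>d (D b) = 0\<close> form a group that d and D map to the two
  sides, and both maps are onto by exactness.  If \<open>d b = d c\<close> for a c in the kernel of D, then
  \<open>D b = D (b - c)\<close> with \<open>b - c\<close> in the kernel of d, and likewise with d and D exchanged.\<close>

theorem staircase_step:
  "cocycles (Suc p) q Mod boundaries (Suc p) q \<cong> cocycles p (Suc q) Mod boundaries p (Suc q)"
proof -
  interpret d: group_hom "C p q" "C (Suc p) q" "d p q" by (rule d_group_hom)
  interpret D: group_hom "C p q" "C p (Suc q)" "D p q" by (rule D_group_hom)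
  let ?dD = "\<lambda>b. d p (Suc q) (D p q b)"
  have hom: "group_hom (C p q) (C (Suc p) (Suc q)) ?dD"
    using hom_compose[OF D_hom d_hom] C_group
    by (auto simp: group_hom_def group_hom_axioms_def comm_group_def comp_def)
  define B where "B = C p q \<lparr>carrier := kernel (C p q) (C (Suc p) (Suc q)) ?dD\<rparr>"
  have B: "b \<in> carrier B \<longleftrightarrow> b \<in> carrier (C p q) \<and> d p (Suc q) (D p q b) = \<one>\<^bsub>C (Suc p) (Suc q)\<^esub>" for b
    by (auto simp: B_def kernel_def)
  have dc: "d p q b \<in> carrier (cocycles (Suc p) q)" and Dc: "D p q b \<in> carrier (cocycles p (Suc q))" if "b \<in> carrier B" for b
    using that d_D[of b p q] by (auto simp: B cocycles_def kernel_def d_d D_D d_closed D_closed)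
  show ?thesis
  proof (rule FactGroup_iso_span)
    show "group B"
      unfolding B_def by (rule subgroup.subgroup_is_group[OF group_hom.subgroup_kernel[OF hom] d.G.is_group])
    show "group (cocycles (Suc p) q)" "group (cocycles p (Suc q))"
      using cocycles_comm_group by (auto simp: comm_group_def)
    show "boundaries (Suc p) q \<lhd> cocycles (Suc p) q" "boundaries p (Suc q) \<lhd> cocycles p (Suc q)"
      by (rule boundaries_normal)+
    show "d p q \<in> hom B (cocycles (Suc p) q)" "D p q \<in> hom B (cocycles p (Suc q))"
      using dc Dc d.hom_mult D.hom_mult by (auto intro!: homI simp: B) (simp_all add: B_def cocycles_def)
    show "d p q ` carrier B = carrier (cocycles (Suc p) q)"
    proof (intro equalityI subsetI)
      fix a assume a: "a \<in> carrier (cocycles (Suc p) q)"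
      then obtain b where b: "b \<in> carrier (C p q)" "d p q b = a"
        using d_exact[of a p q] by (auto simp: cocycles_def kernel_def)
      with a show "a \<in> d p q ` carrier B"
        by (intro image_eqI[of _ _ b]) (auto simp: B d_D cocycles_def kernel_def)
    qed (use dc in auto)
    show "D p q ` carrier B = carrier (cocycles p (Suc q))"
    proof (intro equalityI subsetI)
      fix a assume a: "a \<in> carrier (cocycles p (Suc q))"
      then obtain b where b: "b \<in> carrier (C p q)" "D p q b = a"
        using D_exact[of a p q] by (auto simp: cocycles_def kernel_def)
      with a show "a \<in> D p q ` carrier B"
        by (intro image_eqI[of _ _ b]) (auto simp: B cocycles_def kernel_def)
    qed (use Dc in auto)
    fix b assume "b \<in> carrier B"
    then have b: "b \<in> carrier (C p q)" by (simp add: B)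
    have bd: "boundaries p (Suc q) = D p q ` kernel (C p q) (C (Suc p) q) (d p q)"
      by (cases p) (simp add: boundaries_def, simp add: boundaries_Suc_Suc)
    have diff: "f (b \<otimes>\<^bsub>C p q\<^esub> inv\<^bsub>C p q\<^esub> c) = f b \<otimes>\<^bsub>H\<^esub> inv\<^bsub>H\<^esub> f c"
      if "group_hom (C p q) H f" "c \<in> carrier (C p q)" for f H c
      using that b by (simp add: group_hom.hom_mult group_hom.hom_inv)
    have mem: "b \<otimes>\<^bsub>C p q\<^esub> inv\<^bsub>C p q\<^esub> c \<in> carrier (C p q)" if "c \<in> carrier (C p q)" for c
      using b that by simp
    show "d p q b \<in> boundaries (Suc p) q \<longleftrightarrow> D p q b \<in> boundaries p (Suc q)"
    proof
      assume "d p q b \<in> boundaries (Suc p) q"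
      then obtain c where c: "c \<in> carrier (C p q)" "D p q c = \<one>\<^bsub>C p (Suc q)\<^esub>" "d p q b = d p q c"
        by (auto simp: boundaries_def kernel_def)
      have "D p q b = D p q (b \<otimes>\<^bsub>C p q\<^esub> inv\<^bsub>C p q\<^esub> c)"
        using diff[OF D_group_hom c(1)] c b by simp
      moreover have "d p q (b \<otimes>\<^bsub>C p q\<^esub> inv\<^bsub>C p q\<^esub> c) = \<one>\<^bsub>C (Suc p) q\<^esub>"
        using diff[OF d_group_hom c(1)] c b by simp
      ultimately show "D p q b \<in> boundaries p (Suc q)"
        unfolding bd using mem[OF c(1)] by (auto simp: kernel_def)
    next
      assume "D p q b \<in> boundaries p (Suc q)"
      then obtain c where c: "c \<in> carrier (C p q)" "d p q c = \<one>\<^bsub>C (Suc p) q\<^esub>" "D p q b = D p q c"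
        unfolding bd by (auto simp: kernel_def)
      have "d p q b = d p q (b \<otimes>\<^bsub>C p q\<^esub> inv\<^bsub>C p q\<^esub> c)"
        using diff[OF d_group_hom c(1)] c b by simp
      moreover have "D p q (b \<otimes>\<^bsub>C p q\<^esub> inv\<^bsub>C p q\<^esub> c) = \<one>\<^bsub>C p (Suc q)\<^esub>"
        using diff[OF D_group_hom c(1)] c b by simp
      ultimately show "d p q b \<in> boundaries (Suc p) q"
        using mem[OF c(1)] by (auto simp: boundaries_def kernel_def)
    qed
  qed
qed

theorem staircase: "cocycles n 0 Mod boundaries n 0 \<cong> cocycles 0 n Mod boundaries 0 n"
proof -
  have "cocycles n 0 Mod boundaries n 0 \<cong> cocycles (n - k) k Mod boundaries (n - k) k" if "k \<le> n" for k
    using that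
  proof (induction k)
    case 0
    show ?case using iso_refl by (auto simp: is_iso_def)
  next
    case (Suc k)
    then have "n - k = Suc (n - Suc k)" by simp
    then show ?case using Suc staircase_step[of "n - Suc k" k] iso_trans by fastforce
  qed
  from this[of n] show ?thesis by simp
qed

end

section \<open>Cochain groups\<close>

lemma hom_group_carrier: "f \<in> carrier (hom_group G A) \<longleftrightarrow> f \<in> hom G A \<and> f \<in> extensional (carrier G)"
  by (simp add: hom_group_def)

lemma hom_group_mult: "x \<in> carrier G \<Longrightarrow> (f \<otimes>\<^bsub>hom_group G A\<^esub> g) x = f x \<otimes>\<^bsub>A\<^esub> g x"
  and hom_group_one: "x \<in> carrier G \<Longrightarrow> \<one>\<^bsub>hom_group G A\<^esub> x = \<one>\<^bsub>A\<^esub>"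
  by (simp_all add: hom_group_def)

lemma hom_group_eqI:
  "\<lbrakk>f \<in> carrier (hom_group G A); g \<in> carrier (hom_group G A); \<And>x. x \<in> carrier G \<Longrightarrow> f x = g x\<rbrakk> \<Longrightarrow> f = g"
  by (auto simp: hom_group_carrier intro: extensionalityI)

lemma hom_group_comm_group:
  assumes G: "group G" and A: "comm_group A"
  shows "comm_group (hom_group G A)"
proof -
  interpret A: comm_group A by (rule A)
  interpret G: group G by (rule G)
  let ?H = "hom_group G A"
  have cl: "f x \<in> carrier A" if "f \<in> carrier ?H" "x \<in> carrier G" for f x
    using that by (auto simp: hom_group_carrier hom_def)
  have mult: "f (x \<otimes>\<^bsub>G\<^esub> y) = f x \<otimes>\<^bsub>A\<^esub> f y" if "f \<in> carrier ?H" "x \<in> carrier G" "y \<in> carrier G" for f x y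
    using that by (auto simp: hom_group_carrier hom_def)
  have closed: "f \<otimes>\<^bsub>?H\<^esub> g \<in> carrier ?H" if "f \<in> carrier ?H" "g \<in> carrier ?H" for f g
  proof -
    have "(\<lambda>x\<in>carrier G. f x \<otimes>\<^bsub>A\<^esub> g x) \<in> hom G A"
      using that cl by (intro homI) (auto simp: mult A.m_ac)
    then show ?thesis by (simp add: hom_group_def)
  qed
  have one: "\<one>\<^bsub>?H\<^esub> \<in> carrier ?H"
    by (auto simp: hom_group_def hom_def)
  have inverse: "(\<lambda>x\<in>carrier G. inv\<^bsub>A\<^esub> f x) \<in> carrier ?H" if "f \<in> carrier ?H" for f
  proof -
    have "(\<lambda>x\<in>carrier G. inv\<^bsub>A\<^esub> f x) \<in> hom G A"
      using that cl by (intro homI) (auto simp: mult A.inv_mult)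
    then show ?thesis by (simp add: hom_group_def)
  qed
  show ?thesis
  proof (rule comm_groupI)
    fix f g h assume fgh: "f \<in> carrier ?H" "g \<in> carrier ?H" "h \<in> carrier ?H"
    show "f \<otimes>\<^bsub>?H\<^esub> g \<otimes>\<^bsub>?H\<^esub> h = f \<otimes>\<^bsub>?H\<^esub> (g \<otimes>\<^bsub>?H\<^esub> h)"
      by (rule hom_group_eqI[of _ G A]) (use fgh in \<open>auto simp: closed hom_group_mult cl A.m_assoc\<close>)
  next
    fix f g assume fg: "f \<in> carrier ?H" "g \<in> carrier ?H"
    show "f \<otimes>\<^bsub>?H\<^esub> g = g \<otimes>\<^bsub>?H\<^esub> f"
      by (rule hom_group_eqI[of _ G A]) (use fg in \<open>auto simp: closed hom_group_mult cl A.m_comm\<close>)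
  next
    fix f assume f: "f \<in> carrier ?H"
    show "\<one>\<^bsub>?H\<^esub> \<otimes>\<^bsub>?H\<^esub> f = f"
      by (rule hom_group_eqI[of _ G A]) (use f in \<open>auto simp: closed one hom_group_mult hom_group_one cl\<close>)
    have "(\<lambda>x\<in>carrier G. inv\<^bsub>A\<^esub> f x) \<otimes>\<^bsub>?H\<^esub> f = \<one>\<^bsub>?H\<^esub>"
      by (rule hom_group_eqI[of _ G A]) (use f in \<open>auto simp: closed one inverse hom_group_mult hom_group_one cl\<close>)
    then show "\<exists>g\<in>carrier ?H. g \<otimes>\<^bsub>?H\<^esub> f = \<one>\<^bsub>?H\<^esub>" using inverse[OF f] by blast
  qed (auto intro: closed one)
qed

lemma hom_group_compose:
  assumes "group G'" "\<phi> \<in> hom G' G" "f \<in> carrier (hom_group G A)"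
  shows "compose (carrier G') f \<phi> \<in> carrier (hom_group G' A)"
proof -
  interpret G': group G' by fact
  show ?thesis
    using assms by (auto simp: hom_group_carrier compose_def hom_def Pi_iff)
qed

lemma hom_group_compose_hom:
  assumes "group G'" "\<phi> \<in> hom G' G"
  shows "(\<lambda>f. compose (carrier G') f \<phi>) \<in> hom (hom_group G A) (hom_group G' A)"
proof (rule homI)
  fix f g assume "f \<in> carrier (hom_group G A)" "g \<in> carrier (hom_group G A)"
  show "compose (carrier G') (f \<otimes>\<^bsub>hom_group G A\<^esub> g) \<phi> =
      compose (carrier G') f \<phi> \<otimes>\<^bsub>hom_group G' A\<^esub> compose (carrier G') g \<phi>"
    using assms(2) by (auto simp: hom_group_def compose_def hom_def Pi_iff fun_eq_iff)
qed (rule hom_group_compose[OF assms])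

lemma hom_free_abelian_linear:
  assumes A: "comm_group A" and f: "f \<in> hom (free_Abelian_group S) A"
  shows "f 0 = \<one>\<^bsub>A\<^esub>"
    and "Poly_Mapping.keys a \<subseteq> S \<Longrightarrow> f a \<in> carrier A"
    and "\<lbrakk>Poly_Mapping.keys a \<subseteq> S; Poly_Mapping.keys b \<subseteq> S\<rbrakk> \<Longrightarrow> f (a + b) = f a \<otimes>\<^bsub>A\<^esub> f b"
    and "\<lbrakk>Poly_Mapping.keys a \<subseteq> S; Poly_Mapping.keys b \<subseteq> S\<rbrakk> \<Longrightarrow> f (a - b) = f a \<otimes>\<^bsub>A\<^esub> inv\<^bsub>A\<^esub> f b"
    and "Poly_Mapping.keys a \<subseteq> S \<Longrightarrow> f (frag_cmul k a) = f a [^]\<^bsub>A\<^esub> k"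
proof -
  interpret f: group_hom "free_Abelian_group S" A f
    using A f by (simp add: group_hom_def group_hom_axioms_def comm_group_def)
  show "f 0 = \<one>\<^bsub>A\<^esub>" using f.hom_one by simp
  show "Poly_Mapping.keys a \<subseteq> S \<Longrightarrow> f a \<in> carrier A" by simp
  show add: "\<lbrakk>Poly_Mapping.keys a \<subseteq> S; Poly_Mapping.keys b \<subseteq> S\<rbrakk> \<Longrightarrow> f (a + b) = f a \<otimes>\<^bsub>A\<^esub> f b" for a b
    using f.hom_mult[of a b] by simp
  show "\<lbrakk>Poly_Mapping.keys a \<subseteq> S; Poly_Mapping.keys b \<subseteq> S\<rbrakk> \<Longrightarrow> f (a - b) = f a \<otimes>\<^bsub>A\<^esub> inv\<^bsub>A\<^esub> f b"
    using add[of a "- b"] f.hom_inv[of b] by simp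
  show "Poly_Mapping.keys a \<subseteq> S \<Longrightarrow> f (frag_cmul k a) = f a [^]\<^bsub>A\<^esub> k"
    using f.hom_int_pow[of a k] by simp
qed

lemma frag_extend_hom:
  assumes "\<And>x. x \<in> S \<Longrightarrow> Poly_Mapping.keys (f x) \<subseteq> T"
  shows "frag_extend f \<in> hom (free_Abelian_group S) (free_Abelian_group T)"
  by (intro homI) (simp_all add: frag_extend_add keys_extend_subset[OF _ assms])

lemma push_hom: "f \<in> S \<rightarrow> T \<Longrightarrow> push f \<in> hom (free_Abelian_group S) (free_Abelian_group T)"
  unfolding push_def by (rule frag_extend_hom) auto

text \<open>How a linear contraction s of chains yields exactness for cochains with any coefficients: if a
  does not see the difference between c and \<open>s (u c)\<close>, it is the cochain \<open>a \<circ> s\<close> composed with u.\<close>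

lemma hom_group_section:
  assumes A: "comm_group A" and a: "a \<in> carrier (hom_group (free_Abelian_group S) A)"
    and u: "\<And>c. Poly_Mapping.keys c \<subseteq> S \<Longrightarrow> Poly_Mapping.keys (u c) \<subseteq> S'"
    and s: "\<And>w. w \<in> S' \<Longrightarrow> Poly_Mapping.keys (s w) \<subseteq> S"
    and eq: "\<And>c. Poly_Mapping.keys c \<subseteq> S \<Longrightarrow> a (c - frag_extend s (u c)) = \<one>\<^bsub>A\<^esub>"
  obtains b where "b \<in> carrier (hom_group (free_Abelian_group S') A)"
    "compose (carrier (free_Abelian_group S)) b u = a"
proof
  interpret A: comm_group A by (rule A)
  let ?b = "compose (carrier (free_Abelian_group S')) a (frag_extend s)"
  show "?b \<in> carrier (hom_group (free_Abelian_group S') A)"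
    by (rule hom_group_compose[OF _ frag_extend_hom a]) (use s in auto)
  have ah: "a \<in> hom (free_Abelian_group S) A" "a \<in> extensional (carrier (free_Abelian_group S))"
    using a by (auto simp: hom_group_carrier)
  note lin = hom_free_abelian_linear[OF A ah(1)]
  have "a (frag_extend s (u c)) = a c" if c: "Poly_Mapping.keys c \<subseteq> S" for c
  proof -
    have k: "Poly_Mapping.keys (frag_extend s (u c)) \<subseteq> S" by (rule keys_extend_subset[OF u[OF c] s])
    have "a c \<otimes>\<^bsub>A\<^esub> inv\<^bsub>A\<^esub> a (frag_extend s (u c)) = \<one>\<^bsub>A\<^esub>" using eq[OF c] lin(4)[OF c k] by simp
    then show ?thesis using lin(2)[OF c] lin(2)[OF k] A.inv_equality A.inv_inv A.inv_closed by metis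
  qed
  then show "compose (carrier (free_Abelian_group S)) ?b u = a"
    using u ah(2) by (intro extensionalityI[of _ "carrier (free_Abelian_group S)"]) (auto simp: compose_def)
qed

section \<open>The bicomplex of a resolution\<close>

lemma carrier_level [simp]: "carrier (level F q) = cells F q"
  by (simp add: level_def)

lemma rack_boundary_sum: "rack_boundary X (sum f I) = (\<Sum>i\<in>I. rack_boundary X (f i))"
  by (induction I rule: infinite_finite_induct) (auto simp: rack_boundary_add)

lemma rack_boundary_cmul: "rack_boundary X (frag_cmul k c) = frag_cmul k (rack_boundary X c)"
  by (metis rack_boundary_extend frag_extend_cmul)

lemma rack_boundary_hom:
  assumes "rack X"
  shows "rack_boundary X \<in> hom (free_Abelian_group (tuples (carrier X) (Suc n))) (free_Abelian_group (tuples (carrier X) n))"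
  by (intro homI) (simp_all add: rack_boundary_add keys_rack_boundary[OF assms])

lemma simplicial_boundary_hom:
  assumes "simplicial_set S"
  shows "simplicial_boundary S q \<in> hom (free_Abelian_group (cells S (Suc q))) (free_Abelian_group (cells S q))"
  unfolding simplicial_boundary_def
  by (intro frag_extend_hom keys_sum_subset keys_cmul_subset)
    (use simplicial_set.face_closed[OF assms] in auto)

text \<open>The last assumption is the form in which the cofibrancy of F enters.\<close>

locale rack_resolution =
  fixes X :: "'x rack" and A :: "'a monoid" and F :: "'f simplicial_rack" and \<epsilon> :: "nat \<Rightarrow> 'f \<Rightarrow> 'x"
  assumes rack_X: "rack X" and comm_A: "comm_group A" and rack_F: "simplicial_rack F"
    and eps: "\<epsilon> \<in> simplicial_rack_maps F (constant_simplicial_rack X)"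
    and weak: "weak_equivalence F (constant_simplicial_rack X) \<epsilon>"
    and contraction: "\<exists>s. \<forall>w\<in>lists (cells F q).
      Poly_Mapping.keys (s w) \<subseteq> tuples (cells F q) (Suc (length w)) \<and>
      (2 \<le> length w \<longrightarrow>
        rack_boundary (level F q) (s w) + frag_extend s (rack_boundary (level F q) (frag_of w)) = frag_of w)"
begin

sublocale F: simplicial_rack F by (rule rack_F)

abbreviation Fpow where "Fpow \<equiv> simplicial_power F"

lemma simp_F: "simplicial_set F" by (rule F.simplicial_set_axioms)

lemma simp_Fpow: "simplicial_set (Fpow p)" by (rule simplicial_power_simplicial_set[OF simp_F])

abbreviation chains where "chains p q \<equiv> free_Abelian_group (tuples (cells F q) (Suc p))"

definition C :: "nat \<Rightarrow> nat \<Rightarrow> (('f list \<Rightarrow>\<^sub>0 int) \<Rightarrow> 'a) monoid" where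
  "C p q = hom_group (chains p q) A"

definition d :: "nat \<Rightarrow> nat \<Rightarrow> (('f list \<Rightarrow>\<^sub>0 int) \<Rightarrow> 'a) \<Rightarrow> ('f list \<Rightarrow>\<^sub>0 int) \<Rightarrow> 'a" where
  "d p q f = compose (carrier (chains (Suc p) q)) f (rack_boundary (level F q))"

definition D :: "nat \<Rightarrow> nat \<Rightarrow> (('f list \<Rightarrow>\<^sub>0 int) \<Rightarrow> 'a) \<Rightarrow> ('f list \<Rightarrow>\<^sub>0 int) \<Rightarrow> 'a" where
  "D p q f = compose (carrier (chains p (Suc q))) f (simplicial_boundary (Fpow (Suc p)) q)"

lemma rb_hom: "rack_boundary (level F q) \<in> hom (chains (Suc p) q) (chains p q)"
  using rack_boundary_hom[OF F.level_rack[of q], of "Suc p"] by simp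

lemma sb_hom: "simplicial_boundary (Fpow (Suc p)) q \<in> hom (chains p (Suc q)) (chains p q)"
  using simplicial_boundary_hom[OF simp_Fpow, of "Suc p" q] by simp

lemma rb_keys: "Poly_Mapping.keys c \<subseteq> tuples (cells F q) (Suc n) \<Longrightarrow>
    Poly_Mapping.keys (rack_boundary (level F q) c) \<subseteq> tuples (cells F q) n"
  using keys_rack_boundary[OF F.level_rack[of q], of c n] by simp

lemma sb_keys: "Poly_Mapping.keys c \<subseteq> tuples (cells F (Suc q)) p \<Longrightarrow>
    Poly_Mapping.keys (simplicial_boundary (Fpow p) q c) \<subseteq> tuples (cells F q) p"
  using hom_in_carrier[OF simplicial_boundary_hom[OF simp_Fpow, of p q], of c] by simp

lemma boundaries_commute:
  assumes c: "Poly_Mapping.keys c \<subseteq> tuples (cells F (Suc q)) n"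
  shows "rack_boundary (level F q) (simplicial_boundary (Fpow m) q c) =
    simplicial_boundary (Fpow m') q (rack_boundary (level F (Suc q)) c)"
proof -
  have "rack_boundary (level F q) (push (map (face F (Suc q) i)) c) =
      push (map (face F (Suc q) i)) (rack_boundary (level F (Suc q)) c)" if "i \<le> Suc q" for i
    by (rule rack_boundary_natural[OF F.face_hom[OF that]]) (use c in auto)
  then show ?thesis
    by (simp add: simplicial_boundary_push rack_boundary_sum rack_boundary_cmul del: sum.atMost_Suc)
qed

lemma C_carrier: "f \<in> carrier (C p q) \<longleftrightarrow> f \<in> hom (chains p q) A \<and> f \<in> extensional (carrier (chains p q))"
  by (simp add: C_def hom_group_carrier)

lemma one_C: "Poly_Mapping.keys c \<subseteq> tuples (cells F q) (Suc p) \<Longrightarrow> \<one>\<^bsub>C p q\<^esub> c = \<one>\<^bsub>A\<^esub>"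
  by (simp add: C_def hom_group_one)

lemma C_comm_group: "comm_group (C p q)"
  unfolding C_def by (rule hom_group_comm_group[OF _ comm_A]) simp

lemma d_C: "d p q \<in> hom (C p q) (C (Suc p) q)"
  using hom_group_compose_hom[OF _ rb_hom[of q p]] unfolding C_def d_def[abs_def] by simp

lemma D_C: "D p q \<in> hom (C p q) (C p (Suc q))"
  using hom_group_compose_hom[OF _ sb_hom[of p q]] unfolding C_def D_def[abs_def] by simp

lemma C_eqI:
  assumes "f \<in> carrier (C p q)" "g \<in> carrier (C p q)"
    and eq: "\<And>c. Poly_Mapping.keys c \<subseteq> tuples (cells F q) (Suc p) \<Longrightarrow> f c = g c"
  shows "f = g"
  using assms(1,2) unfolding C_def by (rule hom_group_eqI) (simp add: eq)

lemma d_apply: "Poly_Mapping.keys c \<subseteq> tuples (cells F q) (Suc (Suc p)) \<Longrightarrow> d p q f c = f (rack_boundary (level F q) c)"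
  and D_apply: "Poly_Mapping.keys c \<subseteq> tuples (cells F (Suc q)) (Suc p) \<Longrightarrow> D p q f c = f (simplicial_boundary (Fpow (Suc p)) q c)"
  by (simp_all add: d_def D_def compose_def)

lemma C_zero: "a \<in> carrier (C p q) \<Longrightarrow> a 0 = \<one>\<^bsub>A\<^esub>"
  using hom_free_abelian_linear(1)[OF comm_A] unfolding C_carrier by blast

lemma one_closed_C: "\<one>\<^bsub>C p q\<^esub> \<in> carrier (C p q)"
  using C_comm_group[of p q] by (simp add: comm_group_def group_def monoid.one_closed)

lemma d_exact:
  assumes a: "a \<in> carrier (C (Suc p) q)" and da: "d (Suc p) q a = \<one>\<^bsub>C (Suc (Suc p)) q\<^esub>"
  shows "\<exists>b\<in>carrier (C p q). d p q b = a"
proof -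
  obtain s where keys: "\<And>w. w \<in> lists (cells F q) \<Longrightarrow> Poly_Mapping.keys (s w) \<subseteq> tuples (cells F q) (Suc (length w))"
    and s: "\<And>w. w \<in> lists (cells F q) \<Longrightarrow> 2 \<le> length w \<Longrightarrow>
      rack_boundary (level F q) (s w) + frag_extend s (rack_boundary (level F q) (frag_of w)) = frag_of w"
    using contraction[of q] by blast
  let ?S = "\<lambda>n. tuples (cells F q) n"
  have keys': "Poly_Mapping.keys (s w) \<subseteq> ?S (Suc n)" if "w \<in> ?S n" for w n
    using keys[of w] that by auto
  have s': "c - frag_extend s (rack_boundary (level F q) c) = rack_boundary (level F q) (frag_extend s c)"
    if "Poly_Mapping.keys c \<subseteq> ?S (Suc (Suc p))" for c
    using that
  proof (induction c rule: frag_induction)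
    case (one w)
    then have "w \<in> lists (cells F q)" "2 \<le> length w" by auto
    from s[OF this] show ?case by (simp add: algebra_simps)
  next
    case (diff a b)
    show ?case
      unfolding rack_boundary_diff frag_extend_diff diff[symmetric] by (simp add: algebra_simps)
  qed simp
  have aS: "a \<in> carrier (hom_group (free_Abelian_group (?S (Suc (Suc p)))) A)" using a by (simp add: C_def)
  have "a (c - frag_extend s (rack_boundary (level F q) c)) = \<one>\<^bsub>A\<^esub>" if c: "Poly_Mapping.keys c \<subseteq> ?S (Suc (Suc p))" for c
  proof -
    have k: "Poly_Mapping.keys (frag_extend s c) \<subseteq> ?S (Suc (Suc (Suc p)))"
      by (rule keys_extend_subset[OF c keys'])
    show ?thesis unfolding s'[OF c] d_apply[OF k, symmetric] da one_C[OF k] ..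
  qed
  from hom_group_section[OF comm_A aS rb_keys keys' this] show ?thesis
    unfolding C_def d_def by blast
qed

lemma D_exact:
  assumes a: "a \<in> carrier (C p (Suc q))" and Da: "D p (Suc q) a = \<one>\<^bsub>C p (Suc (Suc q))\<^esub>"
  shows "\<exists>b\<in>carrier (C p q). D p q b = a"
proof -
  let ?S = "\<lambda>q. tuples (cells F q) (Suc p)"
  obtain t g where
    keys: "\<And>q w. w \<in> ?S q \<Longrightarrow> Poly_Mapping.keys (t q w) \<subseteq> ?S (Suc q)"
    "\<And>v. v \<in> tuples (carrier X) (Suc p) \<Longrightarrow> Poly_Mapping.keys (g v) \<subseteq> ?S 0"
    "\<And>w. w \<in> ?S 0 \<Longrightarrow> simplicial_boundary (Fpow (Suc p)) 0 (t 0 w) = frag_of w - g (map (\<epsilon> 0) w)"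
    and t: "\<And>q w. w \<in> ?S (Suc q) \<Longrightarrow>
      simplicial_boundary (Fpow (Suc p)) (Suc q) (t (Suc q) w) +
      frag_extend (t q) (simplicial_boundary (Fpow (Suc p)) q (frag_of w)) = frag_of w"
    by (rule simplicial_power_contraction[OF simp_F weak, of "Suc p"]) (rule that)
  have t': "c - frag_extend (t q) (simplicial_boundary (Fpow (Suc p)) q c) =
      simplicial_boundary (Fpow (Suc p)) (Suc q) (frag_extend (t (Suc q)) c)"
    if "Poly_Mapping.keys c \<subseteq> ?S (Suc q)" for c
    using that
  proof (induction c rule: frag_induction)
    case (one w)
    from t[OF this] show ?case by (simp add: algebra_simps)
  next
    case (diff a b)
    show ?case
      unfolding simplicial_boundary_diff frag_extend_diff diff[symmetric] by (simp add: algebra_simps)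
  qed simp
  have aS: "a \<in> carrier (hom_group (free_Abelian_group (?S (Suc q))) A)" using a by (simp add: C_def)
  have "a (c - frag_extend (t q) (simplicial_boundary (Fpow (Suc p)) q c)) = \<one>\<^bsub>A\<^esub>"
    if c: "Poly_Mapping.keys c \<subseteq> ?S (Suc q)" for c
  proof -
    have k: "Poly_Mapping.keys (frag_extend (t (Suc q)) c) \<subseteq> ?S (Suc (Suc q))"
      by (rule keys_extend_subset[OF c keys(1)])
    show ?thesis unfolding t'[OF c] D_apply[OF k, symmetric] Da one_C[OF k] ..
  qed
  from hom_group_section[OF comm_A aS sb_keys keys(1) this] show ?thesis
    unfolding C_def D_def by blast
qed

sublocale bicomplex C d D
proof (rule bicomplex.intro)
  show "comm_group (C p q)" for p q by (rule C_comm_group)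
  show "d p q \<in> hom (C p q) (C (Suc p) q)" for p q by (rule d_C)
  show "D p q \<in> hom (C p q) (C p (Suc q))" for p q by (rule D_C)
  note cl = hom_in_carrier[OF d_C] hom_in_carrier[OF D_C]
  show "d (Suc p) q (d p q a) = \<one>\<^bsub>C (Suc (Suc p)) q\<^esub>" if a: "a \<in> carrier (C p q)" for a p q
  proof (rule C_eqI)
    fix c :: "'f list \<Rightarrow>\<^sub>0 int" assume c: "Poly_Mapping.keys c \<subseteq> tuples (cells F q) (Suc (Suc (Suc p)))"
    have "Poly_Mapping.keys c \<subseteq> lists (carrier (level F q))" using c by auto
    then show "d (Suc p) q (d p q a) c = \<one>\<^bsub>C (Suc (Suc p)) q\<^esub> c"
      using C_zero[OF a] rack_boundary_boundary[OF F.level_rack[of q], of c]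
      unfolding d_apply[OF c] d_apply[OF rb_keys[OF c]] one_C[OF c] by simp
  qed (use a cl one_closed_C in auto)
  show "D p (Suc q) (D p q a) = \<one>\<^bsub>C p (Suc (Suc q))\<^esub>" if a: "a \<in> carrier (C p q)" for a p q
  proof (rule C_eqI)
    fix c :: "'f list \<Rightarrow>\<^sub>0 int" assume c: "Poly_Mapping.keys c \<subseteq> tuples (cells F (Suc (Suc q))) (Suc p)"
    then show "D p (Suc q) (D p q a) c = \<one>\<^bsub>C p (Suc (Suc q))\<^esub> c"
      using C_zero[OF a] simplicial_boundary_boundary[OF simp_Fpow, of c "Suc p" q]
      unfolding D_apply[OF c] D_apply[OF sb_keys[OF c]] one_C[OF c] by simp
  qed (use a cl one_closed_C in auto)
  show "d p (Suc q) (D p q a) = D (Suc p) q (d p q a)" if a: "a \<in> carrier (C p q)" for a p q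
  proof (rule C_eqI)
    fix c :: "'f list \<Rightarrow>\<^sub>0 int" assume c: "Poly_Mapping.keys c \<subseteq> tuples (cells F (Suc q)) (Suc (Suc p))"
    show "d p (Suc q) (D p q a) c = D (Suc p) q (d p q a) c"
      unfolding d_apply[OF c] D_apply[OF rb_keys[OF c]] D_apply[OF c] d_apply[OF sb_keys[OF c]]
      unfolding boundaries_commute[OF c, of "Suc (Suc p)" "Suc p"] ..
  qed (use a cl in auto)
qed (rule d_exact D_exact; assumption)+

subsection \<open>The edge of rack cochains\<close>

abbreviation Xchains where "Xchains n \<equiv> free_Abelian_group (tuples (carrier X) n)"

definition inflate :: "nat \<Rightarrow> (('x list \<Rightarrow>\<^sub>0 int) \<Rightarrow> 'a) \<Rightarrow> ('f list \<Rightarrow>\<^sub>0 int) \<Rightarrow> 'a" where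
  "inflate n r = compose (carrier (chains n 0)) r (push (map (\<epsilon> 0)))"

lemma eps_hom: "\<epsilon> q \<in> rack_hom (level F q) X"
  using eps by (auto simp: simplicial_rack_maps_def rack_hom_def level_def)

lemma eps_closed: "x \<in> cells F q \<Longrightarrow> \<epsilon> q x \<in> carrier X"
  using eps_hom[of q] by (auto simp: rack_hom_def)

lemma eps_face: "\<lbrakk>x \<in> cells F (Suc q); i \<le> Suc q\<rbrakk> \<Longrightarrow> \<epsilon> q (face F (Suc q) i x) = \<epsilon> (Suc q) x"
  using eps by (auto simp: simplicial_rack_maps_def simplicial_maps_def)

lemma eps_onto: "\<epsilon> 0 ` cells F 0 = carrier X"
  by (rule weak_equivalence_discrete[OF simp_F weak])

lemma push_eps_hom: "push (map (\<epsilon> 0)) \<in> hom (chains n 0) (Xchains (Suc n))"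
  by (intro push_hom map_tuples) (auto intro: eps_closed)

lemma inflate_hom: "inflate n \<in> hom (hom_group (Xchains (Suc n)) A) (C n 0)"
  using hom_group_compose_hom[OF _ push_eps_hom] unfolding C_def inflate_def[abs_def] by simp

lemma inflate_apply: "Poly_Mapping.keys c \<subseteq> tuples (cells F 0) (Suc n) \<Longrightarrow> inflate n r c = r (push (map (\<epsilon> 0)) c)"
  by (simp add: inflate_def compose_def)

lemma push_eps_onto:
  assumes "Poly_Mapping.keys c \<subseteq> tuples (carrier X) n"
  obtains c' where "Poly_Mapping.keys c' \<subseteq> tuples (cells F 0) n" "push (map (\<epsilon> 0)) c' = c"
proof
  let ?i = "inv_into (cells F 0) (\<epsilon> 0)"
  have i: "?i x \<in> cells F 0" "\<epsilon> 0 (?i x) = x" if "x \<in> carrier X" for x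
    using that eps_onto by (auto intro: inv_into_into f_inv_into_f)
  show "Poly_Mapping.keys (push (map ?i) c) \<subseteq> tuples (cells F 0) n"
    by (rule keys_push_subset[OF assms map_tuples]) (use i in auto)
  show "push (map (\<epsilon> 0)) (push (map ?i) c) = c"
    unfolding push_push by (rule push_ident) (use assms i in \<open>auto intro!: map_idI simp: subset_iff\<close>)
qed

lemma inflate_inj:
  assumes "r \<in> carrier (hom_group (Xchains (Suc n)) A)" "r' \<in> carrier (hom_group (Xchains (Suc n)) A)"
    "inflate n r = inflate n r'"
  shows "r = r'"
proof (rule hom_group_eqI[OF assms(1,2)])
  fix c assume "c \<in> carrier (Xchains (Suc n))"
  then have "Poly_Mapping.keys c \<subseteq> tuples (carrier X) (Suc n)" by simp
  then obtain c' where "Poly_Mapping.keys c' \<subseteq> tuples (cells F 0) (Suc n)" "push (map (\<epsilon> 0)) c' = c"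
    by (rule push_eps_onto)
  then show "r c = r' c" using inflate_apply[of c' n r] inflate_apply[of c' n r'] assms(3) by simp
qed

lemma D_inflate:
  assumes r: "r \<in> carrier (hom_group (Xchains (Suc n)) A)"
  shows "D n 0 (inflate n r) = \<one>\<^bsub>C n (Suc 0)\<^esub>"
proof (rule C_eqI)
  fix c :: "'f list \<Rightarrow>\<^sub>0 int" assume c: "Poly_Mapping.keys c \<subseteq> tuples (cells F (Suc 0)) (Suc n)"
  have "push (map (\<epsilon> 0)) (push (map (face F (Suc 0) i)) c) = push (map (\<epsilon> (Suc 0))) c" if "i \<le> Suc 0" for i
    unfolding push_push by (rule push_cong) (use c that eps_face[of _ 0 i] in \<open>auto simp: subset_iff\<close>)
  then have "push (map (\<epsilon> 0)) (simplicial_boundary (Fpow (Suc n)) 0 c) = 0"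
    by (simp add: simplicial_boundary_push push_diff)
  moreover have "r 0 = \<one>\<^bsub>A\<^esub>"
    using r hom_free_abelian_linear(1)[OF comm_A] unfolding hom_group_carrier by blast
  ultimately show "D n 0 (inflate n r) c = \<one>\<^bsub>C n (Suc 0)\<^esub> c"
    unfolding D_apply[OF c] inflate_apply[OF sb_keys[OF c]] one_C[OF c] by simp
qed (rule one_closed_C hom_in_carrier[OF D_C hom_in_carrier[OF inflate_hom r]])+

text \<open>In degree 0 the contraction of the powers of F is a homotopy from \<open>g \<circ> \<epsilon>\<close> to the identity, so a
  cochain with \<open>D a = 0\<close> is the pullback of \<open>a \<circ> g\<close>.\<close>

lemma inflate_onto:
  assumes a: "a \<in> carrier (C n 0)" and Da: "D n 0 a = \<one>\<^bsub>C n (Suc 0)\<^esub>"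
  obtains r where "r \<in> carrier (hom_group (Xchains (Suc n)) A)" "inflate n r = a"
proof -
  let ?S = "\<lambda>q. tuples (cells F q) (Suc n)"
  obtain t g where
    keys: "\<And>q w. w \<in> ?S q \<Longrightarrow> Poly_Mapping.keys (t q w) \<subseteq> ?S (Suc q)"
    "\<And>v. v \<in> tuples (carrier X) (Suc n) \<Longrightarrow> Poly_Mapping.keys (g v) \<subseteq> ?S 0"
    and t: "\<And>w. w \<in> ?S 0 \<Longrightarrow> simplicial_boundary (Fpow (Suc n)) 0 (t 0 w) = frag_of w - g (map (\<epsilon> 0) w)"
    "\<And>q w. w \<in> ?S (Suc q) \<Longrightarrow>
      simplicial_boundary (Fpow (Suc n)) (Suc q) (t (Suc q) w) +
      frag_extend (t q) (simplicial_boundary (Fpow (Suc n)) q (frag_of w)) = frag_of w"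
    by (rule simplicial_power_contraction[OF simp_F weak, of "Suc n"]) (rule that)
  have t': "c - frag_extend g (push (map (\<epsilon> 0)) c) = simplicial_boundary (Fpow (Suc n)) 0 (frag_extend (t 0) c)"
    if "Poly_Mapping.keys c \<subseteq> ?S 0" for c
    using that
  proof (induction c rule: frag_induction)
    case (one w)
    from t(1)[OF this] show ?case by simp
  next
    case (diff a b)
    show ?case
      unfolding simplicial_boundary_diff frag_extend_diff push_diff diff[symmetric] by (simp add: algebra_simps)
  qed simp
  have aS: "a \<in> carrier (hom_group (free_Abelian_group (?S 0)) A)" using a by (simp add: C_def)
  have pk: "Poly_Mapping.keys (push (map (\<epsilon> 0)) c) \<subseteq> tuples (carrier X) (Suc n)" if "Poly_Mapping.keys c \<subseteq> ?S 0" for c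
    using hom_in_carrier[OF push_eps_hom[of n], of c] that by simp
  have "a (c - frag_extend g (push (map (\<epsilon> 0)) c)) = \<one>\<^bsub>A\<^esub>" if c: "Poly_Mapping.keys c \<subseteq> ?S 0" for c
  proof -
    have k: "Poly_Mapping.keys (frag_extend (t 0) c) \<subseteq> ?S (Suc 0)"
      by (rule keys_extend_subset[OF c keys(1)])
    show ?thesis unfolding t'[OF c] D_apply[OF k, symmetric] Da using one_C[OF k] by simp
  qed
  from hom_group_section[OF comm_A aS pk keys(2) this] show ?thesis
    using that unfolding inflate_def by blast
qed

lemma d_inflate:
  assumes r: "r \<in> carrier (hom_group (Xchains (Suc n)) A)"
  shows "d n 0 (inflate n r) = inflate (Suc n) (compose (carrier (Xchains (Suc (Suc n)))) r (rack_boundary X))"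
proof (rule C_eqI)
  show "d n 0 (inflate n r) \<in> carrier (C (Suc n) 0)"
    by (rule hom_in_carrier[OF d_C hom_in_carrier[OF inflate_hom r]])
  show "inflate (Suc n) (compose (carrier (Xchains (Suc (Suc n)))) r (rack_boundary X)) \<in> carrier (C (Suc n) 0)"
    by (rule hom_in_carrier[OF inflate_hom hom_group_compose[OF _ rack_boundary_hom[OF rack_X] r]]) simp
  fix c :: "'f list \<Rightarrow>\<^sub>0 int" assume c: "Poly_Mapping.keys c \<subseteq> tuples (cells F 0) (Suc (Suc n))"
  have "rack_boundary X (push (map (\<epsilon> 0)) c) = push (map (\<epsilon> 0)) (rack_boundary (level F 0) c)"
    by (rule rack_boundary_natural[OF eps_hom]) (use c in auto)
  moreover have "push (map (\<epsilon> 0)) c \<in> carrier (Xchains (Suc (Suc n)))"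
    using hom_in_carrier[OF push_eps_hom[of "Suc n"], of c] c by simp
  ultimately show "d n 0 (inflate n r) c = inflate (Suc n) (compose (carrier (Xchains (Suc (Suc n)))) r (rack_boundary X)) c"
    unfolding d_apply[OF c] inflate_apply[OF rb_keys[OF c]] inflate_apply[OF c] by (simp add: compose_def)
qed

text \<open>Pulling back along \<open>\<epsilon>\<close> identifies the cochains of X with the kernel of D in the column
  \<open>q = 0\<close>, compatibly with d.  For \<open>n = 0\<close> there are no boundaries, because the differential from
  degree 0 to degree 1 of rack cochains vanishes.\<close>

theorem rack_cohomology_edge: "rack_cohomology X A (Suc n) \<cong> cocycles n 0 Mod boundaries n 0"
proof -
  define R where "R m = hom_group (Xchains m) A" for m
  define \<delta> where "\<delta> m r = compose (carrier (Xchains (Suc m))) r (rack_boundary X)" for m and r :: "('x list \<Rightarrow>\<^sub>0 int) \<Rightarrow> 'a"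
  have R_chains: "hom_group (rack_chains X m) A = R m" for m by (simp add: R_def rack_chains_def)
  have RG: "comm_group (R m)" for m unfolding R_def by (rule hom_group_comm_group[OF _ comm_A]) simp
  have \<delta>: "\<delta> m \<in> hom (R m) (R (Suc m))" for m
    using hom_group_compose_hom[OF _ rack_boundary_hom[OF rack_X]] unfolding R_def \<delta>_def[abs_def] by simp
  have \<delta>_gh: "group_hom (R m) (R (Suc m)) (\<delta> m)" for m
    using RG \<delta> by (simp add: group_hom_def group_hom_axioms_def comm_group_def)
  have inf: "inflate m \<in> hom (R (Suc m)) (C m 0)" for m unfolding R_def by (rule inflate_hom)
  have inf_gh: "group_hom (R (Suc m)) (C m 0) (inflate m)" for m
    using RG C_comm_group inf by (simp add: group_hom_def group_hom_axioms_def comm_group_def)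
  have d_inf: "d m 0 (inflate m r) = inflate (Suc m) (\<delta> (Suc m) r)" if "r \<in> carrier (R (Suc m))" for m r
    using d_inflate that by (simp add: R_def \<delta>_def)
  have inf_inj: "r = r'" if "r \<in> carrier (R (Suc m))" "r' \<in> carrier (R (Suc m))" "inflate m r = inflate m r'" for m r r'
    using inflate_inj that by (simp add: R_def)
  have inf_onto: "\<exists>r\<in>carrier (R (Suc m)). inflate m r = a" if "a \<in> carrier (C m 0)" "D m 0 a = \<one>\<^bsub>C m (Suc 0)\<^esub>" for a m
    using inflate_onto[OF that] by (auto simp: R_def)
  have D_inf: "D m 0 (inflate m r) = \<one>\<^bsub>C m (Suc 0)\<^esub>" if "r \<in> carrier (R (Suc m))" for m r
    using D_inflate that by (simp add: R_def)
  define Z where "Z = R (Suc n) \<lparr>carrier := kernel (R (Suc n)) (R (Suc (Suc n))) (\<delta> (Suc n))\<rparr>"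
  have Z: "r \<in> carrier Z \<longleftrightarrow> r \<in> carrier (R (Suc n)) \<and> inflate n r \<in> carrier (cocycles n 0)" for r
  proof -
    have "\<delta> (Suc n) r = \<one>\<^bsub>R (Suc (Suc n))\<^esub> \<longleftrightarrow> d n 0 (inflate n r) = \<one>\<^bsub>C (Suc n) 0\<^esub>" if r: "r \<in> carrier (R (Suc n))"
      unfolding d_inf[OF r] using inf_inj[of "\<delta> (Suc n) r" "Suc n" "\<one>\<^bsub>R (Suc (Suc n))\<^esub>"]
        hom_in_carrier[OF \<delta> r] group_hom.hom_one[OF inf_gh, of "Suc n"]
        monoid.one_closed[of "R (Suc (Suc n))"] RG by (auto simp: comm_group_def group_def)
    then show ?thesis
      using hom_in_carrier[OF inf] D_inf by (auto simp: Z_def kernel_def cocycles_def)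
  qed
  have Z_sub: "subgroup (carrier Z) (R (Suc n))"
    unfolding Z_def using group_hom.subgroup_kernel[OF \<delta>_gh] by simp
  have Z_group: "group Z"
    unfolding Z_def
    using subgroup.subgroup_is_group[OF group_hom.subgroup_kernel[OF \<delta>_gh]] RG by (simp add: comm_group_def)
  have Z_comm: "comm_group Z"
    using subgroup_comm_group[OF RG Z_sub] by (simp add: Z_def)
  have bound: "\<delta> n r \<in> carrier Z \<and> inflate n (\<delta> n r) \<in> boundaries n 0" if r: "r \<in> carrier (R n)" for r
  proof -
    have "inflate n (\<delta> n r) \<in> boundaries n 0"
    proof (cases n)
      case 0
      have "\<delta> 0 r = \<one>\<^bsub>R 1\<^esub>"
      proof -
        have "\<delta> 0 r c = \<one>\<^bsub>R 1\<^esub> c" if c: "c \<in> carrier (Xchains 1)" for c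
        proof -
          have "Poly_Mapping.keys c \<subseteq> tuples (carrier X) 1" using c by simp
          then have "rack_boundary X c = 0"
            by (induction c rule: frag_induction) (auto simp: length_Suc_conv rack_boundary_Cons rack_boundary_diff)
          moreover have "r 0 = \<one>\<^bsub>A\<^esub>"
            using r hom_free_abelian_linear(1)[OF comm_A] unfolding R_def hom_group_carrier by blast
          ultimately show ?thesis using c by (simp add: \<delta>_def compose_def R_def hom_group_one)
        qed
        then show ?thesis
          using hom_in_carrier[OF \<delta>[of 0], of r] r 0 monoid.one_closed[of "R 1"] RG[of 1] hom_group_eqI[of _ "Xchains 1" A]
          by (auto simp: R_def comm_group_def group_def)
      qed
      then show ?thesis using group_hom.hom_one[OF inf_gh, of 0] 0 by (simp add: boundaries_def)
    next
      case (Suc m)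
      then show ?thesis
        using d_inf[of r m] r D_inf[of r m] hom_in_carrier[OF inf[of m], of r]
        by (auto simp: boundaries_def kernel_def intro!: image_eqI[of _ _ "inflate m r"])
    qed
    then show ?thesis using boundaries_subset[of n 0] hom_in_carrier[OF \<delta> r] by (auto simp: Z)
  qed
  have bound': "r \<in> \<delta> n ` carrier (R n)" if r: "r \<in> carrier Z" and b: "inflate n r \<in> boundaries n 0" for r
  proof (cases n)
    case 0
    have rR: "r \<in> carrier (R (Suc 0))" using r Z 0 by auto
    have "inflate 0 r = inflate 0 \<one>\<^bsub>R (Suc 0)\<^esub>"
      using b 0 group_hom.hom_one[OF inf_gh, of 0] by (simp add: boundaries_def)
    then have "r = \<one>\<^bsub>R (Suc 0)\<^esub>"
      using inf_inj rR monoid.one_closed[of "R (Suc 0)"] RG[of "Suc 0"] by (simp add: comm_group_def group_def)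
    also have "\<dots> = \<delta> 0 \<one>\<^bsub>R 0\<^esub>" using group_hom.hom_one[OF \<delta>_gh, of 0] by simp
    finally show ?thesis
      using 0 monoid.one_closed[of "R 0"] RG[of 0] by (auto simp: comm_group_def group_def)
  next
    case (Suc m)
    then obtain e where e: "e \<in> carrier (C m 0)" "D m 0 e = \<one>\<^bsub>C m (Suc 0)\<^esub>" "inflate n r = d m 0 e"
      using b by (auto simp: boundaries_def kernel_def)
    then obtain r' where r': "r' \<in> carrier (R (Suc m))" "inflate m r' = e" using inf_onto by blast
    then have "inflate n r = inflate n (\<delta> n r')" using d_inf[of r' m] e Suc by simp
    then have "r = \<delta> n r'" using inf_inj[of r n "\<delta> n r'"] r Z hom_in_carrier[OF \<delta>[of n], of r'] r' Suc by auto
    then show ?thesis using r' Suc by auto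
  qed
  have im: "\<delta> n ` carrier (R n) \<lhd> Z"
  proof (rule comm_group.subgroup_imp_normal[OF Z_comm])
    have "subgroup (\<delta> n ` carrier (R n)) (R (Suc n))"
      by (rule group_hom.subgroup_img_is_subgroup[OF \<delta>_gh group.subgroup_self]) (use RG in \<open>simp add: comm_group_def\<close>)
    then have "subgroup (\<delta> n ` carrier (R n)) (R (Suc n) \<lparr>carrier := carrier Z\<rparr>)"
      using group.subgroup_incl[of "R (Suc n)", OF _ _ Z_sub] RG bound by (auto simp: comm_group_def)
    moreover have "R (Suc n) \<lparr>carrier := carrier Z\<rparr> = Z" by (simp add: Z_def)
    ultimately show "subgroup (\<delta> n ` carrier (R n)) Z" by simp
  qed
  have "Z Mod \<delta> n ` carrier (R n) \<cong> cocycles n 0 Mod boundaries n 0"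
  proof (rule FactGroup_iso_span[OF Z_group Z_group _ im boundaries_normal])
    show "group (cocycles n 0)" using cocycles_comm_group by (simp add: comm_group_def)
    show "(\<lambda>r. r) \<in> hom Z Z" "(\<lambda>r. r) ` carrier Z = carrier Z" by (auto simp: hom_def)
    show "inflate n \<in> hom Z (cocycles n 0)"
      using hom_mult[OF inf] by (auto intro!: homI simp: Z) (simp add: Z_def cocycles_def)
    show "inflate n ` carrier Z = carrier (cocycles n 0)"
    proof (intro equalityI subsetI)
      fix a assume a: "a \<in> carrier (cocycles n 0)"
      then obtain r where "r \<in> carrier (R (Suc n))" "inflate n r = a"
        using inf_onto[of a n] by (auto simp: cocycles_def kernel_def)
      with a show "a \<in> inflate n ` carrier Z" by (intro image_eqI[of _ _ r]) (auto simp: Z)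
    qed (auto simp: Z)
    show "r \<in> \<delta> n ` carrier (R n) \<longleftrightarrow> inflate n r \<in> boundaries n 0" if "r \<in> carrier Z" for r
      using bound bound' that by auto
  qed
  moreover have "rack_cohomology X A (Suc n) = Z Mod \<delta> n ` carrier (R n)"
    unfolding rack_cohomology_def cohomology_def nat.case R_chains Z_def
    by (simp add: \<delta>_def[abs_def] rack_chains_def)
  ultimately show ?thesis by simp
qed

end

subsection \<open>The edge of Quillen cochains\<close>

context rack_resolution
begin

abbreviation "M \<equiv> trivial_beck_module X A"

abbreviation Omega_level where "Omega_level q \<equiv> Omega X (level F q) (\<epsilon> q)"

abbreviation unit where "unit q \<equiv> Omega_unit X (level F q) (\<epsilon> q)"

abbreviation "Q q \<equiv> beck_hom_group (Omega_level q) M"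

abbreviation "\<Delta> \<equiv> quillen_coboundary X F \<epsilon> M"

lemma slice: "slice_object X (level F q) (\<epsilon> q)"
  by (intro slice_object.intro rack_X F.level_rack eps_hom)

lemma M_beck: "beck_module X M"
  by (rule trivial_beck_module_is_beck_module[OF rack_X comm_A])

lemma Omega_beck: "beck_module X (Omega_level q)"
  by (rule slice_object.Omega_beck_module[OF slice])

lemma Q_comm_group: "comm_group (Q q)"
  by (rule beck_hom_group_is_comm_group[OF Omega_beck M_beck])

lemma unit_slice: "unit q \<in> slice_hom (level F q) (\<epsilon> q) (Omega_level q) (proj (Omega_level q))"
  by (rule slice_object.Omega_unit_hom[OF slice])

lemma slice_hom_comp:
  "\<lbrakk>f \<in> slice_hom Y p Z r; g \<in> slice_hom Z r W s\<rbrakk> \<Longrightarrow> g \<circ> f \<in> slice_hom Y p W s"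
  by (auto simp: slice_hom_def rack_hom_def Pi_iff)

lemma Q_slice: "k \<in> carrier (Q q) \<Longrightarrow> k \<in> slice_hom (Omega_level q) (proj (Omega_level q)) M (proj M)"
  by (simp add: beck_hom_group_def beck_hom_def)

lemma unit_closed: "y \<in> cells F q \<Longrightarrow> unit q y \<in> carrier (Omega_level q)"
  using unit_slice[of q] by (auto simp: slice_hom_def rack_hom_def)

lemma Q_unit:
  assumes "k \<in> carrier (Q q)" "y \<in> cells F q"
  shows "fst (k (unit q y)) \<in> carrier A" "snd (k (unit q y)) = \<epsilon> q y"
  using slice_hom_comp[OF unit_slice Q_slice[OF assms(1)]] assms(2)
  by (auto simp: slice_hom_def rack_hom_def Pi_iff mem_Times_iff)

lemma Q_unit_act:
  assumes "k \<in> carrier (Q q)" "y \<in> cells F q" "z \<in> cells F q"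
  shows "fst (k (unit q (y \<rhd>\<^bsub>level F q\<^esub> z))) = fst (k (unit q z))"
  using slice_hom_comp[OF unit_slice Q_slice[OF assms(1)]] assms(2,3)
  by (auto simp: slice_hom_def rack_hom_def split_beta)

lemma Q_eval_hom:
  assumes "y \<in> cells F q"
  shows "group_hom (Q q) A (\<lambda>k. fst (k (unit q y)))"
proof -
  have "(\<lambda>k. fst (k (unit q y))) \<in> hom (Q q) A"
    using Q_unit(1)[OF _ assms] unit_closed[OF assms]
    by (intro homI) (auto simp: beck_hom_group_def split_beta)
  then show ?thesis
    using Q_comm_group comm_A by (simp add: group_hom_def group_hom_axioms_def comm_group_def)
qed

lemma Q_eqI:
  assumes k: "k \<in> carrier (Q q)" and l: "l \<in> carrier (Q q)"
    and eq: "\<And>y. y \<in> cells F q \<Longrightarrow> fst (k (unit q y)) = fst (l (unit q y))"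
  shows "k = l"
proof -
  have "l \<circ> unit q \<in> slice_hom (level F q) (\<epsilon> q) M (proj M)"
    by (rule slice_hom_comp[OF unit_slice Q_slice[OF l]])
  note uniq = slice_object.Omega_lift_unique[OF slice M_beck this]
  have "k (unit q y) = l (unit q y)" if "y \<in> cells F q" for y
    using eq[OF that] Q_unit(2)[OF k that] Q_unit(2)[OF l that] by (simp add: prod_eq_iff)
  then show ?thesis using uniq[OF k] uniq[OF l] by simp
qed

text \<open>The boundary of a pair \<open>[y, z]\<close> is \<open>[y \<rhd> z] - [z]\<close>.\<close>

lemma d_zero_iff:
  assumes \<phi>: "\<phi> \<in> carrier (C 0 q)"
  shows "d 0 q \<phi> = \<one>\<^bsub>C (Suc 0) q\<^esub> \<longleftrightarrow>
    (\<forall>y\<in>cells F q. \<forall>z\<in>cells F q. \<phi> (frag_of [y \<rhd>\<^bsub>level F q\<^esub> z]) = \<phi> (frag_of [z]))"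
proof -
  interpret A: comm_group A by (rule comm_A)
  let ?S = "tuples (cells F q)"
  have "\<phi> \<in> hom (free_Abelian_group (?S (Suc 0))) A" using \<phi> by (simp add: C_carrier)
  note lin = hom_free_abelian_linear[OF comm_A this]
  have act: "y \<rhd>\<^bsub>level F q\<^esub> z \<in> cells F q" if "y \<in> cells F q" "z \<in> cells F q" for y z
    using rack_act_closed[OF F.level_rack, of y q z] that by simp
  have pair: "\<phi> (rack_boundary (level F q) (frag_of [y, z])) = \<one>\<^bsub>A\<^esub> \<longleftrightarrow>
      \<phi> (frag_of [y \<rhd>\<^bsub>level F q\<^esub> z]) = \<phi> (frag_of [z])" if "y \<in> cells F q" "z \<in> cells F q" for y z
  proof -
    have k: "Poly_Mapping.keys (frag_of [y \<rhd>\<^bsub>level F q\<^esub> z]) \<subseteq> ?S (Suc 0)" "Poly_Mapping.keys (frag_of [z]) \<subseteq> ?S (Suc 0)"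
      using that act by auto
    have "rack_boundary (level F q) (frag_of [y, z]) = frag_of [y \<rhd>\<^bsub>level F q\<^esub> z] - frag_of [z]"
      by (simp add: rack_boundary_Cons)
    then show ?thesis
      using lin(4)[OF k] lin(2)[OF k(1)] lin(2)[OF k(2)] A.inv_equality A.inv_inv A.inv_closed A.r_inv by metis
  qed
  show ?thesis
  proof
    assume *: "d 0 q \<phi> = \<one>\<^bsub>C (Suc 0) q\<^esub>"
    show "\<forall>y\<in>cells F q. \<forall>z\<in>cells F q. \<phi> (frag_of [y \<rhd>\<^bsub>level F q\<^esub> z]) = \<phi> (frag_of [z])"
    proof (intro ballI)
      fix y z assume yz: "y \<in> cells F q" "z \<in> cells F q"
      then have c: "Poly_Mapping.keys (frag_of [y, z]) \<subseteq> ?S (Suc (Suc 0))" by simp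
      then show "\<phi> (frag_of [y \<rhd>\<^bsub>level F q\<^esub> z]) = \<phi> (frag_of [z])"
        using pair[OF yz] d_apply[OF c, of \<phi>] one_C[OF c] * by simp
    qed
  next
    assume *: "\<forall>y\<in>cells F q. \<forall>z\<in>cells F q. \<phi> (frag_of [y \<rhd>\<^bsub>level F q\<^esub> z]) = \<phi> (frag_of [z])"
    show "d 0 q \<phi> = \<one>\<^bsub>C (Suc 0) q\<^esub>"
    proof (rule C_eqI)
      fix c :: "'f list \<Rightarrow>\<^sub>0 int" assume c: "Poly_Mapping.keys c \<subseteq> ?S (Suc (Suc 0))"
      then have "Poly_Mapping.keys c \<subseteq> ?S (Suc (Suc 0)) \<and> \<phi> (rack_boundary (level F q) c) = \<one>\<^bsub>A\<^esub>"
      proof (induction c rule: frag_induction)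
        case (one w)
        then obtain y z where "w = [y, z]" "y \<in> cells F q" "z \<in> cells F q" by (auto simp: length_Suc_conv)
        then show ?case using * pair by simp
      next
        case (diff a b)
        then show ?case
          using lin(4)[OF rb_keys rb_keys, of a b] keys_diff_subset[of a "?S (Suc (Suc 0))" b]
          by (simp add: rack_boundary_diff)
      qed (simp add: lin(1))
      then show "d 0 q \<phi> c = \<one>\<^bsub>C (Suc 0) q\<^esub> c" using d_apply[OF c] one_C[OF c] by simp
    qed (use hom_in_carrier[OF d_C \<phi>] one_closed_C in auto)
  qed
qed

definition adjoint :: "nat \<Rightarrow> (('f list \<Rightarrow>\<^sub>0 int) \<Rightarrow> 'a) \<Rightarrow> 'x \<times> ('f, 'x) bterm set \<Rightarrow> 'a \<times> 'x" where
  "adjoint q \<phi> = Omega_lift X (level F q) (\<epsilon> q) M (\<lambda>y. (\<phi> (frag_of [y]), \<epsilon> q y))"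

text \<open>The cochains of this group are, by \<open>d_zero_iff\<close>, the homomorphisms from \<open>F\<^sub>q\<close> to the trivial
  rack A.\<close>

definition invariant :: "nat \<Rightarrow> (('f list \<Rightarrow>\<^sub>0 int) \<Rightarrow> 'a) monoid" where
  "invariant q = C 0 q \<lparr>carrier := kernel (C 0 q) (C (Suc 0) q) (d 0 q)\<rparr>"

lemma invariant_carrier: "\<phi> \<in> carrier (invariant q) \<longleftrightarrow> \<phi> \<in> carrier (C 0 q) \<and> d 0 q \<phi> = \<one>\<^bsub>C (Suc 0) q\<^esub>"
  by (simp add: invariant_def kernel_def)

lemma invariant_group: "group (invariant q)"
  unfolding invariant_def
  using subgroup.subgroup_is_group[OF group_hom.subgroup_kernel[OF d_group_hom]] C_comm_group
  by (simp add: comm_group_def)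

lemma C_value: "\<lbrakk>\<phi> \<in> carrier (C 0 q); y \<in> cells F q\<rbrakk> \<Longrightarrow> \<phi> (frag_of [y]) \<in> carrier A"
  using hom_free_abelian_linear(2)[OF comm_A, of \<phi> "tuples (cells F q) (Suc 0)" "frag_of [y]"]
  by (simp add: C_carrier)

lemma adjoint_slice:
  assumes "\<phi> \<in> carrier (invariant q)"
  shows "(\<lambda>y. (\<phi> (frag_of [y]), \<epsilon> q y)) \<in> slice_hom (level F q) (\<epsilon> q) M (proj M)"
  using assms d_zero_iff[of \<phi> q] C_value eps_closed eps_hom[of q]
  by (auto simp: invariant_carrier slice_hom_def rack_hom_def)

lemma adjoint_closed: "\<phi> \<in> carrier (invariant q) \<Longrightarrow> adjoint q \<phi> \<in> carrier (Q q)"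
  unfolding adjoint_def by (rule slice_object.Omega_lift_hom[OF slice M_beck adjoint_slice])

lemma adjoint_unit: "\<lbrakk>\<phi> \<in> carrier (invariant q); y \<in> cells F q\<rbrakk> \<Longrightarrow> adjoint q \<phi> (unit q y) = (\<phi> (frag_of [y]), \<epsilon> q y)"
  unfolding adjoint_def using slice_object.Omega_lift_unit[OF slice M_beck adjoint_slice, of \<phi> q y] by simp

lemma C0_eqI:
  assumes \<phi>: "\<phi> \<in> carrier (C 0 q)" and \<psi>: "\<psi> \<in> carrier (C 0 q)"
    and eq: "\<And>y. y \<in> cells F q \<Longrightarrow> \<phi> (frag_of [y]) = \<psi> (frag_of [y])"
  shows "\<phi> = \<psi>"
proof (rule C_eqI[OF \<phi> \<psi>])
  let ?S = "tuples (cells F q) (Suc 0)"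
  have "\<phi> \<in> hom (free_Abelian_group ?S) A" "\<psi> \<in> hom (free_Abelian_group ?S) A"
    using \<phi> \<psi> by (simp_all add: C_carrier)
  note lin = this[THEN hom_free_abelian_linear(1)[OF comm_A]] this[THEN hom_free_abelian_linear(4)[OF comm_A]]
  fix c :: "'f list \<Rightarrow>\<^sub>0 int" assume "Poly_Mapping.keys c \<subseteq> ?S"
  then have "Poly_Mapping.keys c \<subseteq> ?S \<and> \<phi> c = \<psi> c"
  proof (induction c rule: frag_induction)
    case (one w)
    then show ?case using eq by (auto simp: length_Suc_conv)
  next
    case (diff a b)
    then show ?case using lin keys_diff_subset[of a ?S b] by simp
  qed (use lin in simp)
  then show "\<phi> c = \<psi> c" by simp
qed

lemma adjoint_inj: "inj_on (adjoint q) (carrier (invariant q))"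
proof (rule inj_onI)
  fix \<phi> \<psi> assume *: "\<phi> \<in> carrier (invariant q)" "\<psi> \<in> carrier (invariant q)" "adjoint q \<phi> = adjoint q \<psi>"
  show "\<phi> = \<psi>"
  proof (rule C0_eqI)
    show "\<phi> (frag_of [y]) = \<psi> (frag_of [y])" if "y \<in> cells F q" for y
      using adjoint_unit[OF *(1) that] adjoint_unit[OF *(2) that] *(3) by simp
  qed (use * in \<open>auto simp: invariant_carrier\<close>)
qed

lemma adjoint_hom: "group_hom (invariant q) (Q q) (adjoint q)"
proof -
  have "adjoint q \<in> hom (invariant q) (Q q)"
  proof (rule homI)
    fix \<phi> \<psi> assume *: "\<phi> \<in> carrier (invariant q)" "\<psi> \<in> carrier (invariant q)"
    have m: "\<phi> \<otimes>\<^bsub>invariant q\<^esub> \<psi> \<in> carrier (invariant q)"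
      by (rule monoid.m_closed[OF group.is_monoid[OF invariant_group] *])
    show "adjoint q (\<phi> \<otimes>\<^bsub>invariant q\<^esub> \<psi>) = adjoint q \<phi> \<otimes>\<^bsub>Q q\<^esub> adjoint q \<psi>"
    proof (rule Q_eqI)
      show "adjoint q (\<phi> \<otimes>\<^bsub>invariant q\<^esub> \<psi>) \<in> carrier (Q q)" by (rule adjoint_closed[OF m])
      show "adjoint q \<phi> \<otimes>\<^bsub>Q q\<^esub> adjoint q \<psi> \<in> carrier (Q q)"
        using adjoint_closed * Q_comm_group by (simp add: comm_group_def group_def monoid.m_closed)
      fix y assume y: "y \<in> cells F q"
      have "(\<phi> \<otimes>\<^bsub>invariant q\<^esub> \<psi>) (frag_of [y]) = \<phi> (frag_of [y]) \<otimes>\<^bsub>A\<^esub> \<psi> (frag_of [y])"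
        using y by (simp add: invariant_def C_def hom_group_mult)
      then show "fst (adjoint q (\<phi> \<otimes>\<^bsub>invariant q\<^esub> \<psi>) (unit q y)) = fst ((adjoint q \<phi> \<otimes>\<^bsub>Q q\<^esub> adjoint q \<psi>) (unit q y))"
        using group_hom.hom_mult[OF Q_eval_hom[OF y] adjoint_closed[OF *(1)] adjoint_closed[OF *(2)]]
          adjoint_unit[OF m y] adjoint_unit[OF *(1) y] adjoint_unit[OF *(2) y] by simp
    qed
  qed (rule adjoint_closed)
  then show ?thesis
    using invariant_group Q_comm_group by (simp add: group_hom_def group_hom_axioms_def comm_group_def)
qed

lemma adjoint_onto: "adjoint q ` carrier (invariant q) = carrier (Q q)"
proof (intro equalityI subsetI)
  fix k assume k: "k \<in> carrier (Q q)"
  let ?S = "tuples (cells F q) (Suc 0)"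
  have "(\<lambda>w. fst (k (unit q (hd w)))) ` ?S \<subseteq> carrier A"
    using Q_unit(1)[OF k] by (auto simp: length_Suc_conv)
  then obtain h where h: "h \<in> hom (free_Abelian_group ?S) A"
    and hw: "\<And>w. w \<in> ?S \<Longrightarrow> h (frag_of w) = fst (k (unit q (hd w)))"
    by (rule comm_group.free_Abelian_group_universal[OF comm_A]) (rule that)
  define \<phi> where "\<phi> = restrict h (carrier (free_Abelian_group ?S))"
  have "\<phi> \<in> hom (free_Abelian_group ?S) A"
    using hom_free_abelian_linear(2,3)[OF comm_A h]
    by (intro homI) (simp_all add: \<phi>_def keys_add_subset[of _ ?S])
  then have \<phi>: "\<phi> \<in> carrier (C 0 q)" by (simp add: C_carrier \<phi>_def)
  have \<phi>y: "\<phi> (frag_of [y]) = fst (k (unit q y))" if "y \<in> cells F q" for y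
    using hw[of "[y]"] that by (simp add: \<phi>_def)
  have "y \<rhd>\<^bsub>level F q\<^esub> z \<in> cells F q" if "y \<in> cells F q" "z \<in> cells F q" for y z
    using rack_act_closed[OF F.level_rack, of y q z] that by simp
  then have inv: "\<phi> \<in> carrier (invariant q)"
    using \<phi> \<phi>y Q_unit_act[OF k] by (simp add: invariant_carrier d_zero_iff)
  have "k = adjoint q \<phi>"
    by (rule Q_eqI[OF k adjoint_closed[OF inv]]) (simp add: adjoint_unit[OF inv] \<phi>y)
  then show "k \<in> adjoint q ` carrier (invariant q)" using inv by blast
qed (auto intro: adjoint_closed)

lemma unit_face_slice:
  assumes "i \<le> Suc q"
  shows "unit q \<circ> face F (Suc q) i \<in>
    slice_hom (level F (Suc q)) (\<epsilon> (Suc q)) (Omega_level q) (proj (Omega_level q))"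
proof (rule slice_hom_comp[OF _ unit_slice])
  show "face F (Suc q) i \<in> slice_hom (level F (Suc q)) (\<epsilon> (Suc q)) (level F q) (\<epsilon> q)"
    using F.face_hom[OF assms] eps_face[OF _ assms] by (auto simp: slice_hom_def)
qed

lemma cotangent_face_unit:
  "\<lbrakk>i \<le> Suc q; y \<in> cells F (Suc q)\<rbrakk> \<Longrightarrow>
    cotangent_face X F \<epsilon> (Suc q) i (unit (Suc q) y) = unit q (face F (Suc q) i y)"
  using slice_object.Omega_lift_unit[OF slice Omega_beck unit_face_slice, of i q y]
  by (simp add: cotangent_face_def Omega_map_def)

lemma cotangent_face_hom:
  "i \<le> Suc q \<Longrightarrow>
    cotangent_face X F \<epsilon> (Suc q) i \<in> carrier (beck_hom_group (Omega_level (Suc q)) (Omega_level q))"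
  using slice_object.Omega_lift_hom[OF slice Omega_beck unit_face_slice]
  by (simp add: cotangent_face_def Omega_map_def)

lemma beck_hom_compose:
  assumes "beck_module X N" "f \<in> carrier (beck_hom_group N N')" "g \<in> carrier (beck_hom_group N' N'')"
  shows "compose (carrier N) g f \<in> carrier (beck_hom_group N N'')"
proof -
  interpret N: beck_module X N by fact
  show ?thesis
    using assms(2,3) N.badd_closed rack_act_closed[OF N.rack_M]
    by (auto simp: beck_hom_group_def beck_hom_def slice_hom_def rack_hom_def compose_def Pi_iff)
qed

text \<open>Morphisms out of \<open>\<Omega> F\<^sub>q\<close> are determined by their values at the units, and the value of either
  side at the unit of y is the alternating sum of the values of \<open>\<phi>\<close> at the faces of y.\<close>

lemma coboundary_adjoint:
  assumes \<phi>: "\<phi> \<in> carrier (invariant q)"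
  shows "\<Delta> q (adjoint q \<phi>) = adjoint (Suc q) (D 0 q \<phi>)"
proof -
  interpret Q: comm_group "Q (Suc q)" by (rule Q_comm_group)
  interpret A: comm_group A by (rule comm_A)
  let ?T = "\<lambda>i. compose (carrier (Omega_level (Suc q))) (adjoint q \<phi>) (cotangent_face X F \<epsilon> (Suc q) i)"
  let ?P = "\<lambda>m. finprod (Q (Suc q)) (\<lambda>i. ?T i [^]\<^bsub>Q (Suc q)\<^esub> ((-1) ^ i :: int)) {..m}"
  have \<Delta>: "\<Delta> q (adjoint q \<phi>) = ?P (Suc q)"
    by (simp add: quillen_coboundary_def quillen_cochains_def cotangent_def)
  have \<phi>C: "\<phi> \<in> carrier (C 0 q)" using \<phi> by (simp add: invariant_carrier)
  then have "\<phi> \<in> hom (free_Abelian_group (tuples (cells F q) (Suc 0))) A" by (simp add: C_carrier)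
  note lin = hom_free_abelian_linear[OF comm_A this]
  have T: "?T i \<in> carrier (Q (Suc q))" if "i \<le> Suc q" for i
    by (rule beck_hom_compose[OF Omega_beck cotangent_face_hom[OF that] adjoint_closed[OF \<phi>]])
  then have TP: "?T i [^]\<^bsub>Q (Suc q)\<^esub> ((-1) ^ i :: int) \<in> carrier (Q (Suc q))" if "i \<le> Suc q" for i
    using that by simp
  have D\<phi>: "D 0 q \<phi> \<in> carrier (invariant (Suc q))"
    using \<phi> D_closed[of \<phi> 0 q] d_D[of \<phi> 0 q] group_hom.hom_one[OF D_group_hom]
    by (simp add: invariant_carrier)
  show ?thesis
    unfolding \<Delta>
  proof (rule Q_eqI)
    show "?P (Suc q) \<in> carrier (Q (Suc q))" using TP by (intro Q.finprod_closed) auto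
    show "adjoint (Suc q) (D 0 q \<phi>) \<in> carrier (Q (Suc q))" by (rule adjoint_closed[OF D\<phi>])
    fix y assume y: "y \<in> cells F (Suc q)"
    interpret e: group_hom "Q (Suc q)" A "\<lambda>k. fst (k (unit (Suc q) y))" by (rule Q_eval_hom[OF y])
    let ?t = "\<lambda>i. frag_cmul ((-1) ^ i) (frag_of [face F (Suc q) i y])"
    have t: "Poly_Mapping.keys (?t i) \<subseteq> tuples (cells F q) (Suc 0)" if "i \<le> Suc q" for i
      using F.face_closed[OF y that] by (intro keys_cmul_subset) simp
    have eT: "fst ((?T i [^]\<^bsub>Q (Suc q)\<^esub> ((-1) ^ i :: int)) (unit (Suc q) y)) = \<phi> (?t i)" if i: "i \<le> Suc q" for i
    proof -
      have fy: "face F (Suc q) i y \<in> cells F q" by (rule F.face_closed[OF y i])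
      then have "fst (?T i (unit (Suc q) y)) = \<phi> (frag_of [face F (Suc q) i y])"
        using cotangent_face_unit[OF i y] adjoint_unit[OF \<phi> fy] unit_closed[OF y] by (simp add: compose_def)
      then show ?thesis using e.hom_int_pow[OF T[OF i]] lin(5)[of "frag_of [face F (Suc q) i y]"] fy by simp
    qed
    have "fst (?P m (unit (Suc q) y)) = \<phi> (\<Sum>i\<le>m. ?t i)" if "m \<le> Suc q" for m
      using that
    proof (induction m)
      case 0
      have "?P 0 = ?T 0 [^]\<^bsub>Q (Suc q)\<^esub> ((-1) ^ 0 :: int)"
        by (rule Q.finprod_0) (use TP[of 0] in auto)
      then show ?case using eT[of 0] by simp
    next
      case (Suc m)
      have "?P (Suc m) = (?T (Suc m) [^]\<^bsub>Q (Suc q)\<^esub> ((-1) ^ Suc m :: int)) \<otimes>\<^bsub>Q (Suc q)\<^esub> ?P m"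
        by (rule Q.finprod_Suc) (use TP Suc.prems in auto)
      moreover have "?P m \<in> carrier (Q (Suc q))" using TP Suc.prems by (intro Q.finprod_closed) auto
      ultimately have "fst (?P (Suc m) (unit (Suc q) y)) = \<phi> (?t (Suc m)) \<otimes>\<^bsub>A\<^esub> \<phi> (\<Sum>i\<le>m. ?t i)"
        using e.hom_mult[OF TP[OF Suc.prems], of "?P m"] eT[OF Suc.prems] Suc by simp
      also have "\<dots> = \<phi> (?t (Suc m) + (\<Sum>i\<le>m. ?t i))"
      proof (rule lin(3)[symmetric])
        show "Poly_Mapping.keys (?t (Suc m)) \<subseteq> tuples (cells F q) (Suc 0)" by (rule t[OF Suc.prems])
        show "Poly_Mapping.keys (\<Sum>i\<le>m. ?t i) \<subseteq> tuples (cells F q) (Suc 0)"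
          by (rule keys_sum_subset, rule t) (use Suc.prems in simp)
      qed
      finally show ?case by (simp add: add.commute)
    qed
    from this[of "Suc q"] have "fst (?P (Suc q) (unit (Suc q) y)) = \<phi> (simplicial_boundary (Fpow (Suc 0)) q (frag_of [y]))"
      by (simp add: simplicial_boundary_def del: sum.atMost_Suc)
    then show "fst (?P (Suc q) (unit (Suc q) y)) = fst (adjoint (Suc q) (D 0 q \<phi>) (unit (Suc q) y))"
      using adjoint_unit[OF D\<phi> y] D_apply[where c = "frag_of [y]" and q = q and p = 0 and f = \<phi>] y by simp
  qed
qed

text \<open>The adjunction identifies the kernel of d in the row \<open>p = 0\<close> with the Quillen cochains, and
  D with their differential.\<close>

theorem quillen_cohomology_edge:
  "cocycles 0 n Mod boundaries 0 n \<cong> quillen_cohomology X F \<epsilon> M n"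
proof -
  let ?B = "case n of 0 \<Rightarrow> {\<one>\<^bsub>Q 0\<^esub>} | Suc m \<Rightarrow> \<Delta> m ` carrier (Q m)"
  define K where "K = Q n \<lparr>carrier := kernel (Q n) (Q (Suc n)) (\<Delta> n)\<rparr>"
  have K: "quillen_cohomology X F \<epsilon> M n = K Mod ?B"
    by (cases n) (simp_all add: quillen_cohomology_def cohomology_def quillen_cochains_def cotangent_def K_def)
  interpret inv: group "invariant n" by (rule invariant_group)
  interpret adj: group_hom "invariant n" "Q n" "adjoint n" by (rule adjoint_hom)
  have one: "\<one>\<^bsub>invariant m\<^esub> = \<one>\<^bsub>C 0 m\<^esub>" for m by (simp add: invariant_def)
  have inv_sub: "subgroup (carrier (invariant n)) (C 0 n)"
    unfolding invariant_def using group_hom.subgroup_kernel[OF d_group_hom] by simp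
  have coc: "\<phi> \<in> carrier (cocycles 0 n) \<longleftrightarrow> \<phi> \<in> carrier (invariant n) \<and> D 0 n \<phi> = \<one>\<^bsub>C 0 (Suc n)\<^esub>" for \<phi>
    by (auto simp: cocycles_def invariant_carrier kernel_def)
  have incl: "subgroup H (invariant n)" if "subgroup H (C 0 n)" "H \<subseteq> carrier (cocycles 0 n)" for H
  proof -
    have "C 0 n \<lparr>carrier := carrier (invariant n)\<rparr> = invariant n" by (simp add: invariant_def)
    then show ?thesis
      using group.subgroup_incl[OF comm_group.axioms(2)[OF C_group] that(1) inv_sub] that(2) coc by auto
  qed
  have D_inv: "D 0 m \<phi> \<in> carrier (invariant (Suc m))" if "\<phi> \<in> carrier (invariant m)" for m \<phi>
    using that D_closed[of \<phi> 0 m] d_D[of \<phi> 0 m] group_hom.hom_one[OF D_group_hom]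
    by (simp add: invariant_carrier)
  have kernel: "adjoint n ` carrier (cocycles 0 n) = carrier K"
  proof -
    have "adjoint n \<phi> \<in> carrier K \<longleftrightarrow> \<phi> \<in> carrier (cocycles 0 n)" if \<phi>: "\<phi> \<in> carrier (invariant n)" for \<phi>
    proof -
      have "adjoint (Suc n) (D 0 n \<phi>) = \<one>\<^bsub>Q (Suc n)\<^esub> \<longleftrightarrow> D 0 n \<phi> = \<one>\<^bsub>C 0 (Suc n)\<^esub>"
        using inj_on_eq_iff[OF adjoint_inj D_inv[OF \<phi>], of "\<one>\<^bsub>invariant (Suc n)\<^esub>"]
          group_hom.hom_one[OF adjoint_hom, of "Suc n"] monoid.one_closed[OF group.is_monoid[OF invariant_group]]
        by (simp add: one)
      then show ?thesis
        using adjoint_closed[OF \<phi>] \<phi> by (simp add: K_def kernel_def coboundary_adjoint[OF \<phi>] coc)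
    qed
    moreover have "carrier K \<subseteq> adjoint n ` carrier (invariant n)"
      unfolding adjoint_onto by (auto simp: K_def kernel_def)
    ultimately show ?thesis using coc by blast
  qed
  have bound: "adjoint n ` boundaries 0 n = ?B"
  proof (cases n)
    case 0
    then show ?thesis using adj.hom_one by (simp add: boundaries_def one)
  next
    case (Suc m)
    have "boundaries 0 n = D 0 m ` carrier (invariant m)"
      by (simp add: boundaries_def Suc invariant_def)
    then have "adjoint n ` boundaries 0 n = (\<lambda>\<phi>. \<Delta> m (adjoint m \<phi>)) ` carrier (invariant m)"
      by (simp add: image_image Suc coboundary_adjoint cong: image_cong_simp)
    also have "\<dots> = \<Delta> m ` carrier (Q m)"
      unfolding adjoint_onto[symmetric] image_image ..
    finally show ?thesis by (simp add: Suc)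
  qed
  have sub: "subgroup (carrier K) (Q n)" "subgroup ?B (Q n)"
    unfolding kernel[symmetric] bound[symmetric]
    by (rule adj.subgroup_img_is_subgroup[OF incl]; use cocycles_subgroup boundaries_subgroup boundaries_subset in blast)+
  have K_eq: "Q n \<lparr>carrier := carrier K\<rparr> = K" by (simp add: K_def)
  have K_comm: "comm_group K"
    using subgroup_comm_group[OF Q_comm_group sub(1)] by (simp add: K_eq)
  have "?B \<subseteq> carrier K" unfolding kernel[symmetric] bound[symmetric] using boundaries_subset by blast
  then have "subgroup ?B K"
    using group.subgroup_incl[OF _ sub(2,1)] Q_comm_group by (simp add: K_eq comm_group_def)
  then have norm: "?B \<lhd> K" by (rule comm_group.subgroup_imp_normal[OF K_comm])
  show ?thesis
    unfolding K
  proof (rule FactGroup_iso_span[OF _ _ _ boundaries_normal norm])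
    show "group (cocycles 0 n)" "group (cocycles 0 n)" "group K"
      using cocycles_comm_group K_comm by (auto simp: comm_group_def)
    show "(\<lambda>\<phi>. \<phi>) \<in> hom (cocycles 0 n) (cocycles 0 n)" "(\<lambda>\<phi>. \<phi>) ` carrier (cocycles 0 n) = carrier (cocycles 0 n)"
      by (auto simp: hom_def)
    show "adjoint n ` carrier (cocycles 0 n) = carrier K" by (rule kernel)
    show "adjoint n \<in> hom (cocycles 0 n) K"
    proof (rule homI)
      fix \<phi> \<psi> assume "\<phi> \<in> carrier (cocycles 0 n)" "\<psi> \<in> carrier (cocycles 0 n)"
      then show "adjoint n (\<phi> \<otimes>\<^bsub>cocycles 0 n\<^esub> \<psi>) = adjoint n \<phi> \<otimes>\<^bsub>K\<^esub> adjoint n \<psi>"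
        using adj.hom_mult[of \<phi> \<psi>] coc by (simp add: K_def cocycles_def invariant_def)
    qed (use kernel in blast)
    show "\<phi> \<in> boundaries 0 n \<longleftrightarrow> adjoint n \<phi> \<in> ?B" if "\<phi> \<in> carrier (cocycles 0 n)" for \<phi>
      unfolding bound[symmetric]
      using inj_on_image_mem_iff[OF adjoint_inj, of \<phi> n "boundaries 0 n"] that boundaries_subset[of 0 n] coc
      by blast
  qed
qed

end

section \<open>The comparison theorem\<close>

theorem theorem3p1:
  fixes X :: "'x rack" and A :: "'a monoid"
    and F :: "'f simplicial_rack" and \<epsilon> :: "nat \<Rightarrow> 'f \<Rightarrow> 'x" and n :: nat
  assumes "rack X" and "comm_group A"
    and "cofibrant_replacement TYPE('g) X F \<epsilon>"
  shows "rack_cohomology X A (Suc n) \<cong> quillen_cohomology X F \<epsilon> (trivial_beck_module X A) n"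
proof -
  have F: "simplicial_rack F" and \<epsilon>: "\<epsilon> \<in> simplicial_rack_maps F (constant_simplicial_rack X)"
    and w: "weak_equivalence F (constant_simplicial_rack X) \<epsilon>"
    using assms(3) by (auto simp: cofibrant_replacement_def cofibrant_def)
  obtain G :: "'g simplicial_rack" and i r where G: "free_simplicial_rack G"
    and i: "i \<in> simplicial_rack_maps F G" and r: "r \<in> simplicial_rack_maps G F"
    and ri: "\<And>q x. x \<in> cells F q \<Longrightarrow> r q (i q x) = x"
    using assms(3) unfolding cofibrant_replacement_def cofibrant_def by blast
  obtain B where B: "\<And>q. free_on (level G q) (B q)"
    using G unfolding free_simplicial_rack_def by blast
  have GR: "rack (level G q)" for q
    using G by (simp add: free_simplicial_rack_def simplicial_rack.level_rack)
  have "\<exists>s. \<forall>v\<in>lists (cells F q).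
      Poly_Mapping.keys (s v) \<subseteq> tuples (cells F q) (Suc (length v)) \<and>
      (2 \<le> length v \<longrightarrow>
        rack_boundary (level F q) (s v) + frag_extend s (rack_boundary (level F q) (frag_of v)) = frag_of v)" for q
  proof (rule retract_contraction[OF simplicial_rack.level_rack[OF F] GR _ _ _ B, of "i q" q q "r q"])
    show "i q \<in> rack_hom (level F q) (level G q)" "r q \<in> rack_hom (level G q) (level F q)"
      using i r by (auto simp: simplicial_rack_maps_def)
    show "r q (i q x) = x" if "x \<in> carrier (level F q)" for x using ri that by simp
  qed (unfold carrier_level, blast)
  then interpret rack_resolution X A F \<epsilon>
    using assms(1,2) F \<epsilon> w by (intro rack_resolution.intro)
  show ?thesis
    by (rule iso_trans[OF rack_cohomology_edge iso_trans[OF staircase quillen_cohomology_edge]])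
qed

end
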